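(* Let $\{\mathbb{X}^r\}_{r\in\mathbb{N}}$ be the sequence of systems described in the context. Then the fluid limits exist, and each component of a fluid limit is Lipschitz continuous. Each fluid limit $\bar{\mathbb{X}}=(\bar A,\bar A_d,\bar Q,\bar Z,\bar Y,\bar T,\bar D,\bar L)$ satisfies the following equations for all $t\ge 0$: \begin{align*} \bar A_{ij}(t)&=\bar A_{ij,i}(t)+\bar A_{ij,j}(t), && \forall \{i,j\}\in E,\\ \bar A_{ij}(t)&=p_{ij}\lambda \bar Y(t), && \forall \{i,j\}\in E,\\ \bar Q_j(t)&=\bar Q_j(0)+\sum_{i:\{i,j\}\in E}\bar A_{ij,j}(t)-\bar D_j(t), && j=1,\ldots,S,\\ \bar D_j(t)&=\mu \bar T_j(t), && j=1,\ldots,S,\\ \bar Y(t)&=\int_0^t \bar L(s)\,ds,\\ \bar T_j(t)&=\int_0^t \bar Z_j(s)\,ds, && j=1,\ldots,S,\\ \bar Z_j(t)&=\min\{\bar Q_j(t),\,p_j\lambda/\mu\}, && j=1,\ldots,S,\\ \bar L(t)&=1-\sum_{j=1}^S\left(\bar Q_j(t)-p_j\lambda/\mu\right)^+ . \end{align*} Also, for every $\{i,j\}\in E$, if $t$ is a regular point of $\bar{\mathbb{X}}$, then $$\bar A'_{ij,i}(t)=\lambda p_{ij}\bar L(t)\quad\text{and}\quad \bar A'_{ij,j}(t)=0\qquad\text{if } \frac{\bar Q_j(t)}{p_j}>\frac{\bar Q_i(t)}{p_i}.$$ Finally, there is a unique invariant state, given by $q=(q_1,\ldots,q_S)$ with $q_i=p_i\lambda/\mu$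 for $i=1,\ldots,S$.
   Context: Model. There are $S\ge 2$ battery swapping stations and $r$ electric vehicles (EVs); $\lambda,\mu>0$. For unordered pairs $\{i,j\}$ of distinct stations let $p_{ij}=p_{ji}\ge 0$ with $\sum_{\{i,j\}}p_{ij}=1$, and let $p_i=\frac12\sum_{j}p_{ij}$. Let $E=\{\{i,j\}:p_{ij}>0\}$; standing assumption: the graph $(\{1,\ldots,S\},E)$ is connected. Station $i$ has $B_i^r=p_i\left(\frac{\lambda r}{\mu}+\beta\sqrt{\frac{\lambda r}{\mu}}\right)$ spare batteries and $F_i^r=p_i\left(\frac{\lambda r}{\mu}+\gamma\sqrt{\frac{\lambda r}{\mu}}\right)$ charging points, where $\beta\in\mathbb{R}$, $\gamma\le\beta$ (integrality is ignored). Dynamics. Each EV not waiting at a station needs a new battery after an exponential time of rate $\lambda$; then with probability $p_{ij}$ it chooses between stations $i$ and $j$, and goes to the one with the smaller value of $Q_\cdot^r(t)/p_\cdot$ (ties broken evenly), where its battery is instantaneously swapped for a fully-charged one if available, and otherwise the EV waits there for one. Each charge takes an exponential time of rate $\mu$. Let $\Lambda_{ij}$ ($\{i,j\}\in E$) and $S_j$ ($1\le j\le S$) be independent Poisson processes of rates $p_{ij}\lambda$ and $\mu$, on a probability space $(\Omega,\mathcal F,\mathbb P)$. The process $\mathbb{X}^r=(A^r,A^r_d,Q^r,Z^r,Y^r,T^r,D^r,L^r)$ consists of: $A^r_{ij}$ (arrivals that choose between $i$ and $j$), $A^r_d=(A^r_{ij,i})$ (those arrivals routed to $i$), $Q^r_j$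 (batteries in need of charging at station $j$), $Z^r_j$ (busy charging points), $Y^r$ (aggregated time of non-waiting cars), $T^r_j$ (aggregated busy time of charging points), $D^r_j$ (charging completions), $L^r$ (number of EVs not waiting). It satisfies $A_{ij}^r=A^r_{ij,i}+A^r_{ij,j}$, $A^r_{ij}(t)=\Lambda_{ij}(Y^r(t))$, $Q^r_j(t)=Q^r_j(0)+\sum_{i:\{i,j\}\in E}A^r_{ij,j}(t)-D^r_j(t)$, $D^r_j(t)=S_j(T^r_j(t))$, $Y^r(t)=\int_0^tL^r(s)ds$, $T^r_j(t)=\int_0^tZ^r_j(s)ds$, $Z^r_j(t)=\min\{Q^r_j(t),F^r_j\}$, $L^r(t)=r-\sum_{j}(Q^r_j(t)-B^r_j)^+$, and $A^r_{ij,i}$ can only increase when $Q^r_i(t)/p_i\le Q^r_j(t)/p_j$. Here $x^+=\max\{x,0\}$. Fluid limits. $\bar{\mathbb{X}}^r=\mathbb{X}^r/r$. Let $\mathcal A\subset\Omega$, $\mathbb P(\mathcal A)=1$, be the set on which, as $r\to\infty$, $\Lambda_{ij}(rx)/r\to p_{ij}\lambda x$ for all $\{i,j\}\in E$ and $S_j(rx)/r\to\mu x$ for all $j$, uniformly on compact sets (u.o.c.). $\bar{\mathbb X}$ is a fluid limit of $\{\mathbb X^r\}$ if there exist $\omega\in\mathcal A$ and a (sub)sequence $r_l\to\infty$ such that $\bar{\mathbb X}^{r_l}(\cdot,\omega)$ converges u.o.c. to $\bar{\mathbb X}(\cdot,\omega)$. A vector $q=(q_1,\ldots,q_S)$ is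 an invariant state of the fluid limits if, for any fluid limit $\bar{\mathbb X}$, $\bar Q(0)=q$ implies $\bar Q(t)=q$ for all $t\ge0$. A time $t$ is a regular point of a function if the function is differentiable at $t$.
   Formalization: Invariant states are sought among q with q_i ≥ 0 and Σ(q_j − p_jλ/μ)^+ ≤ 1 (any other q is never Q̄(0), so vacuously invariant), over fluid limits from all admissible initial states; B_i^r, F_i^r are nonnegative and, for large r, within 1 of the formulas. *)

theory Defs
  imports "HOL-Probability.Probability"
begin

section \<open>The graph of stations\<close>

text \<open>
  Stations are the numbers \<open>1, \<dots>, S\<close>. An unordered pair of stations is a two-element set, so that
  \<open>p\<^sub>i\<^sub>j = p\<^sub>j\<^sub>i\<close> is \<open>p {i, j}\<close>, and \<open>p\<^sub>i\<close> is \<open>load S p i\<close>.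
\<close>

definition pairs :: "nat \<Rightarrow> nat set set" where
  "pairs S = {e. e \<subseteq> {1..S} \<and> card e = 2}"

definition edges :: "nat \<Rightarrow> (nat set \<Rightarrow> real) \<Rightarrow> nat set set" where
  "edges S p = {e \<in> pairs S. 0 < p e}"

definition load :: "nat \<Rightarrow> (nat set \<Rightarrow> real) \<Rightarrow> nat \<Rightarrow> real" where
  "load S p i = (\<Sum>j\<in>{1..S} - {i}. p {i, j}) / 2"

definition connected_graph :: "nat set \<Rightarrow> nat set set \<Rightarrow> bool" where
  "connected_graph V E \<longleftrightarrow> (\<forall>i\<in>V. \<forall>j\<in>V. (i, j) \<in> {(a, b). {a, b} \<in> E}\<^sup>*)"

definition halfin_whitt :: "real \<Rightarrow> real \<Rightarrow> real \<Rightarrow> real \<Rightarrow> nat \<Rightarrow> real" where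
  "halfin_whitt w lam \<mu> c r = w * (lam * real r / \<mu> + c * sqrt (lam * real r / \<mu>))"

text \<open>
  Numbers of batteries and charging points are meant to be integers, whereas the square-root
  formula is in general not an integer. A capacity sequence is therefore allowed to differ from the
  formula by a rounding error of at most 1 (error 0 being the formula itself). The formula is imposed
  for large \<open>r\<close> only, because for small \<open>r\<close> it can be negative.
\<close>

definition capacity :: "nat \<Rightarrow> (nat set \<Rightarrow> real) \<Rightarrow> real \<Rightarrow> real \<Rightarrow> real \<Rightarrow> (nat \<Rightarrow> nat \<Rightarrow> real) \<Rightarrow> bool" where
  "capacity S p lam \<mu> c K \<longleftrightarrow>
     (\<forall>r. \<forall>i\<in>{1..S}. 0 \<le> K r i) \<and>
     (\<forall>\<^sub>F r in sequentially. \<forall>i\<in>{1..S}. \<bar>K r i - halfin_whitt (load S p i) lam \<mu> c r\<bar> \<le> 1)"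


section \<open>Driving processes\<close>

text \<open>Processes have time domain \<open>{0..}\<close>; values at negative times are irrelevant.\<close>

definition poisson_process :: "'w measure \<Rightarrow> real \<Rightarrow> (real \<Rightarrow> 'w \<Rightarrow> nat) \<Rightarrow> bool" where
  "poisson_process M a N \<longleftrightarrow>
     (\<forall>t\<ge>0. N t \<in> M \<rightarrow>\<^sub>M count_space UNIV) \<and>
     (\<forall>\<omega>\<in>space M. N 0 \<omega> = 0 \<and> mono_on {0..} (\<lambda>t. N t \<omega>) \<and>
        (\<forall>t\<ge>0. continuous (at_right t) (\<lambda>t. real (N t \<omega>)))) \<and>
     (\<forall>s\<ge>0. \<forall>t>s. distr M (count_space UNIV) (\<lambda>\<omega>. N t \<omega> - N s \<omega>)
                     = measure_pmf (poisson_pmf (a * (t - s)))) \<and>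
     (\<forall>(n::nat) \<tau>. 0 \<le> \<tau> 0 \<and> mono \<tau> \<longrightarrow>
        prob_space.indep_vars M (\<lambda>_. count_space UNIV) (\<lambda>k \<omega>. N (\<tau> (Suc k)) \<omega> - N (\<tau> k) \<omega>) {..<n})"

definition process_sigma :: "'w measure \<Rightarrow> (real \<Rightarrow> 'w \<Rightarrow> nat) \<Rightarrow> 'w set set" where
  "process_sigma M N = sigma_sets (space M) {N t -` C \<inter> space M | t C. 0 \<le> t}"

definition driving_processes ::
  "'w measure \<Rightarrow> nat \<Rightarrow> (nat set \<Rightarrow> real) \<Rightarrow> real \<Rightarrow> real \<Rightarrow>
   (nat set \<Rightarrow> real \<Rightarrow> 'w \<Rightarrow> nat) \<Rightarrow> (nat \<Rightarrow> real \<Rightarrow> 'w \<Rightarrow> nat) \<Rightarrow> bool" where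
  "driving_processes M S p lam \<mu> \<Lambda> Sv \<longleftrightarrow>
     (\<forall>e\<in>edges S p. poisson_process M (p e * lam) (\<Lambda> e)) \<and>
     (\<forall>j\<in>{1..S}. poisson_process M \<mu> (Sv j)) \<and>
     prob_space.indep_sets M
       (case_sum (\<lambda>e. process_sigma M (\<Lambda> e)) (\<lambda>j. process_sigma M (Sv j)))
       (edges S p <+> {1..S})"

text \<open>
  Ties are broken by fair coins \<open>U e k\<close>, one for the \<open>k\<close>-th arrival that chooses from \<open>e\<close>,
  independent of each other and of the driving processes.
\<close>

definition fair_coins ::
  "'w measure \<Rightarrow> nat \<Rightarrow> (nat set \<Rightarrow> real) \<Rightarrow> (nat set \<Rightarrow> real \<Rightarrow> 'w \<Rightarrow> nat) \<Rightarrow>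
   (nat \<Rightarrow> real \<Rightarrow> 'w \<Rightarrow> nat) \<Rightarrow> (nat set \<Rightarrow> nat \<Rightarrow> 'w \<Rightarrow> bool) \<Rightarrow> bool" where
  "fair_coins M S p \<Lambda> Sv U \<longleftrightarrow>
     (\<forall>e\<in>edges S p. \<forall>k. U e k \<in> M \<rightarrow>\<^sub>M count_space UNIV \<and>
        distr M (count_space UNIV) (U e k) = measure_pmf (bernoulli_pmf (1/2))) \<and>
     prob_space.indep_sets M
       (case_sum
          (case_sum (\<lambda>e. process_sigma M (\<Lambda> e)) (\<lambda>j. process_sigma M (Sv j)))
          (\<lambda>(e, k). {U e k -` C \<inter> space M | C. True}))
       ((edges S p <+> {1..S}) <+> (edges S p \<times> UNIV))"


section \<open>The systems\<close>

text \<open>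
  One path of the process \<open>(A, A\<^sub>d, Q, Z, Y, T, D, L)\<close>; \<open>pAd x e i\<close> is \<open>A\<^sub>i\<^sub>j\<^sub>,\<^sub>i\<close> for \<open>e = {i, j}\<close>.
\<close>

record ev_path =
  pA :: "nat set \<Rightarrow> real \<Rightarrow> real"
  pAd :: "nat set \<Rightarrow> nat \<Rightarrow> real \<Rightarrow> real"
  pQ :: "nat \<Rightarrow> real \<Rightarrow> real"
  pZ :: "nat \<Rightarrow> real \<Rightarrow> real"
  pY :: "real \<Rightarrow> real"
  pT :: "nat \<Rightarrow> real \<Rightarrow> real"
  pD :: "nat \<Rightarrow> real \<Rightarrow> real"
  pL :: "real \<Rightarrow> real"

definition shorter_queue_routing :: "nat \<Rightarrow> (nat set \<Rightarrow> real) \<Rightarrow> ev_path \<Rightarrow> bool" where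
  \<comment> \<open>An arrival at time \<open>t\<close> joins according to the queues just before \<open>t\<close>, so \<open>A\<^sub>i\<^sub>j\<^sub>,\<^sub>i\<close> can only
      increase when \<open>Q\<^sub>i / p\<^sub>i \<le> Q\<^sub>j / p\<^sub>j\<close> just before.\<close>
  "shorter_queue_routing S p x \<longleftrightarrow>
     (\<forall>i j s t. {i, j} \<in> edges S p \<and> 0 \<le> s \<and> s < t \<and>
        (\<forall>u\<in>{s..<t}. pQ x i u / load S p i > pQ x j u / load S p j)
        \<longrightarrow> pAd x {i, j} i t = pAd x {i, j} i s)"

definition tie_breaking :: "nat \<Rightarrow> (nat set \<Rightarrow> real) \<Rightarrow> (nat set \<Rightarrow> nat \<Rightarrow> bool) \<Rightarrow> ev_path \<Rightarrow> bool" where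
  \<comment> \<open>If the queues are tied just before the \<open>k\<close>-th arrival choosing from \<open>{i, j}\<close>, \<open>i < j\<close>, then
      this arrival joins \<open>i\<close> or \<open>j\<close> according to the coin \<open>U {i, j} k\<close>.\<close>
  "tie_breaking S p U x \<longleftrightarrow>
     (\<forall>i j s t k. {i, j} \<in> edges S p \<and> i < j \<and> 0 \<le> s \<and> s < t \<and>
        (\<forall>u\<in>{s..<t}. pQ x i u / load S p i = pQ x j u / load S p j \<and>
                      pA x {i, j} u = real k) \<and>
        pA x {i, j} t = real (Suc k)
        \<longrightarrow> pAd x {i, j} i t = pAd x {i, j} i s + (if U {i, j} (Suc k) then 1 else 0))"

definition system_path ::
  "nat \<Rightarrow> (nat set \<Rightarrow> real) \<Rightarrow> nat \<Rightarrow> (nat \<Rightarrow> real) \<Rightarrow> (nat \<Rightarrow> real) \<Rightarrow>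
   (nat set \<Rightarrow> real \<Rightarrow> nat) \<Rightarrow> (nat \<Rightarrow> real \<Rightarrow> nat) \<Rightarrow> (nat set \<Rightarrow> nat \<Rightarrow> bool) \<Rightarrow> ev_path \<Rightarrow> bool" where
  "system_path S p r b f \<Lambda> Sv U x \<longleftrightarrow>
     (\<forall>e\<in>edges S p. \<forall>i\<in>e. mono_on {0..} (pAd x e i) \<and> (\<forall>t\<ge>0. pAd x e i t \<in> \<nat>)) \<and>
     (\<forall>j\<in>{1..S}. \<forall>t\<ge>0. pQ x j t \<in> \<nat>) \<and>
     (\<forall>t\<ge>0. 0 \<le> pL x t) \<and>
     (\<forall>i j. {i, j} \<in> edges S p \<longrightarrow> (\<forall>t\<ge>0. pA x {i, j} t = pAd x {i, j} i t + pAd x {i, j} j t)) \<and>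
     (\<forall>e\<in>edges S p. \<forall>t\<ge>0. pA x e t = real (\<Lambda> e (pY x t))) \<and>
     (\<forall>j\<in>{1..S}. \<forall>t\<ge>0. pQ x j t =
        pQ x j 0 + (\<Sum>i | {i, j} \<in> edges S p. pAd x {i, j} j t) - pD x j t) \<and>
     (\<forall>j\<in>{1..S}. \<forall>t\<ge>0. pD x j t = real (Sv j (pT x j t))) \<and>
     (\<forall>t\<ge>0. (pL x has_integral pY x t) {0..t}) \<and>
     (\<forall>j\<in>{1..S}. \<forall>t\<ge>0. (pZ x j has_integral pT x j t) {0..t}) \<and>
     (\<forall>j\<in>{1..S}. \<forall>t\<ge>0. pZ x j t = min (pQ x j t) (f j)) \<and>
     (\<forall>t\<ge>0. pL x t = real r - (\<Sum>j\<in>{1..S}. max (pQ x j t - b j) 0)) \<and>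
     shorter_queue_routing S p x \<and>
     tie_breaking S p U x"

text \<open>Initial queue vectors for which the number of EVs not waiting is nonnegative.\<close>

definition initial_states :: "nat \<Rightarrow> nat \<Rightarrow> (nat \<Rightarrow> real) \<Rightarrow> (nat \<Rightarrow> nat) set" where
  "initial_states S r b =
     {n \<in> {1..S} \<rightarrow>\<^sub>E UNIV. (\<Sum>j\<in>{1..S}. max (real (n j) - b j) 0) \<le> real r}"

text \<open>
  The family of systems: one process \<open>X r n\<close> for each number \<open>r\<close> of EVs and each initial state \<open>n\<close>,
  all of them driven by the same \<open>\<Lambda>\<close> and \<open>Sv\<close>.
\<close>

definition swapping_systems ::
  "'w measure \<Rightarrow> nat \<Rightarrow> (nat set \<Rightarrow> real) \<Rightarrow> (nat \<Rightarrow> nat \<Rightarrow> real) \<Rightarrow> (nat \<Rightarrow> nat \<Rightarrow> real) \<Rightarrow>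
   (nat set \<Rightarrow> real \<Rightarrow> 'w \<Rightarrow> nat) \<Rightarrow> (nat \<Rightarrow> real \<Rightarrow> 'w \<Rightarrow> nat) \<Rightarrow>
   (nat \<Rightarrow> (nat \<Rightarrow> nat) \<Rightarrow> 'w \<Rightarrow> ev_path) \<Rightarrow> bool" where
  "swapping_systems M S p B F \<Lambda> Sv X \<longleftrightarrow>
     (\<forall>r\<ge>1. \<forall>n\<in>initial_states S r (B r). \<exists>U. fair_coins M S p \<Lambda> Sv U \<and>
        (\<forall>\<omega>\<in>space M.
           (\<forall>j\<in>{1..S}. pQ (X r n \<omega>) j 0 = real (n j)) \<and>
           system_path S p r (B r) (F r)
             (\<lambda>e t. \<Lambda> e t \<omega>) (\<lambda>j t. Sv j t \<omega>) (\<lambda>e k. U e k \<omega>) (X r n \<omega>)))"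

text \<open>
  A sequence of systems is obtained from the family by choosing an initial state, possibly random,
  for every \<open>r\<close>.
\<close>

definition initial_sequence ::
  "'w measure \<Rightarrow> nat \<Rightarrow> (nat \<Rightarrow> nat \<Rightarrow> real) \<Rightarrow> (nat \<Rightarrow> 'w \<Rightarrow> nat \<Rightarrow> nat) \<Rightarrow> bool" where
  "initial_sequence M S B \<nu> \<longleftrightarrow> (\<forall>r\<ge>1. \<forall>\<omega>\<in>space M. \<nu> r \<omega> \<in> initial_states S r (B r))"

definition start_from ::
  "(nat \<Rightarrow> (nat \<Rightarrow> nat) \<Rightarrow> 'w \<Rightarrow> ev_path) \<Rightarrow> (nat \<Rightarrow> 'w \<Rightarrow> nat \<Rightarrow> nat) \<Rightarrow> nat \<Rightarrow> 'w \<Rightarrow> ev_path" where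
  "start_from X \<nu> r \<omega> = X r (\<nu> r \<omega>) \<omega>"


section \<open>Fluid limits\<close>

definition uoc :: "(nat \<Rightarrow> real \<Rightarrow> real) \<Rightarrow> (real \<Rightarrow> real) \<Rightarrow> bool" where
  "uoc f g \<longleftrightarrow> (\<forall>K. compact K \<and> K \<subseteq> {0..} \<longrightarrow> uniform_limit K f g sequentially)"

definition lln_set ::
  "'w measure \<Rightarrow> nat \<Rightarrow> (nat set \<Rightarrow> real) \<Rightarrow> real \<Rightarrow> real \<Rightarrow>
   (nat set \<Rightarrow> real \<Rightarrow> 'w \<Rightarrow> nat) \<Rightarrow> (nat \<Rightarrow> real \<Rightarrow> 'w \<Rightarrow> nat) \<Rightarrow> 'w set" where
  "lln_set M S p lam \<mu> \<Lambda> Sv = {\<omega> \<in> space M.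
     (\<forall>e\<in>edges S p. uoc (\<lambda>r x. real (\<Lambda> e (real r * x) \<omega>) / real r) (\<lambda>x. p e * lam * x)) \<and>
     (\<forall>j\<in>{1..S}. uoc (\<lambda>r x. real (Sv j (real r * x) \<omega>) / real r) (\<lambda>x. \<mu> * x))}"

definition path_convergence :: "nat \<Rightarrow> (nat set \<Rightarrow> real) \<Rightarrow> (nat \<Rightarrow> nat) \<Rightarrow> (nat \<Rightarrow> ev_path) \<Rightarrow> ev_path \<Rightarrow> bool" where
  "path_convergence S p \<rho> x y \<longleftrightarrow>
     (\<forall>e\<in>edges S p. uoc (\<lambda>l t. pA (x (\<rho> l)) e t / real (\<rho> l)) (pA y e)) \<and>
     (\<forall>e\<in>edges S p. \<forall>i\<in>e. uoc (\<lambda>l t. pAd (x (\<rho> l)) e i t / real (\<rho> l)) (pAd y e i)) \<and>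
     (\<forall>j\<in>{1..S}. uoc (\<lambda>l t. pQ (x (\<rho> l)) j t / real (\<rho> l)) (pQ y j)) \<and>
     (\<forall>j\<in>{1..S}. uoc (\<lambda>l t. pZ (x (\<rho> l)) j t / real (\<rho> l)) (pZ y j)) \<and>
     uoc (\<lambda>l t. pY (x (\<rho> l)) t / real (\<rho> l)) (pY y) \<and>
     (\<forall>j\<in>{1..S}. uoc (\<lambda>l t. pT (x (\<rho> l)) j t / real (\<rho> l)) (pT y j)) \<and>
     (\<forall>j\<in>{1..S}. uoc (\<lambda>l t. pD (x (\<rho> l)) j t / real (\<rho> l)) (pD y j)) \<and>
     uoc (\<lambda>l t. pL (x (\<rho> l)) t / real (\<rho> l)) (pL y)"

definition fluid_limit_at ::
  "nat \<Rightarrow> (nat set \<Rightarrow> real) \<Rightarrow> (nat \<Rightarrow> 'w \<Rightarrow> ev_path) \<Rightarrow> 'w \<Rightarrow> ev_path \<Rightarrow> bool" where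
  "fluid_limit_at S p Xs \<omega> y \<longleftrightarrow>
     (\<exists>\<rho>. filterlim \<rho> at_top sequentially \<and> path_convergence S p \<rho> (\<lambda>r. Xs r \<omega>) y)"

definition fluid_limit ::
  "'w measure \<Rightarrow> nat \<Rightarrow> (nat set \<Rightarrow> real) \<Rightarrow> real \<Rightarrow> real \<Rightarrow>
   (nat set \<Rightarrow> real \<Rightarrow> 'w \<Rightarrow> nat) \<Rightarrow> (nat \<Rightarrow> real \<Rightarrow> 'w \<Rightarrow> nat) \<Rightarrow>
   (nat \<Rightarrow> 'w \<Rightarrow> ev_path) \<Rightarrow> ev_path \<Rightarrow> bool" where
  "fluid_limit M S p lam \<mu> \<Lambda> Sv Xs y \<longleftrightarrow>
     (\<exists>\<omega>\<in>lln_set M S p lam \<mu> \<Lambda> Sv. fluid_limit_at S p Xs \<omega> y)"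

definition lipschitz_path :: "nat \<Rightarrow> (nat set \<Rightarrow> real) \<Rightarrow> ev_path \<Rightarrow> bool" where
  "lipschitz_path S p y \<longleftrightarrow>
     (\<forall>e\<in>edges S p. \<exists>C. C-lipschitz_on {0..} (pA y e)) \<and>
     (\<forall>e\<in>edges S p. \<forall>i\<in>e. \<exists>C. C-lipschitz_on {0..} (pAd y e i)) \<and>
     (\<forall>j\<in>{1..S}. \<exists>C. C-lipschitz_on {0..} (pQ y j)) \<and>
     (\<forall>j\<in>{1..S}. \<exists>C. C-lipschitz_on {0..} (pZ y j)) \<and>
     (\<exists>C. C-lipschitz_on {0..} (pY y)) \<and>
     (\<forall>j\<in>{1..S}. \<exists>C. C-lipschitz_on {0..} (pT y j)) \<and>
     (\<forall>j\<in>{1..S}. \<exists>C. C-lipschitz_on {0..} (pD y j)) \<and>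
     (\<exists>C. C-lipschitz_on {0..} (pL y))"

text \<open>
  Differentiability is relative to the time domain \<open>{0..}\<close>: two-sided at \<open>t > 0\<close>, one-sided at \<open>0\<close>.
\<close>

definition regular_point :: "nat \<Rightarrow> (nat set \<Rightarrow> real) \<Rightarrow> ev_path \<Rightarrow> real \<Rightarrow> bool" where
  "regular_point S p y t \<longleftrightarrow> 0 \<le> t \<and>
     (\<forall>e\<in>edges S p. pA y e differentiable (at t within {0..})) \<and>
     (\<forall>e\<in>edges S p. \<forall>i\<in>e. pAd y e i differentiable (at t within {0..})) \<and>
     (\<forall>j\<in>{1..S}. pQ y j differentiable (at t within {0..})) \<and>
     (\<forall>j\<in>{1..S}. pZ y j differentiable (at t within {0..})) \<and>
     pY y differentiable (at t within {0..}) \<and>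
     (\<forall>j\<in>{1..S}. pT y j differentiable (at t within {0..})) \<and>
     (\<forall>j\<in>{1..S}. pD y j differentiable (at t within {0..})) \<and>
     pL y differentiable (at t within {0..})"

text \<open>
  The possible states of the fluid-scaled queues: the queues, and by the formula for \<open>L\<close> the fraction
  of EVs not waiting, are nonnegative. A vector outside this set is not the initial state of any
  fluid limit, so that invariance would hold for it vacuously.
\<close>

definition fluid_states :: "nat \<Rightarrow> (nat set \<Rightarrow> real) \<Rightarrow> real \<Rightarrow> real \<Rightarrow> (nat \<Rightarrow> real) set" where
  "fluid_states S p lam \<mu> =
     {q \<in> {1..S} \<rightarrow>\<^sub>E {0..}. (\<Sum>j\<in>{1..S}. max (q j - load S p j * lam / \<mu>) 0) \<le> 1}"

text \<open>Invariance refers to the fluid limits from all initial states of the systems.\<close>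

definition invariant_state ::
  "'w measure \<Rightarrow> nat \<Rightarrow> (nat set \<Rightarrow> real) \<Rightarrow> real \<Rightarrow> real \<Rightarrow> (nat \<Rightarrow> nat \<Rightarrow> real) \<Rightarrow>
   (nat set \<Rightarrow> real \<Rightarrow> 'w \<Rightarrow> nat) \<Rightarrow> (nat \<Rightarrow> real \<Rightarrow> 'w \<Rightarrow> nat) \<Rightarrow>
   (nat \<Rightarrow> (nat \<Rightarrow> nat) \<Rightarrow> 'w \<Rightarrow> ev_path) \<Rightarrow> (nat \<Rightarrow> real) \<Rightarrow> bool" where
  "invariant_state M S p lam \<mu> B \<Lambda> Sv X q \<longleftrightarrow>
     q \<in> fluid_states S p lam \<mu> \<and>
     (\<forall>\<nu> y. initial_sequence M S B \<nu> \<and> fluid_limit M S p lam \<mu> \<Lambda> Sv (start_from X \<nu>) y \<and>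
        (\<forall>j\<in>{1..S}. pQ y j 0 = q j) \<longrightarrow> (\<forall>t\<ge>0. \<forall>j\<in>{1..S}. pQ y j t = q j))"

end

theory Submission
  imports Defs "HOL-Complex_Analysis.Great_Picard" "HOL-Real_Asymp.Real_Asymp"
begin

text \<open>
  Everything random enters through the law of large numbers for finitely many Poisson processes;
  after that the argument is deterministic, one path at a time.

  \<^emph>\<open>Law of large numbers.\<close> A Poisson process is monotone, so its scaled paths converge uniformly on
  compact sets as soon as \<open>N(n\<^sup>2) / n\<^sup>2\<close> converges (\<open>uoc_linear_iff_squares\<close>). Along the squares the
  variances \<open>a / n\<^sup>2\<close> are summable, which gives almost sure convergence; and since only countably many
  times are involved, the good set is an event (\<open>lln_set_prob\<close>).

  \<^emph>\<open>Fluid limits.\<close> The scaled busy times have bounded slopes, and the routed arrivals grow no faster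
  than all arrivals on their edge, whose slope is bounded up to an error that vanishes with the
  scale. Such families are relatively compact (\<open>uoc_convergent_subsequence\<close>), and the remaining
  components are continuous functions of these and of the initial queues. This gives both existence
  (\<open>scaled_limit_exists\<close>) and the limiting equations. If station \<open>j\<close> is strictly more
  loaded than \<open>i\<close> in the limit, it is so in the scaled systems on a whole time interval, where no
  arrival choosing between \<open>i\<close> and \<open>j\<close> joins \<open>j\<close> (\<open>limit_longer_queue\<close>).

  \<^emph>\<open>Invariant state.\<close> Write \<open>x\<^sub>j = Q\<^sub>j / p\<^sub>j\<close> and \<open>c = lam / \<mu>\<close>. The limiting equations do not
  determine the routing at ties, but testing the queues against weights \<open>g(x\<^sub>j)\<close> removes the
  ambiguity: at a tie the two ends of the edge carry the same weight, so only the total arrivals on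
  the edge matter. Hence
  \<open>\<Sum>\<^sub>j g(x\<^sub>j(t)) Q\<^sub>j'(t) = lam L \<Sum>\<^sub>e p\<^sub>e g(min\<^sub>e x) - \<mu> \<Sum>\<^sub>j g(x\<^sub>j) Z\<^sub>j\<close>
  for every function \<open>g\<close> (\<open>weighted_queue_deriv\<close>). For a constant path, \<open>g\<close> the indicator of the
  largest, respectively the smallest, value of \<open>x\<close> gives
  \<open>min (max x) c \<le> c L \<le> min (min x) c\<close>, and this forces \<open>x\<^sub>j = c\<close> for all \<open>j\<close>
  (\<open>constant_path_equilibrium\<close>). Conversely, \<open>g(v) = 2 (v - c)\<close> shows that
  \<open>V = \<Sum>\<^sub>j p\<^sub>j (x\<^sub>j - c)\<^sup>2\<close> satisfies \<open>V' \<le> 2 lam V\<close>, so that \<open>V\<close> stays at \<open>0\<close> once it is there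
  (\<open>equilibrium_path_constant\<close>). For uniqueness it remains that every fluid state is the limit of
  admissible initial states (\<open>initial_states_approximate\<close>).
\<close>

section \<open>Uniform convergence on compact sets\<close>

lemma uoc_iff:
  "uoc f g \<longleftrightarrow> (\<forall>b \<epsilon>. 0 \<le> b \<and> 0 < \<epsilon> \<longrightarrow>
     (\<forall>\<^sub>F n in sequentially. \<forall>t\<in>{0..b}. \<bar>f n t - g t\<bar> < \<epsilon>))"
proof
  assume "uoc f g"
  then show "\<forall>b \<epsilon>. 0 \<le> b \<and> 0 < \<epsilon> \<longrightarrow>
     (\<forall>\<^sub>F n in sequentially. \<forall>t\<in>{0..b}. \<bar>f n t - g t\<bar> < \<epsilon>)"
    by (auto simp: uoc_def uniform_limit_iff dist_real_def)
next
  assume R: "\<forall>b \<epsilon>. 0 \<le> b \<and> 0 < \<epsilon> \<longrightarrow>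
     (\<forall>\<^sub>F n in sequentially. \<forall>t\<in>{0..b}. \<bar>f n t - g t\<bar> < \<epsilon>)"
  show "uoc f g"
    unfolding uoc_def uniform_limit_iff
  proof (intro allI impI, elim conjE)
    fix K :: "real set" and \<epsilon> :: real
    assume K: "compact K" "K \<subseteq> {0..}" and "0 < \<epsilon>"
    obtain b where b: "\<forall>x\<in>K. \<bar>x\<bar> \<le> b"
      using compact_imp_bounded[OF K(1)] by (auto simp: bounded_iff)
    have "\<forall>\<^sub>F n in sequentially. \<forall>t\<in>{0..max b 0}. \<bar>f n t - g t\<bar> < \<epsilon>"
      using R \<open>0 < \<epsilon>\<close> by auto
    then show "\<forall>\<^sub>F n in sequentially. \<forall>x\<in>K. dist (f n x) (g x) < \<epsilon>"
      by eventually_elim (use b K(2) in \<open>force simp: dist_real_def\<close>)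
  qed
qed

lemma uocI:
  assumes "\<And>b \<epsilon>. 0 \<le> b \<Longrightarrow> 0 < \<epsilon> \<Longrightarrow>
     \<forall>\<^sub>F n in sequentially. \<forall>t\<in>{0..b}. \<bar>f n t - g t\<bar> < \<epsilon>"
  shows "uoc f g"
  using assms by (auto simp: uoc_iff)

lemma uocD:
  assumes "uoc f g" "0 \<le> b" "0 < \<epsilon>"
  shows "\<forall>\<^sub>F n in sequentially. \<forall>t\<in>{0..b}. \<bar>f n t - g t\<bar> < \<epsilon>"
  using assms by (auto simp: uoc_iff)

lemma uoc_tendsto:
  assumes "uoc f g" "0 \<le> t"
  shows "(\<lambda>n. f n t) \<longlonglongrightarrow> g t"
proof -
  have "uniform_limit {t} f g sequentially"
    using assms unfolding uoc_def by (metis compact_sing atLeast_iff empty_subsetI insert_subset)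
  then show ?thesis by simp
qed

lemma uoc_unique:
  assumes "uoc f g" "uoc f h" "0 \<le> t"
  shows "g t = h t"
  using uoc_tendsto[OF assms(1,3)] uoc_tendsto[OF assms(2,3)] by (rule LIMSEQ_unique)

lemma uoc_cong:
  assumes "uoc f g" "\<forall>\<^sub>F n in sequentially. \<forall>t\<ge>0. f' n t = f n t" "\<And>t. 0 \<le> t \<Longrightarrow> g' t = g t"
  shows "uoc f' g'"
proof (rule uocI)
  fix b \<epsilon> :: real assume "0 \<le> b" "0 < \<epsilon>"
  from uocD[OF assms(1) this] assms(2)
  show "\<forall>\<^sub>F n in sequentially. \<forall>t\<in>{0..b}. \<bar>f' n t - g' t\<bar> < \<epsilon>"
    by eventually_elim (use assms(3) in auto)
qed

lemma uoc_subseq: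
  assumes "uoc f g" "filterlim \<rho> at_top sequentially"
  shows "uoc (\<lambda>l. f (\<rho> l)) g"
proof (rule uocI)
  fix b \<epsilon> :: real assume "0 \<le> b" "0 < \<epsilon>"
  from eventually_compose_filterlim[OF uocD[OF assms(1) this] assms(2)]
  show "\<forall>\<^sub>F n in sequentially. \<forall>t\<in>{0..b}. \<bar>f (\<rho> n) t - g t\<bar> < \<epsilon>" .
qed

lemma uoc_const:
  assumes "a \<longlonglongrightarrow> c"
  shows "uoc (\<lambda>n t. a n) (\<lambda>t. c)"
proof (rule uocI)
  fix b \<epsilon> :: real assume "0 \<le> b" "0 < \<epsilon>"
  then show "\<forall>\<^sub>F n in sequentially. \<forall>t\<in>{0..b}. \<bar>a n - c\<bar> < \<epsilon>"
    using tendstoD[OF assms \<open>0 < \<epsilon>\<close>] by (simp add: dist_real_def eventually_mono)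
qed

lemma uoc_add: "uoc f g \<Longrightarrow> uoc f' g' \<Longrightarrow> uoc (\<lambda>n t. f n t + f' n t) (\<lambda>t. g t + g' t)"
  by (auto simp: uoc_def intro!: uniform_limit_add)

lemma uoc_diff: "uoc f g \<Longrightarrow> uoc f' g' \<Longrightarrow> uoc (\<lambda>n t. f n t - f' n t) (\<lambda>t. g t - g' t)"
  by (auto simp: uoc_def intro!: uniform_limit_minus)

lemma uoc_cmult:
  assumes "uoc f g"
  shows "uoc (\<lambda>n t. a * f n t) (\<lambda>t. a * g t)"
  using assms by (auto simp: uoc_def intro!: bounded_linear_uniform_limit_intros)

lemma uoc_sum:
  assumes "finite I" "\<And>i. i \<in> I \<Longrightarrow> uoc (f i) (g i)"
  shows "uoc (\<lambda>n t. \<Sum>i\<in>I. f i n t) (\<lambda>t. \<Sum>i\<in>I. g i t)"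
  using assms
proof (induction I rule: finite_induct)
  case empty
  then show ?case using uoc_const[of "\<lambda>_. 0" 0] by simp
next
  case (insert i I)
  then show ?case by (auto intro!: uoc_add)
qed

text \<open>
  Minima and maxima of converging functions are covered at once: they are 1-Lipschitz for the
  sum distance.
\<close>

lemma uoc_contraction:
  assumes "uoc f g" "uoc f' g'"
    and h: "\<And>a b a' b'. \<bar>h a a' - h b b'\<bar> \<le> \<bar>a - b\<bar> + \<bar>a' - b' :: real\<bar>"
  shows "uoc (\<lambda>n t. h (f n t) (f' n t)) (\<lambda>t. h (g t) (g' t))"
proof (rule uocI)
  fix b \<epsilon> :: real assume "0 \<le> b" "0 < \<epsilon>"
  then have "0 < \<epsilon> / 2" by simp
  from uocD[OF assms(1) \<open>0 \<le> b\<close> this] uocD[OF assms(2) \<open>0 \<le> b\<close> this]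
  show "\<forall>\<^sub>F n in sequentially. \<forall>t\<in>{0..b}. \<bar>h (f n t) (f' n t) - h (g t) (g' t)\<bar> < \<epsilon>"
  proof eventually_elim
    case (elim n)
    show ?case
    proof
      fix t assume "t \<in> {0..b}"
      with elim have "\<bar>f n t - g t\<bar> < \<epsilon> / 2" "\<bar>f' n t - g' t\<bar> < \<epsilon> / 2" by auto
      with h[of "f n t" "f' n t" "g t" "g' t"]
      show "\<bar>h (f n t) (f' n t) - h (g t) (g' t)\<bar> < \<epsilon>" by linarith
    qed
  qed
qed

lemma uoc_min: "uoc f g \<Longrightarrow> uoc f' g' \<Longrightarrow> uoc (\<lambda>n t. min (f n t) (f' n t)) (\<lambda>t. min (g t) (g' t))"
  by (erule (1) uoc_contraction) linarith

lemma uoc_max: "uoc f g \<Longrightarrow> uoc f' g' \<Longrightarrow> uoc (\<lambda>n t. max (f n t) (f' n t)) (\<lambda>t. max (g t) (g' t))"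
  by (erule (1) uoc_contraction) linarith

text \<open>
  Random time change: this turns the law of large numbers for the driving processes into the limit of
  the arrivals and of the charging completions, which run on the clocks \<open>Y\<close> and \<open>T\<^sub>j\<close>. The linear
  bound keeps the clock in a compact set on which \<open>N\<close> converges uniformly.
\<close>

lemma uoc_compose_linear:
  assumes N: "uoc N (\<lambda>x. a * x)" and \<phi>: "uoc \<phi> \<psi>"
    and bound: "\<forall>\<^sub>F n in sequentially. \<forall>t\<ge>0. 0 \<le> \<phi> n t \<and> \<phi> n t \<le> C * t"
  shows "uoc (\<lambda>n t. N n (\<phi> n t)) (\<lambda>t. a * \<psi> t)"
proof (rule uocI)
  fix b \<epsilon> :: real assume b: "0 \<le> b" and \<epsilon>: "0 < \<epsilon>"
  define d where "d = \<epsilon> / (2 * (\<bar>a\<bar> + 1))"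
  have d: "0 < d" using \<epsilon> by (simp add: d_def)
  have ad: "\<bar>a\<bar> * d \<le> \<epsilon> / 2" using \<epsilon> by (simp add: d_def field_simps)
  have "0 \<le> \<bar>C\<bar> * b" "0 < \<epsilon> / 2" using b \<epsilon> by auto
  from uocD[OF N this] uocD[OF \<phi> b d] bound
  show "\<forall>\<^sub>F n in sequentially. \<forall>t\<in>{0..b}. \<bar>N n (\<phi> n t) - a * \<psi> t\<bar> < \<epsilon>"
  proof eventually_elim
    case (elim n)
    show ?case
    proof
      fix t assume t: "t \<in> {0..b}"
      have "C * t \<le> \<bar>C\<bar> * b" using t by (intro mult_mono) auto
      with elim(3) t have "\<phi> n t \<in> {0..\<bar>C\<bar> * b}" by force
      with elim(1) have 1: "\<bar>N n (\<phi> n t) - a * \<phi> n t\<bar> < \<epsilon> / 2" by auto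
      have "\<bar>a * \<phi> n t - a * \<psi> t\<bar> = \<bar>a\<bar> * \<bar>\<phi> n t - \<psi> t\<bar>"
        by (simp add: abs_mult flip: right_diff_distrib)
      also have "\<dots> \<le> \<bar>a\<bar> * d" using elim(2) t by (intro mult_left_mono) (auto intro: less_imp_le)
      finally show "\<bar>N n (\<phi> n t) - a * \<psi> t\<bar> < \<epsilon>" using 1 ad by linarith
    qed
  qed
qed

lemma uoc_lipschitz_limit:
  assumes f: "uoc f g" and "0 \<le> C"
    and lip: "\<And>s t \<epsilon>. 0 \<le> s \<Longrightarrow> 0 \<le> t \<Longrightarrow> 0 < \<epsilon> \<Longrightarrow>
      \<forall>\<^sub>F n in sequentially. \<bar>f n t - f n s\<bar> \<le> C * \<bar>t - s\<bar> + \<epsilon>"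
  shows "C-lipschitz_on {0..} g"
proof (rule lipschitz_onI)
  fix s t :: real assume "s \<in> {0..}" "t \<in> {0..}"
  then have st: "0 \<le> s" "0 \<le> t" by auto
  have "(\<lambda>n. \<bar>f n s - f n t\<bar>) \<longlonglongrightarrow> \<bar>g s - g t\<bar>"
    using uoc_tendsto[OF f st(1)] uoc_tendsto[OF f st(2)] by (intro tendsto_intros)
  then have "\<bar>g s - g t\<bar> \<le> C * \<bar>s - t\<bar> + \<epsilon>" if "0 < \<epsilon>" for \<epsilon>
    by (rule tendsto_upperbound) (use lip[OF st(2,1) that] in auto)
  then show "dist (g s) (g t) \<le> C * dist s t"
    by (simp add: dist_real_def field_le_epsilon)
qed (fact \<open>0 \<le> C\<close>)

lemma uoc_has_integral:
  assumes f: "uoc f g" and F: "uoc F G" and cont: "continuous_on {0..} g"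
    and int: "\<forall>\<^sub>F n in sequentially. \<forall>t\<ge>0. (f n has_integral F n t) {0..t}" and t: "0 \<le> t"
  shows "(g has_integral G t) {0..t}"
proof -
  have g: "(g has_integral integral {0..t} g) {0..t}"
    by (intro integrable_integral integrable_continuous_real continuous_on_subset[OF cont]) auto
  have "(\<lambda>n. F n t) \<longlonglongrightarrow> integral {0..t} g"
  proof (rule tendstoI)
    fix \<epsilon> :: real assume \<epsilon>: "0 < \<epsilon>"
    define d where "d = \<epsilon> / (t + 1)"
    have d: "0 < d" "d * t < \<epsilon>" using \<epsilon> t by (auto simp: d_def field_simps)
    from uocD[OF f t d(1)] int show "\<forall>\<^sub>F n in sequentially. dist (F n t) (integral {0..t} g) < \<epsilon>"
    proof eventually_elim
      case (elim n)
      have "((\<lambda>x. f n x - g x) has_integral F n t - integral {0..t} g) {0..t}"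
        using elim(2) t g by (intro has_integral_diff) auto
      then have "norm (F n t - integral {0..t} g) \<le> d * measure lborel {0..t}"
        by (rule has_integral_bound_real[where S="{}", rotated 2])
          (use elim(1) d in \<open>auto intro: less_imp_le\<close>)
      with d t show ?case by (simp add: dist_real_def)
    qed
  qed
  with uoc_tendsto[OF F t] have "G t = integral {0..t} g" by (rule LIMSEQ_unique)
  with g show ?thesis by simp
qed

section \<open>Compactness\<close>

text \<open>
  Convergence at the points of a finite grid controls the functions on the whole interval, because
  between grid points they move by at most the mesh times the Lipschitz constant, plus an error that
  is eventually small. Pre-limit paths have jumps, so equicontinuity holds only in this asymptotic
  sense.
\<close>

lemma uniformly_Cauchy_asymptotically_lipschitz:
  fixes f :: "nat \<Rightarrow> real \<Rightarrow> real"
  assumes "0 \<le> C"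
    and lip: "\<And>\<epsilon>. 0 < \<epsilon> \<Longrightarrow>
      \<forall>\<^sub>F n in sequentially. \<forall>s\<in>{0..b}. \<forall>t\<in>{0..b}. \<bar>f n t - f n s\<bar> \<le> C * \<bar>t - s\<bar> + \<epsilon>"
    and conv: "\<And>q. q \<in> \<rat> \<Longrightarrow> 0 \<le> q \<Longrightarrow> convergent (\<lambda>n. f n q)"
  shows "uniformly_Cauchy_on {0..b} f"
proof (rule uniformly_Cauchy_onI)
  fix \<epsilon> :: real assume \<epsilon>: "0 < \<epsilon>"
  obtain N :: nat where N: "C < real N * (\<epsilon> / 8)"
    using \<epsilon> reals_Archimedean2[of "C / (\<epsilon> / 8)"] by (auto simp: field_simps)
  have "0 < N" using N \<epsilon> \<open>0 \<le> C\<close> by (cases N) auto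
  define G where "G = (\<lambda>m. real m / real N) ` {..nat \<lceil>b * real N\<rceil>}"
  have "\<forall>q\<in>G. \<forall>\<^sub>F n in sequentially. \<forall>m\<ge>n. \<bar>f n q - f m q\<bar> < \<epsilon> / 8"
  proof
    fix q assume "q \<in> G"
    then have "q \<in> \<rat>" "0 \<le> q" by (auto simp: G_def)
    then have "Cauchy (\<lambda>n. f n q)" by (simp add: conv convergent_Cauchy)
    then obtain M where M: "\<forall>m\<ge>M. \<forall>n\<ge>M. dist (f m q) (f n q) < \<epsilon> / 8"
      using \<epsilon> by (auto simp: Cauchy_def elim!: allE[of _ "\<epsilon> / 8"])
    show "\<forall>\<^sub>F n in sequentially. \<forall>m\<ge>n. \<bar>f n q - f m q\<bar> < \<epsilon> / 8"
      using M by (auto simp: eventually_sequentially dist_real_def intro!: exI[of _ M])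
  qed
  then have "\<forall>\<^sub>F n in sequentially. \<forall>q\<in>G. \<forall>m\<ge>n. \<bar>f n q - f m q\<bar> < \<epsilon> / 8"
    by (intro eventually_ball_finite) (auto simp: G_def)
  moreover have "\<forall>\<^sub>F n in sequentially. \<forall>s\<in>{0..b}. \<forall>t\<in>{0..b}. \<bar>f n t - f n s\<bar> \<le> C * \<bar>t - s\<bar> + \<epsilon> / 8"
    using \<epsilon> by (intro lip) auto
  ultimately have "\<forall>\<^sub>F n in sequentially. (\<forall>q\<in>G. \<forall>m\<ge>n. \<bar>f n q - f m q\<bar> < \<epsilon> / 8) \<and>
      (\<forall>s\<in>{0..b}. \<forall>t\<in>{0..b}. \<bar>f n t - f n s\<bar> \<le> C * \<bar>t - s\<bar> + \<epsilon> / 8)"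
    by (rule eventually_conj)
  then obtain M where M:
    "\<And>n q m. n \<ge> M \<Longrightarrow> q \<in> G \<Longrightarrow> m \<ge> n \<Longrightarrow> \<bar>f n q - f m q\<bar> < \<epsilon> / 8"
    "\<And>n s t. n \<ge> M \<Longrightarrow> s \<in> {0..b} \<Longrightarrow> t \<in> {0..b} \<Longrightarrow> \<bar>f n t - f n s\<bar> \<le> C * \<bar>t - s\<bar> + \<epsilon> / 8"
    unfolding eventually_sequentially by blast
  have "dist (f m t) (f n t) < \<epsilon>" if t: "t \<in> {0..b}" and mn: "m \<ge> M" "n \<ge> M" for t m n
  proof -
    define q where "q = real (nat \<lfloor>t * real N\<rfloor>) / real N"
    have "0 \<le> t * real N" using t by auto
    then have fl: "real (nat \<lfloor>t * real N\<rfloor>) \<le> t * real N" "t * real N < real (nat \<lfloor>t * real N\<rfloor>) + 1"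
      by linarith+
    have "t * real N \<le> b * real N" using t by (intro mult_right_mono) auto
    then have "nat \<lfloor>t * real N\<rfloor> \<le> nat \<lceil>b * real N\<rceil>" by linarith
    then have q: "q \<in> G" by (auto simp: q_def G_def)
    have qt: "q \<le> t" "t - q \<le> 1 / real N"
    proof -
      show "q \<le> t" using fl(1) \<open>0 < N\<close> by (simp add: q_def pos_divide_le_eq)
      have "t * real N \<le> (q + 1 / real N) * real N" using fl(2) \<open>0 < N\<close> by (simp add: q_def distrib_right)
      then show "t - q \<le> 1 / real N" using \<open>0 < N\<close> by simp
    qed
    have "0 \<le> q" by (simp add: q_def)
    then have qb: "q \<in> {0..b}" using qt t by auto
    have "C * \<bar>t - q\<bar> \<le> C * (1 / real N)" using qt \<open>0 \<le> C\<close> by (intro mult_left_mono) auto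
    also have "\<dots> \<le> \<epsilon> / 8" using N \<open>0 < N\<close> by (simp add: field_simps)
    finally have Cq: "C * \<bar>t - q\<bar> \<le> \<epsilon> / 8" .
    have "\<bar>f m q - f n q\<bar> < \<epsilon> / 8"
      using M(1)[OF mn(1) q, of n] M(1)[OF mn(2) q, of m] by (cases "m \<le> n") (auto simp: abs_minus_commute)
    then show ?thesis
      using M(2)[OF mn(1) qb t] M(2)[OF mn(2) qb t] Cq \<epsilon> unfolding dist_real_def by linarith
  qed
  then show "\<exists>M. \<forall>x\<in>{0..b}. \<forall>m\<ge>M. \<forall>n\<ge>M. dist (f m x) (f n x) < \<epsilon>" by blast
qed

text \<open>
  A version of the Arzela-Ascoli theorem for asymptotically Lipschitz functions on the half-line,
  for all members of a countable family simultaneously. A diagonal argument over the index and the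
  nonnegative rationals gives pointwise convergence on a dense set.
\<close>

lemma uoc_convergent_subsequence:
  fixes f :: "'i \<Rightarrow> nat \<Rightarrow> real \<Rightarrow> real" and C :: "'i \<Rightarrow> real"
  assumes I: "countable I" and C: "\<And>i. i \<in> I \<Longrightarrow> 0 \<le> C i"
    and start: "\<And>i. i \<in> I \<Longrightarrow> Bseq (\<lambda>n. f i n 0)"
    and lip: "\<And>i b \<epsilon>. i \<in> I \<Longrightarrow> 0 \<le> b \<Longrightarrow> 0 < \<epsilon> \<Longrightarrow>
      \<forall>\<^sub>F n in sequentially. \<forall>s\<in>{0..b}. \<forall>t\<in>{0..b}. \<bar>f i n t - f i n s\<bar> \<le> C i * \<bar>t - s\<bar> + \<epsilon>"
  obtains k g where "strict_mono (k :: nat \<Rightarrow> nat)" "\<And>i. i \<in> I \<Longrightarrow> uoc (\<lambda>l. f i (k l)) (g i)"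
proof -
  define J where "J = I \<times> (\<rat> \<inter> {0::real..})"
  have "countable J" using I by (auto simp: J_def intro!: countable_SIGMA countable_rat countable_Int1)
  \<comment> \<open>each value is bounded, but not uniformly in the index and the point, hence the normalization by \<open>K\<close> below\<close>
  have "\<exists>K>0. \<forall>n. \<bar>f i n q\<bar> \<le> K" if iq: "i \<in> I" "0 \<le> q" for i q
  proof -
    obtain K where K: "\<And>n. \<bar>f i n 0\<bar> \<le> K"
      using start[OF iq(1)] by (auto simp: Bseq_def)
    have "\<forall>\<^sub>F n in sequentially. norm (f i n q) \<le> K + C i * q + 1"
      using lip[OF iq zero_less_one]
    proof eventually_elim
      case (elim n)
      with iq have "\<bar>f i n q - f i n 0\<bar> \<le> C i * \<bar>q - 0\<bar> + 1"
        by (meson atLeastAtMost_iff order_refl)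
      with K[of n] iq show ?case by auto
    qed
    then have "Bseq (\<lambda>n. f i n q)" by (rule BfunI)
    then show ?thesis by (auto simp: Bseq_def)
  qed
  then have "\<forall>j\<in>J. \<exists>K>0. \<forall>n. \<bar>f (fst j) n (snd j)\<bar> \<le> K" by (auto simp: J_def)
  then obtain K where K: "\<And>j. j \<in> J \<Longrightarrow> 0 < K j" "\<And>j n. j \<in> J \<Longrightarrow> \<bar>f (fst j) n (snd j)\<bar> \<le> K j"
    by metis
  have "norm (f (fst j) n (snd j) / K j) \<le> 1" if "j \<in> J" for n j
    using K[OF that] by (simp add: field_simps)
  then obtain k where k: "strict_mono (k :: nat \<Rightarrow> nat)"
      "\<And>j. j \<in> J \<Longrightarrow> \<exists>l. (\<lambda>n. f (fst j) (k n) (snd j) / K j) \<longlonglongrightarrow> l"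
    using function_convergent_subsequence[OF \<open>countable J\<close>, of "\<lambda>n j. f (fst j) n (snd j) / K j" 1]
    by metis
  have conv: "convergent (\<lambda>n. f i (k n) q)" if "i \<in> I" "q \<in> \<rat>" "0 \<le> q" for i q
  proof -
    have j: "(i, q) \<in> J" using that by (simp add: J_def)
    obtain l where "(\<lambda>n. f i (k n) q / K (i, q)) \<longlonglongrightarrow> l" using k(2)[OF j] by auto
    then have "(\<lambda>n. f i (k n) q / K (i, q) * K (i, q)) \<longlonglongrightarrow> l * K (i, q)" by (intro tendsto_intros)
    then show ?thesis using K(1)[OF j] by (auto simp: convergent_def)
  qed
  have kl: "filterlim k at_top sequentially" using k(1) by (rule filterlim_subseq)
  have unif: "uniformly_convergent_on {0..b} (\<lambda>l. f i (k l))" if i: "i \<in> I" and b: "0 \<le> b" for i b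
  proof -
    have "uniformly_Cauchy_on {0..b} (\<lambda>l. f i (k l))"
    proof (rule uniformly_Cauchy_asymptotically_lipschitz[OF C[OF i] _ conv[OF i]])
      fix \<epsilon> :: real assume "0 < \<epsilon>"
      from eventually_compose_filterlim[OF lip[OF i b this] kl]
      show "\<forall>\<^sub>F n in sequentially. \<forall>s\<in>{0..b}. \<forall>t\<in>{0..b}. \<bar>f i (k n) t - f i (k n) s\<bar> \<le> C i * \<bar>t - s\<bar> + \<epsilon>" .
    qed
    then show ?thesis by (rule Cauchy_uniformly_convergent)
  qed
  have "uoc (\<lambda>l. f i (k l)) (\<lambda>t. lim (\<lambda>l. f i (k l) t))" if i: "i \<in> I" for i
  proof (rule uocI)
    fix b \<epsilon> :: real assume b: "0 \<le> b" and \<epsilon>: "0 < \<epsilon>"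
    have "uniform_limit {0..b} (\<lambda>l. f i (k l)) (\<lambda>t. lim (\<lambda>l. f i (k l) t)) sequentially"
      using unif[OF i b] by (simp add: uniformly_convergent_uniform_limit_iff)
    from uniform_limitD[OF this \<epsilon>]
    show "\<forall>\<^sub>F n in sequentially. \<forall>t\<in>{0..b}. \<bar>f i (k n) t - lim (\<lambda>l. f i (k l) t)\<bar> < \<epsilon>"
      by (simp add: dist_real_def)
  qed
  then show thesis by (rule that[OF k(1), of "\<lambda>i t. lim (\<lambda>l. f i (k l) t)"])
qed

section \<open>The law of large numbers for the driving processes\<close>

lemma poisson_power_sums:
  fixes m :: real
  shows "(\<lambda>k. m ^ k / fact k) sums exp m"
    and "(\<lambda>k. real k * (m ^ k / fact k)) sums (m * exp m)"
    and "(\<lambda>k. real k * (real k - 1) * (m ^ k / fact k)) sums (m\<^sup>2 * exp m)"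
proof -
  show 0: "(\<lambda>k. m ^ k / fact k) sums exp m"
    using exp_converges[of m] by (simp add: divide_inverse mult.commute)
  have "(\<lambda>k. m * (m ^ k / fact k)) sums (m * exp m)" using 0 by (rule sums_mult)
  also have "(\<lambda>k. m * (m ^ k / fact k)) = (\<lambda>k. real (Suc k) * (m ^ Suc k / fact (Suc k)))"
    by (rule ext) (simp add: divide_simps)
  finally show 1: "(\<lambda>k. real k * (m ^ k / fact k)) sums (m * exp m)"
    by (subst (asm) sums_Suc_iff) simp
  have "(\<lambda>k. m * (real k * (m ^ k / fact k))) sums (m * (m * exp m))" using 1 by (rule sums_mult)
  also have "(\<lambda>k. m * (real k * (m ^ k / fact k))) =
      (\<lambda>k. real (Suc k) * (real (Suc k) - 1) * (m ^ Suc k / fact (Suc k)))"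
    by (rule ext) (simp add: divide_simps)
  finally show "(\<lambda>k. real k * (real k - 1) * (m ^ k / fact k)) sums (m\<^sup>2 * exp m)"
    by (subst (asm) sums_Suc_iff) (simp add: power2_eq_square mult.assoc)
qed

text \<open>
  Expand \<open>(k - m)\<^sup>2 = k (k - 1) + (1 - 2 m) k + m\<^sup>2\<close> and use the first two factorial moments.
\<close>

lemma poisson_variance:
  assumes "0 < m"
  shows "(\<integral>\<^sup>+k. ennreal ((real k - m)\<^sup>2) \<partial>measure_pmf (poisson_pmf m)) = ennreal m"
proof -
  note S = poisson_power_sums[of m]
  have "(\<lambda>k. (real k * (real k - 1) * (m ^ k / fact k) + (1 - 2 * m) * (real k * (m ^ k / fact k))
      + m\<^sup>2 * (m ^ k / fact k)) * exp (-m)) sums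
    ((m\<^sup>2 * exp m + (1 - 2 * m) * (m * exp m) + m\<^sup>2 * exp m) * exp (-m))"
    by (intro sums_mult2 sums_add sums_mult S)
  also have "(m\<^sup>2 * exp m + (1 - 2 * m) * (m * exp m) + m\<^sup>2 * exp m) * exp (-m) = m * (exp m * exp (-m))"
    by (simp add: algebra_simps power2_eq_square)
  also have "\<dots> = m" by (simp flip: exp_add)
  also have "(\<lambda>k. (real k * (real k - 1) * (m ^ k / fact k) + (1 - 2 * m) * (real k * (m ^ k / fact k))
      + m\<^sup>2 * (m ^ k / fact k)) * exp (-m)) = (\<lambda>k. m ^ k / fact k * exp (-m) * (real k - m)\<^sup>2)"
  proof -
    have "(x * (x - 1) * w + (1 - 2 * m) * (x * w) + m\<^sup>2 * w) * z = w * z * (x - m)\<^sup>2" for x w z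
      by algebra
    then show ?thesis by blast
  qed
  finally have sums: "(\<lambda>k. m ^ k / fact k * exp (-m) * (real k - m)\<^sup>2) sums m" .
  have "(\<integral>\<^sup>+k. ennreal ((real k - m)\<^sup>2) \<partial>measure_pmf (poisson_pmf m)) =
      (\<integral>\<^sup>+k. ennreal (m ^ k / fact k * exp (-m) * (real k - m)\<^sup>2) \<partial>count_space UNIV)"
    using assms by (simp add: nn_integral_measure_pmf flip: ennreal_mult')
  also have "\<dots> = (\<Sum>k. ennreal (m ^ k / fact k * exp (-m) * (real k - m)\<^sup>2))"
    by (rule nn_integral_count_space_nat)
  also have "\<dots> = ennreal m"
    using sums assms by (subst suminf_ennreal2) (auto simp: sums_iff)
  finally show ?thesis .
qed

lemma poisson_process_distr:
  assumes "poisson_process M a N" "0 < t"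
  shows "distr M (count_space UNIV) (N t) = measure_pmf (poisson_pmf (a * t))"
proof -
  have "distr M (count_space UNIV) (\<lambda>\<omega>. N t \<omega> - N 0 \<omega>) = measure_pmf (poisson_pmf (a * (t - 0)))"
    using assms unfolding poisson_process_def by blast
  moreover have "distr M (count_space UNIV) (\<lambda>\<omega>. N t \<omega> - N 0 \<omega>) = distr M (count_space UNIV) (N t)"
    using assms by (intro distr_cong) (auto simp: poisson_process_def)
  ultimately show ?thesis by simp
qed

lemma poisson_process_measurable:
  assumes "poisson_process M a N" "0 \<le> t"
  shows "(\<lambda>\<omega>. real (N t \<omega>)) \<in> borel_measurable M"
proof -
  have [measurable]: "N t \<in> M \<rightarrow>\<^sub>M count_space UNIV" using assms by (auto simp: poisson_process_def)
  show ?thesis by measurable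
qed

text \<open>
  The expected squared errors \<open>a / n\<^sup>2\<close> are summable, so the squared errors themselves are almost surely
  summable and tend to \<open>0\<close>.
\<close>

lemma poisson_process_squares_AE:
  assumes N: "poisson_process M a N" and a: "0 < a"
  shows "AE \<omega> in M. (\<lambda>n. real (N (real (n\<^sup>2)) \<omega>) / real (n\<^sup>2)) \<longlonglongrightarrow> a"
proof -
  \<comment> \<open>shifted by one, because the quotient at \<open>n = 0\<close> is the default value \<open>0\<close>\<close>
  define D where "D n \<omega> = (real (N (real ((Suc n)\<^sup>2)) \<omega>) / real ((Suc n)\<^sup>2) - a)\<^sup>2" for n \<omega>
  have [measurable]: "D n \<in> borel_measurable M" for n
    unfolding D_def using poisson_process_measurable[OF N, of "real ((Suc n)\<^sup>2)"] by measurable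
  have E: "(\<integral>\<^sup>+\<omega>. ennreal (D n \<omega>) \<partial>M) = ennreal (a / real ((Suc n)\<^sup>2))" for n
  proof -
    define t where "t = real ((Suc n)\<^sup>2)"
    have t: "0 < t" by (simp add: t_def)
    have [measurable]: "N t \<in> M \<rightarrow>\<^sub>M count_space UNIV" using N t by (auto simp: poisson_process_def)
    have "(\<integral>\<^sup>+\<omega>. ennreal (D n \<omega>) \<partial>M) =
        (\<integral>\<^sup>+\<omega>. ennreal (1 / t\<^sup>2) * ennreal ((real (N t \<omega>) - a * t)\<^sup>2) \<partial>M)"
    proof (rule nn_integral_cong)
      fix \<omega>
      have "real (N t \<omega>) / t - a = (real (N t \<omega>) - a * t) / t" using t by (simp add: diff_divide_distrib)
      then have "D n \<omega> = 1 / t\<^sup>2 * (real (N t \<omega>) - a * t)\<^sup>2"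
        by (simp only: D_def t_def[symmetric] power_divide) simp
      then show "ennreal (D n \<omega>) = ennreal (1 / t\<^sup>2) * ennreal ((real (N t \<omega>) - a * t)\<^sup>2)"
        by (simp only: ennreal_mult' zero_le_divide_1_iff zero_le_power2)
    qed
    also have "\<dots> = ennreal (1 / t\<^sup>2) * (\<integral>\<^sup>+\<omega>. ennreal ((real (N t \<omega>) - a * t)\<^sup>2) \<partial>M)"
      by (rule nn_integral_cmult) measurable
    also have "(\<integral>\<^sup>+\<omega>. ennreal ((real (N t \<omega>) - a * t)\<^sup>2) \<partial>M) =
        (\<integral>\<^sup>+k. ennreal ((real k - a * t)\<^sup>2) \<partial>distr M (count_space UNIV) (N t))"
      by (rule nn_integral_distr[symmetric]) auto
    also have "\<dots> = ennreal (a * t)"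
      using poisson_process_distr[OF N t] poisson_variance[of "a * t"] a t by simp
    also have "ennreal (1 / t\<^sup>2) * ennreal (a * t) = ennreal (a / t)"
      using a t by (simp add: power2_eq_square flip: ennreal_mult')
    finally show ?thesis by (simp add: t_def)
  qed
  have sq: "summable (\<lambda>n. a / real ((Suc n)\<^sup>2))"
  proof -
    have "summable (\<lambda>n. 1 / real (Suc n) ^ 2)"
      using inverse_squares_sums by (auto simp: sums_iff add.commute)
    from summable_mult[OF this, of a] show ?thesis by (simp del: of_nat_Suc)
  qed
  have "(\<integral>\<^sup>+\<omega>. (\<Sum>n. ennreal (D n \<omega>)) \<partial>M) = (\<Sum>n. ennreal (a / real ((Suc n)\<^sup>2)))"
    by (subst nn_integral_suminf) (simp_all add: E)
  also have "\<dots> \<noteq> \<infinity>"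
    using a sq by (subst suminf_ennreal2) auto
  finally have "AE \<omega> in M. (\<Sum>n. ennreal (D n \<omega>)) \<noteq> \<infinity>"
    by (intro nn_integral_noteq_infinite) auto
  then show ?thesis
  proof (rule AE_mp, intro AE_I2 impI)
    fix \<omega> assume "(\<Sum>n. ennreal (D n \<omega>)) \<noteq> \<infinity>"
    then have "summable (\<lambda>n. D n \<omega>)"
      by (intro summable_suminf_not_top) (auto simp: D_def)
    then have "(\<lambda>n. D n \<omega>) \<longlonglongrightarrow> 0" by (rule summable_LIMSEQ_zero)
    then have "(\<lambda>n. sqrt (D n \<omega>)) \<longlonglongrightarrow> sqrt 0" by (rule tendsto_real_sqrt)
    then have "(\<lambda>n. real (N (real ((Suc n)\<^sup>2)) \<omega>) / real ((Suc n)\<^sup>2) - a) \<longlonglongrightarrow> 0"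
      unfolding D_def real_sqrt_abs real_sqrt_zero by (rule tendsto_rabs_zero_cancel)
    then have "(\<lambda>n. real (N (real ((Suc n)\<^sup>2)) \<omega>) / real ((Suc n)\<^sup>2)) \<longlonglongrightarrow> a"
      by (rule LIM_zero_cancel)
    then show "(\<lambda>n. real (N (real (n\<^sup>2)) \<omega>) / real (n\<^sup>2)) \<longlonglongrightarrow> a"
      by (rule LIMSEQ_imp_Suc)
  qed
qed

text \<open>
  The gap \<open>2 n + 1\<close> between consecutive squares around \<open>t\<close> is of order \<open>sqrt t\<close>, hence below any
  multiple of \<open>t\<close> up to a constant.
\<close>

lemma square_between:
  fixes t :: real
  assumes "0 \<le> t" "0 < \<delta>"
  obtains n :: nat where "real (n\<^sup>2) \<le> t" "t \<le> real ((Suc n)\<^sup>2)"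
    "real ((Suc n)\<^sup>2) \<le> real (n\<^sup>2) + \<delta> * t + 1 / \<delta> + 1"
proof -
  define n where "n = nat \<lfloor>sqrt t\<rfloor>"
  have "0 \<le> sqrt t" using assms by simp
  then have n: "real n \<le> sqrt t" "sqrt t \<le> real (Suc n)" by (simp_all add: n_def) linarith+
  have n2: "real (n\<^sup>2) \<le> t" using power_mono[OF n(1), of 2] assms by simp
  moreover have "t \<le> real ((Suc n)\<^sup>2)" using power_mono[OF n(2), of 2] assms by simp
  moreover have "0 \<le> (\<delta> * sqrt t - 1)\<^sup>2" by simp
  then have "2 * sqrt t * \<delta> \<le> (\<delta> * t + 1 / \<delta>) * \<delta>"
    using assms by (simp add: power2_eq_square algebra_simps)
  then have "2 * sqrt t \<le> \<delta> * t + 1 / \<delta>" using assms by simp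
  with n(1) have "2 * real n \<le> \<delta> * t + 1 / \<delta>" by linarith
  then have "real ((Suc n)\<^sup>2) \<le> real (n\<^sup>2) + \<delta> * t + 1 / \<delta> + 1"
    by (simp add: power2_eq_square)
  ultimately show thesis by (rule that)
qed

text \<open>
  A monotone function is trapped between its values at neighbouring squares. An affine error bound
  with arbitrarily small slope is the form in which the law of large numbers survives rescaling:
  dividing by \<open>r\<close> makes the constant disappear.
\<close>

lemma mono_squares_linear_bound:
  fixes N :: "real \<Rightarrow> real"
  assumes mono: "mono_on {0..} N" and a: "0 \<le> a"
    and lim: "(\<lambda>n. N (real (n\<^sup>2)) / real (n\<^sup>2)) \<longlonglongrightarrow> a" and \<epsilon>: "0 < \<epsilon>"
  obtains C where "\<And>t. 0 \<le> t \<Longrightarrow> \<bar>N t - a * t\<bar> \<le> \<epsilon> * t + C"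
proof -
  define e where "e = min (\<epsilon> / 2) 1"
  have e: "0 < e" "e \<le> \<epsilon> / 2" "e \<le> 1" using \<epsilon> by (auto simp: e_def)
  \<comment> \<open>half of \<open>\<epsilon>\<close> pays for the error at the squares, half for the distance to the next square\<close>
  define \<delta> where "\<delta> = \<epsilon> / (2 * (a + 1))"
  have \<delta>: "0 < \<delta>" using \<epsilon> a by (simp add: \<delta>_def)
  have a\<delta>: "(a + 1) * \<delta> = \<epsilon> / 2"
  proof -
    have "a + 1 \<noteq> 0" using a by simp
    then show ?thesis by (simp add: \<delta>_def divide_simps)
  qed
  have "\<forall>\<^sub>F n in sequentially. norm (N (real (n\<^sup>2)) / real (n\<^sup>2) - a) \<le> e"
    using tendstoD[OF lim e(1)] by eventually_elim (simp add: dist_real_def)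
  then obtain m where m: "\<And>n. n \<ge> m \<Longrightarrow> \<bar>N (real (n\<^sup>2)) / real (n\<^sup>2) - a\<bar> \<le> e"
    by (auto simp: eventually_sequentially)
  define C where "C = (\<Sum>n\<le>m. \<bar>N (real (n\<^sup>2)) - a * real (n\<^sup>2)\<bar>)"
  have "0 \<le> C" by (auto simp: C_def intro: sum_nonneg)
  have sq: "\<bar>N (real (n\<^sup>2)) - a * real (n\<^sup>2)\<bar> \<le> e * real (n\<^sup>2) + C" for n
  proof (cases "n \<le> m")
    case True
    then have "\<bar>N (real (n\<^sup>2)) - a * real (n\<^sup>2)\<bar> \<le> C"
      unfolding C_def by (intro member_le_sum) auto
    then show ?thesis using e by (simp add: add_increasing)
  next
    case False
    define s where "s = real (n\<^sup>2)"
    have s: "0 < s" using False by (simp add: s_def)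
    have "\<bar>N s / s - a\<bar> \<le> e" using m[of n] False by (simp add: s_def)
    then have "\<bar>N s / s - a\<bar> * s \<le> e * s" using s by simp
    also have "\<bar>N s / s - a\<bar> * s = \<bar>(N s / s - a) * s\<bar>" using s by (simp add: abs_mult)
    also have "(N s / s - a) * s = N s - a * s" using s by (simp add: algebra_simps)
    finally show ?thesis using \<open>0 \<le> C\<close> by (simp add: s_def)
  qed
  define K where "K = C + (a + 1) * (1 / \<delta> + 1)"
  have "\<bar>N t - a * t\<bar> \<le> \<epsilon> * t + K" if t: "0 \<le> t" for t
  proof -
    obtain n :: nat where n: "real (n\<^sup>2) \<le> t" "t \<le> real ((Suc n)\<^sup>2)"
      "real ((Suc n)\<^sup>2) \<le> real (n\<^sup>2) + \<delta> * t + 1 / \<delta> + 1"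
      using square_between[OF t \<delta>] by blast
    define u v where "u = real (n\<^sup>2)" and "v = real ((Suc n)\<^sup>2)"
    have uv: "0 \<le> u" "u \<le> t" "t \<le> v" "v \<le> u + (\<delta> * t + (1 / \<delta> + 1))"
      using n by (auto simp: u_def v_def)
    have N: "N u \<le> N t" "N t \<le> N v" using mono uv by (auto simp: mono_on_def)
    have U: "\<bar>N u - a * u\<bar> \<le> e * u + C" and V: "\<bar>N v - a * v\<bar> \<le> e * v + C"
      using sq[of n] sq[of "Suc n"] by (simp_all add: u_def v_def)
    have rest: "(a + 1) * (\<delta> * t + (1 / \<delta> + 1)) = \<epsilon> / 2 * t + (a + 1) * (1 / \<delta> + 1)"
      using a\<delta> by (simp add: distrib_left flip: mult.assoc)
    have "(a + e) * v \<le> (a + e) * (t + (\<delta> * t + (1 / \<delta> + 1)))"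
      using uv a e by (intro mult_left_mono) auto
    also have "\<dots> \<le> (a + e) * t + (a + 1) * (\<delta> * t + (1 / \<delta> + 1))"
      unfolding distrib_left[of _ t] using e t \<delta> by (intro add_left_mono mult_right_mono) auto
    finally have v: "(a + e) * v \<le> (a + e) * t + \<epsilon> / 2 * t + (a + 1) * (1 / \<delta> + 1)"
      using rest by simp
    have "a * t \<le> a * (u + (\<delta> * t + (1 / \<delta> + 1)))"
      using uv a by (intro mult_left_mono) auto
    also have "\<dots> \<le> a * u + (a + 1) * (\<delta> * t + (1 / \<delta> + 1))"
      unfolding distrib_left[of _ u] using t \<delta> by (intro add_left_mono mult_right_mono) auto
    finally have u: "a * t \<le> a * u + \<epsilon> / 2 * t + (a + 1) * (1 / \<delta> + 1)" using rest by simp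
    have et: "e * t \<le> \<epsilon> / 2 * t" using e t by (intro mult_right_mono) auto
    have eu: "e * u \<le> e * t" using e uv by (intro mult_left_mono) auto
    have "N t - a * t \<le> \<epsilon> * t + K"
      using N(2) V v et by (simp add: K_def distrib_right abs_le_iff)
    moreover have "a * t - N t \<le> \<epsilon> * t + K"
      using N(1) U u et eu by (simp add: K_def abs_le_iff)
    ultimately show ?thesis by linarith
  qed
  then show thesis by (rule that)
qed

lemma uoc_linear_iff_squares:
  fixes N :: "real \<Rightarrow> real"
  assumes mono: "mono_on {0..} N" and a: "0 \<le> a"
  shows "uoc (\<lambda>r x. N (real r * x) / real r) (\<lambda>x. a * x) \<longleftrightarrow>
    (\<lambda>n. N (real (n\<^sup>2)) / real (n\<^sup>2)) \<longlonglongrightarrow> a"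
proof
  assume "uoc (\<lambda>r x. N (real r * x) / real r) (\<lambda>x. a * x)"
  from uoc_tendsto[OF this, of 1] have "(\<lambda>r. N (real r) / real r) \<longlonglongrightarrow> a" by simp
  from LIMSEQ_subseq_LIMSEQ[OF this, of "\<lambda>n. n\<^sup>2"]
  show "(\<lambda>n. N (real (n\<^sup>2)) / real (n\<^sup>2)) \<longlonglongrightarrow> a"
    by (auto simp: o_def strict_mono_def power_strict_mono)
next
  assume lim: "(\<lambda>n. N (real (n\<^sup>2)) / real (n\<^sup>2)) \<longlonglongrightarrow> a"
  show "uoc (\<lambda>r x. N (real r * x) / real r) (\<lambda>x. a * x)"
  proof (rule uocI)
    fix b \<epsilon> :: real assume b: "0 \<le> b" and \<epsilon>: "0 < \<epsilon>"
    define e where "e = \<epsilon> / (2 * (b + 1))"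
    have e: "0 < e" "e * b < \<epsilon> / 2" using \<epsilon> b by (auto simp: e_def field_simps)
    obtain C where C: "\<And>t. 0 \<le> t \<Longrightarrow> \<bar>N t - a * t\<bar> \<le> e * t + C"
      using mono_squares_linear_bound[OF mono a lim e(1)] by blast
    have "(\<lambda>r. C / real r) \<longlonglongrightarrow> 0" by real_asymp
    then have "\<forall>\<^sub>F r in sequentially. C / real r < \<epsilon> / 2"
      using \<epsilon> by (intro order_tendstoD) auto
    then show "\<forall>\<^sub>F r in sequentially. \<forall>x\<in>{0..b}. \<bar>N (real r * x) / real r - a * x\<bar> < \<epsilon>"
      using eventually_gt_at_top[of 0]
    proof eventually_elim
      case (elim r)
      show ?case
      proof
        fix x assume x: "x \<in> {0..b}"
        have "\<bar>N (real r * x) / real r - a * x\<bar> = \<bar>N (real r * x) - a * (real r * x)\<bar> / real r"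
        proof -
          have "N (real r * x) / real r - a * x = (N (real r * x) - a * (real r * x)) / real r"
            using elim(2) by (simp add: diff_divide_distrib)
          then show ?thesis by (simp add: abs_divide)
        qed
        also have "\<dots> \<le> (e * (real r * x) + C) / real r"
          using x elim(2) by (intro divide_right_mono C) auto
        also have "\<dots> = e * x + C / real r" using elim(2) by (simp add: add_divide_distrib)
        also have "e * x \<le> e * b" using x e by (intro mult_left_mono) auto
        finally show "\<bar>N (real r * x) / real r - a * x\<bar> < \<epsilon>" using elim(1) e by linarith
      qed
    qed
  qed
qed

text \<open>
  Uniform convergence on compact sets involves uncountably many times; the characterization by the
  squares makes the event measurable and reduces it to finitely many almost sure limits.
\<close>

lemma (in prob_space) lln_set_prob:
  assumes pos: "\<And>e. e \<in> edges S p \<Longrightarrow> 0 < p e * lam" "0 < \<mu>"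
    and dp: "driving_processes M S p lam \<mu> \<Lambda> Sv"
  shows "prob (lln_set M S p lam \<mu> \<Lambda> Sv) = 1"
proof -
  define P where "P N a \<omega> \<longleftrightarrow> (\<lambda>n. real (N (real (n\<^sup>2)) \<omega>) / real (n\<^sup>2)) \<longlonglongrightarrow> a"
    for N :: "real \<Rightarrow> 'a \<Rightarrow> nat" and a \<omega>
  have fin: "finite (edges S p)" by (simp add: edges_def pairs_def)
  have \<Lambda>: "poisson_process M (p e * lam) (\<Lambda> e)" if "e \<in> edges S p" for e
    using dp that by (auto simp: driving_processes_def)
  have Sv: "poisson_process M \<mu> (Sv j)" if "j \<in> {1..S}" for j
    using dp that by (auto simp: driving_processes_def)
  have iff: "uoc (\<lambda>r x. real (N (real r * x) \<omega>) / real r) (\<lambda>x. a * x) \<longleftrightarrow> P N a \<omega>"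
    if "poisson_process M a N" "0 \<le> a" "\<omega> \<in> space M" for N a \<omega>
    unfolding P_def
    by (rule uoc_linear_iff_squares) (use that in \<open>auto simp: poisson_process_def mono_on_def\<close>)
  have eq: "lln_set M S p lam \<mu> \<Lambda> Sv = {\<omega> \<in> space M.
     (\<forall>e\<in>edges S p. P (\<Lambda> e) (p e * lam) \<omega>) \<and> (\<forall>j\<in>{1..S}. P (Sv j) \<mu> \<omega>)}"
    unfolding lln_set_def using iff[OF \<Lambda> less_imp_le[OF pos(1)]] iff[OF Sv less_imp_le[OF pos(2)]] by blast
  have meas: "{\<omega> \<in> space M. P N a \<omega>} \<in> sets M" if "poisson_process M a N" for N a
    unfolding P_def using poisson_process_measurable[OF that] by measurable
  have "lln_set M S p lam \<mu> \<Lambda> Sv \<in> sets M"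
  proof -
    have all: "{\<omega> \<in> space M. \<forall>i\<in>I. R i \<omega>} \<in> sets M"
      if "finite I" "\<And>i. i \<in> I \<Longrightarrow> {\<omega> \<in> space M. R i \<omega>} \<in> sets M" for I :: "'i set" and R
      using that by (cases "I = {}") (auto intro: sets.sets_Collect_finite_All')
    show ?thesis
      unfolding eq by (intro sets.sets_Collect_conj all meas fin \<Lambda> Sv) auto
  qed
  moreover have "AE \<omega> in M. \<omega> \<in> lln_set M S p lam \<mu> \<Lambda> Sv"
  proof -
    have "AE \<omega> in M. \<forall>e\<in>edges S p. P (\<Lambda> e) (p e * lam) \<omega>"
      unfolding P_def using fin \<Lambda> pos(1) by (intro AE_finite_allI poisson_process_squares_AE)
    moreover have "AE \<omega> in M. \<forall>j\<in>{1..S}. P (Sv j) \<mu> \<omega>"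
      unfolding P_def using Sv pos(2) by (intro AE_finite_allI poisson_process_squares_AE) auto
    ultimately show ?thesis
      using AE_space by eventually_elim (simp add: eq)
  qed
  ultimately show ?thesis by (simp add: prob_eq_1)
qed

section \<open>The graph of stations\<close>

text \<open>
  Both sides sum over pairs of an edge and one of its ends, grouped by the edge or by the end.
\<close>

lemma sum_edge_ends:
  fixes f :: "'v set \<Rightarrow> 'v \<Rightarrow> 'b::comm_monoid_add"
  assumes V: "finite V" and E: "\<And>e. e \<in> E \<Longrightarrow> e \<subseteq> V \<and> card e = 2"
  shows "(\<Sum>e\<in>E. \<Sum>j\<in>e. f e j) = (\<Sum>j\<in>V. \<Sum>i | {i, j} \<in> E. f {i, j} j)"
proof -
  have nb: "{i. {i, j} \<in> E} \<subseteq> V" for j using E by blast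
  have fin: "finite E" using V E by (intro finite_subset[of E "Pow V"]) auto
  have bij: "bij_betw (\<lambda>(j, i). ({i, j}, j)) (SIGMA j:V. {i. {i, j} \<in> E}) (SIGMA e:E. e)"
  proof (rule bij_betw_imageI)
    show "inj_on (\<lambda>(j, i). ({i, j}, j)) (SIGMA j:V. {i. {i, j} \<in> E})"
      by (auto simp: inj_on_def doubleton_eq_iff)
    show "(\<lambda>(j, i). ({i, j}, j)) ` (SIGMA j:V. {i. {i, j} \<in> E}) = (SIGMA e:E. e)"
    proof
      show "(SIGMA e:E. e) \<subseteq> (\<lambda>(j, i). ({i, j}, j)) ` (SIGMA j:V. {i. {i, j} \<in> E})"
      proof clarify
        fix e j assume e: "e \<in> E" "j \<in> e"
        obtain a b where ab: "e = {a, b}" using E[OF e(1)] by (auto simp: card_2_iff)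
        define i where "i = (if j = a then b else a)"
        have ei: "e = {i, j}" using ab e(2) by (auto simp: i_def)
        show "(e, j) \<in> (\<lambda>(j, i). ({i, j}, j)) ` (SIGMA j:V. {i. {i, j} \<in> E})"
          using E[OF e(1)] e by (intro image_eqI[of _ _ "(j, i)"]) (auto simp: ei)
      qed
    qed auto
  qed
  have "(\<Sum>e\<in>E. \<Sum>j\<in>e. f e j) = (\<Sum>(e, j)\<in>(SIGMA e:E. e). f e j)"
    using E V by (intro sum.Sigma fin) (auto dest: finite_subset)
  also have "\<dots> = (\<Sum>(j, i)\<in>(SIGMA j:V. {i. {i, j} \<in> E}). f {i, j} j)"
    by (subst sum.reindex_bij_betw[OF bij, symmetric]) (auto intro: sum.cong)
  also have "\<dots> = (\<Sum>j\<in>V. \<Sum>i | {i, j} \<in> E. f {i, j} j)"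
    using V nb by (intro sum.Sigma[symmetric]) (auto intro: finite_subset)
  finally show ?thesis .
qed

locale station_network =
  fixes S :: nat and p :: "nat set \<Rightarrow> real" and lam \<mu> :: real
  assumes stations: "2 \<le> S" and lam_pos: "0 < lam" and \<mu>_pos: "0 < \<mu>"
    and p_nonneg: "\<And>e. e \<in> pairs S \<Longrightarrow> 0 \<le> p e" and p_total: "(\<Sum>e\<in>pairs S. p e) = 1"
    and connected: "connected_graph {1..S} (edges S p)"
begin

lemma pairsD: "e \<in> pairs S \<Longrightarrow> e \<subseteq> {1..S} \<and> card e = 2"
  by (simp add: pairs_def)

lemma edgesD: "e \<in> edges S p \<Longrightarrow> e \<subseteq> {1..S} \<and> card e = 2"
  by (simp add: edges_def pairs_def)

lemma edge_pos: "e \<in> edges S p \<Longrightarrow> 0 < p e"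
  by (simp add: edges_def)

lemma edge_ends: "{i, j} \<in> edges S p \<Longrightarrow> i \<in> {1..S} \<and> j \<in> {1..S} \<and> i \<noteq> j"
  using edgesD[of "{i, j}"] by (cases "i = j") auto

lemma edgeE:
  assumes "e \<in> edges S p"
  obtains i j where "e = {i, j}" "i \<noteq> j" "i \<in> {1..S}" "j \<in> {1..S}"
proof -
  obtain i j where "e = {i, j}" using edgesD[OF assms] by (auto simp: card_2_iff)
  with edge_ends[of i j] assms that show thesis by blast
qed

lemma finite_edges: "finite (edges S p)"
  by (rule finite_subset[of _ "Pow {1..S}"]) (use edgesD in auto)

lemma sum_incoming:
  "(\<Sum>e\<in>edges S p. \<Sum>j\<in>e. f e j) = (\<Sum>j\<in>{1..S}. \<Sum>i | {i, j} \<in> edges S p. f {i, j} j)"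
  by (rule sum_edge_ends) (use edgesD in auto)

text \<open>
  The load of a station is half the weight of its edges, so each edge splits its weight evenly between
  its ends.
\<close>

lemma sum_edge_weights:
  "(\<Sum>e\<in>edges S p. p e * (\<Sum>i\<in>e. w i)) = 2 * (\<Sum>j\<in>{1..S}. load S p j * w j)"
proof -
  have "(\<Sum>e\<in>edges S p. p e * (\<Sum>i\<in>e. w i)) = (\<Sum>e\<in>pairs S. p e * (\<Sum>i\<in>e. w i))"
  proof (rule sum.mono_neutral_left)
    show "finite (pairs S)" by (simp add: pairs_def)
    show "\<forall>e\<in>pairs S - edges S p. p e * (\<Sum>i\<in>e. w i) = 0"
    proof
      fix e assume e: "e \<in> pairs S - edges S p"
      with p_nonneg[of e] have "p e = 0" by (auto simp: edges_def)
      then show "p e * (\<Sum>i\<in>e. w i) = 0" by simp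
    qed
  qed (auto simp: edges_def)
  also have "\<dots> = (\<Sum>e\<in>pairs S. \<Sum>i\<in>e. p e * w i)" by (simp add: sum_distrib_left)
  also have "\<dots> = (\<Sum>j\<in>{1..S}. \<Sum>i | {i, j} \<in> pairs S. p {i, j} * w j)"
    by (rule sum_edge_ends) (use pairsD in auto)
  also have "\<dots> = (\<Sum>j\<in>{1..S}. 2 * (load S p j * w j))"
  proof (rule sum.cong)
    fix j assume j: "j \<in> {1..S}"
    then have "{i. {i, j} \<in> pairs S} = {1..S} - {j}"
      by (auto simp: pairs_def card_insert_if)
    then show "(\<Sum>i | {i, j} \<in> pairs S. p {i, j} * w j) = 2 * (load S p j * w j)"
      by (simp add: load_def insert_commute flip: sum_distrib_right)
  qed simp
  finally show ?thesis by (simp add: sum_distrib_left)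
qed

lemma total_load: "(\<Sum>j\<in>{1..S}. load S p j) = 1"
proof -
  have "(\<Sum>e\<in>edges S p. p e * (\<Sum>i\<in>e. 1)) = (\<Sum>e\<in>edges S p. p e * 2)"
    using edgesD by (intro sum.cong) auto
  also have "\<dots> = (\<Sum>e\<in>pairs S. p e) * 2"
    unfolding sum_distrib_right
  proof (rule sum.mono_neutral_left)
    show "finite (pairs S)" by (simp add: pairs_def)
    show "\<forall>e\<in>pairs S - edges S p. p e * 2 = 0"
      using p_nonneg by (force simp: edges_def)
  qed (auto simp: edges_def)
  finally show ?thesis using sum_edge_weights[of "\<lambda>_. 1"] p_total by simp
qed

text \<open>
  A connected graph with at least two vertices has no isolated vertex.
\<close>

lemma load_pos:
  assumes i: "i \<in> {1..S}"
  shows "0 < load S p i"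
proof -
  obtain j where j: "j \<in> {1..S}" "j \<noteq> i"
    using i stations by (cases "i = 1") (auto intro: that[of 1] that[of 2])
  have "(i, j) \<in> {(a, b). {a, b} \<in> edges S p}\<^sup>*"
    using connected i j by (auto simp: connected_graph_def)
  then obtain k where k: "{i, k} \<in> edges S p"
    using j(2) by (cases rule: converse_rtranclE) auto
  have ik: "k \<in> {1..S} - {i}" using edge_ends[OF k] by auto
  have "p {i, k} \<le> (\<Sum>j\<in>{1..S} - {i}. p {i, j})"
  proof (rule member_le_sum[OF ik])
    fix l assume "l \<in> {1..S} - {i} - {k}"
    then show "0 \<le> p {i, l}" using i by (intro p_nonneg) (auto simp: pairs_def)
  qed simp
  with edge_pos[OF k] show ?thesis by (simp add: load_def)
qed

text \<open>
  Sending every arrival to the less loaded end of its edge, instead of half of it to each end, lowers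
  the weighted flow of arrivals if moving an arrival to the lower end lowers its weight.
\<close>

lemma sum_edge_min_le:
  fixes g x
  assumes g: "\<And>i j. {i, j} \<in> edges S p \<Longrightarrow> x i \<le> x j \<Longrightarrow> g (x i) \<le> (g (x i) + g (x j)) / (2::real)"
  shows "(\<Sum>e\<in>edges S p. p e * g (Min (x ` e))) \<le> (\<Sum>j\<in>{1..S}. load S p j * g (x j :: real))"
proof -
  have "p e * g (Min (x ` e)) \<le> p e * (\<Sum>i\<in>e. g (x i)) / 2" if e: "e \<in> edges S p" for e
  proof -
    obtain a b where "e = {a, b}" "a \<noteq> b" by (rule edgeE[OF e])
    then obtain i j where ij: "e = {i, j}" "i \<noteq> j" "x i \<le> x j"
      using linear[of "x a" "x b"] by (auto simp: insert_commute)
    have "p e * g (x i) \<le> p e * ((g (x i) + g (x j)) / 2)"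
      using g[of i j] ij e edge_pos[OF e] by (intro mult_left_mono) auto
    then show ?thesis using ij by (simp add: min_absorb1)
  qed
  then have "(\<Sum>e\<in>edges S p. p e * g (Min (x ` e))) \<le> (\<Sum>e\<in>edges S p. p e * (\<Sum>i\<in>e. g (x i)) / 2)"
    by (rule sum_mono)
  also have "\<dots> = (\<Sum>j\<in>{1..S}. load S p j * g (x j))"
    by (simp add: sum_edge_weights flip: sum_divide_distrib)
  finally show ?thesis .
qed

lemma sum_edge_min_ge:
  fixes g x
  assumes "\<And>i j. {i, j} \<in> edges S p \<Longrightarrow> x i \<le> x j \<Longrightarrow> g (x i) \<ge> (g (x i) + g (x j)) / (2::real)"
  shows "(\<Sum>e\<in>edges S p. p e * g (Min (x ` e))) \<ge> (\<Sum>j\<in>{1..S}. load S p j * g (x j :: real))"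
  using sum_edge_min_le[of x "\<lambda>u. - g u"] assms by (simp add: sum_negf field_simps)

end

section \<open>Derivatives on the half-line\<close>

lemma DERIV_of_has_integral:
  assumes cont: "continuous_on {0..} (g :: real \<Rightarrow> real)"
    and int: "\<And>t. 0 \<le> t \<Longrightarrow> (g has_integral G t) {0..t}" and t: "0 \<le> t"
  shows "(G has_real_derivative g t) (at t within {0..})"
proof -
  have "((\<lambda>x. integral {0..x} g) has_real_derivative g t) (at t within {0..t + 1})"
    using t by (intro integral_has_real_derivative continuous_on_subset[OF cont]) auto
  then have "((\<lambda>x. integral {0..x} g) has_real_derivative g t) (at t within {0..})"
    using at_within_nhd[of t "{..<t + 1}" "{0..t + 1}" "{0..}"]
    by (simp add: Int_def) (metis (no_types, lifting) less_add_one atLeast_def order_less_imp_le Collect_cong)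
  then show ?thesis
    by (rule has_field_derivative_transform_within[OF _ zero_less_one])
      (use t integral_unique[OF int] in auto)
qed

text \<open>
  Makes quadratic functions of the queues differentiable as soon as certain linear ones are: the
  second-order remainder of a Lipschitz path is negligible.
\<close>

lemma DERIV_lipschitz_square:
  fixes h :: "real \<Rightarrow> real"
  assumes h: "C-lipschitz_on X h" and t: "t \<in> X"
  shows "((\<lambda>s. (h s - h t)\<^sup>2) has_real_derivative 0) (at t within X)"
proof -
  have "((\<lambda>s. ((h s - h t)\<^sup>2 - (h t - h t)\<^sup>2) / (s - t)) \<longlongrightarrow> 0) (at t within X)"
  proof (rule Lim_null_comparison)
    show "\<forall>\<^sub>F s in at t within X. norm (((h s - h t)\<^sup>2 - (h t - h t)\<^sup>2) / (s - t)) \<le> C\<^sup>2 * \<bar>s - t\<bar>"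
      unfolding eventually_at_filter
    proof (intro always_eventually allI impI)
      fix s assume s: "s \<noteq> t" "s \<in> X"
      have "\<bar>h s - h t\<bar> \<le> C * \<bar>s - t\<bar>"
        using lipschitz_onD[OF h s(2) t] by (simp add: dist_real_def)
      then have "(h s - h t)\<^sup>2 \<le> (C * \<bar>s - t\<bar>)\<^sup>2"
        by (metis abs_ge_zero power2_abs power_mono)
      then show "norm (((h s - h t)\<^sup>2 - (h t - h t)\<^sup>2) / (s - t)) \<le> C\<^sup>2 * \<bar>s - t\<bar>"
        using s(1) by (simp add: abs_divide pos_divide_le_eq power_mult_distrib mult.assoc
            flip: power2_eq_square)
    qed
    have "((\<lambda>s. C\<^sup>2 * \<bar>s - t\<bar>) \<longlongrightarrow> C\<^sup>2 * \<bar>t - t\<bar>) (at t within X)" by (intro tendsto_intros)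
    then show "((\<lambda>s. C\<^sup>2 * \<bar>s - t\<bar>) \<longlongrightarrow> 0) (at t within X)" by simp
  qed
  then show ?thesis by (simp add: has_field_derivative_iff)
qed

text \<open>
  Gronwall's inequality from a zero initial value: \<open>exp (- K t) V t\<close> is nonincreasing.
\<close>

lemma gronwall_zero:
  fixes V :: "real \<Rightarrow> real"
  assumes V: "\<And>t. 0 \<le> t \<Longrightarrow> \<exists>d. (V has_real_derivative d) (at t within {0..}) \<and> d \<le> K * V t"
    and V0: "V 0 \<le> 0" and t: "0 \<le> t"
  shows "V t \<le> 0"
proof -
  define h where "h s = exp (- K * s) * V s" for s
  have h: "\<exists>d. (h has_real_derivative d) (at s within {0..}) \<and> d \<le> 0" if s: "0 \<le> s" for s
  proof -
    obtain d where d: "(V has_real_derivative d) (at s within {0..})" "d \<le> K * V s"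
      using V[OF s] by blast
    have "(h has_real_derivative exp (- K * s) * (d - K * V s)) (at s within {0..})"
      unfolding h_def by (auto intro!: derivative_eq_intros d(1) simp: algebra_simps)
    moreover have "exp (- K * s) * (d - K * V s) \<le> 0"
      using d(2) by (simp add: mult_le_0_iff)
    ultimately show ?thesis by blast
  qed
  have cont: "continuous_on {0..t} h"
    unfolding continuous_on_eq_continuous_within
  proof
    fix s assume "s \<in> {0..t}"
    then obtain d where "(h has_real_derivative d) (at s within {0..})" using h[of s] by auto
    then have "continuous (at s within {0..}) h" by (rule DERIV_continuous)
    then show "continuous (at s within {0..t}) h" by (rule continuous_within_subset) auto
  qed
  have "h t \<le> h 0"
  proof (rule DERIV_nonpos_imp_decreasing_open[OF t _ cont])
    fix s assume s: "0 < s" "s < t"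
    then have "at s within {0..} = at s" by (intro at_within_interior) (simp add: interior_Ici)
    with h[of s] s show "\<exists>y. (h has_real_derivative y) (at s) \<and> y \<le> 0" by auto
  qed
  also have "h 0 \<le> 0" using V0 by (simp add: h_def)
  finally show ?thesis by (simp add: h_def mult_le_0_iff)
qed

section \<open>Fluid paths\<close>

text \<open>
  The fluid equations, the nonnegativity of \<open>L\<close>, the Lipschitz continuity of the queues, and what
  remains of the routing rule in the limit: arrivals do not join the strictly longer queue. These
  conditions no longer mention the stochastic systems.
\<close>

locale fluid_path = station_network +
  fixes y :: ev_path
  assumes A_split: "\<And>i j t. {i, j} \<in> edges S p \<Longrightarrow> 0 \<le> t \<Longrightarrow>
      pA y {i, j} t = pAd y {i, j} i t + pAd y {i, j} j t"
    and A_rate: "\<And>e t. e \<in> edges S p \<Longrightarrow> 0 \<le> t \<Longrightarrow> pA y e t = p e * lam * pY y t"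
    and Q_balance: "\<And>j t. j \<in> {1..S} \<Longrightarrow> 0 \<le> t \<Longrightarrow>
      pQ y j t = pQ y j 0 + (\<Sum>i | {i, j} \<in> edges S p. pAd y {i, j} j t) - pD y j t"
    and D_rate: "\<And>j t. j \<in> {1..S} \<Longrightarrow> 0 \<le> t \<Longrightarrow> pD y j t = \<mu> * pT y j t"
    and Y_integral: "\<And>t. 0 \<le> t \<Longrightarrow> (pL y has_integral pY y t) {0..t}"
    and T_integral: "\<And>j t. j \<in> {1..S} \<Longrightarrow> 0 \<le> t \<Longrightarrow> (pZ y j has_integral pT y j t) {0..t}"
    and Z_eq: "\<And>j t. j \<in> {1..S} \<Longrightarrow> 0 \<le> t \<Longrightarrow> pZ y j t = min (pQ y j t) (load S p j * lam / \<mu>)"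
    and L_eq: "\<And>t. 0 \<le> t \<Longrightarrow> pL y t = 1 - (\<Sum>j\<in>{1..S}. max (pQ y j t - load S p j * lam / \<mu>) 0)"
    and L_nonneg: "\<And>t. 0 \<le> t \<Longrightarrow> 0 \<le> pL y t"
    and Q_lipschitz: "\<And>j. j \<in> {1..S} \<Longrightarrow> \<exists>C. C-lipschitz_on {0..} (pQ y j)"
    and longer_queue: "\<And>i j t. {i, j} \<in> edges S p \<Longrightarrow> 0 \<le> t \<Longrightarrow>
      pQ y i t / load S p i < pQ y j t / load S p j \<Longrightarrow>
      (pAd y {i, j} j has_real_derivative 0) (at t within {0..})"
begin

text \<open>
  Queue length per unit of load, the quantity that arrivals compare.
\<close>

definition x :: "nat \<Rightarrow> real \<Rightarrow> real" where
  "x j t = pQ y j t / load S p j"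

lemma Q_x: "j \<in> {1..S} \<Longrightarrow> pQ y j t = load S p j * x j t"
  using load_pos[of j] by (simp add: x_def)

lemma Z_x:
  assumes "j \<in> {1..S}" "0 \<le> t"
  shows "pZ y j t = load S p j * min (x j t) (lam / \<mu>)"
  using Z_eq[OF assms] Q_x[OF assms(1), of t] load_pos[OF assms(1)]
  by (simp add: min_mult_distrib_left)

lemma L_x:
  assumes "0 \<le> t"
  shows "pL y t = 1 - (\<Sum>j\<in>{1..S}. load S p j * max (x j t - lam / \<mu>) 0)"
proof -
  have "max (pQ y j t - load S p j * lam / \<mu>) 0 = load S p j * max (x j t - lam / \<mu>) 0"
    if "j \<in> {1..S}" for j
    using Q_x[OF that, of t] load_pos[OF that] by (simp add: max_mult_distrib_left algebra_simps)
  then show ?thesis by (simp add: L_eq[OF assms])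
qed

lemma Q_continuous: "j \<in> {1..S} \<Longrightarrow> continuous_on {0..} (pQ y j)"
  using Q_lipschitz lipschitz_on_continuous_on by blast

lemma L_continuous: "continuous_on {0..} (pL y)"
proof -
  have "continuous_on {0..} (\<lambda>t. 1 - (\<Sum>j\<in>{1..S}. max (pQ y j t - load S p j * lam / \<mu>) 0))"
    by (intro continuous_intros Q_continuous)
  then show ?thesis by (rule continuous_on_eq) (use L_eq in auto)
qed

lemma Z_continuous:
  assumes "j \<in> {1..S}"
  shows "continuous_on {0..} (pZ y j)"
proof -
  have "continuous_on {0..} (\<lambda>t. min (pQ y j t) (load S p j * lam / \<mu>))"
    by (intro continuous_intros Q_continuous assms)
  then show ?thesis by (rule continuous_on_eq) (use Z_eq[OF assms] in auto)
qed

lemma A_deriv: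
  assumes e: "e \<in> edges S p" and t: "0 \<le> t"
  shows "(pA y e has_real_derivative lam * p e * pL y t) (at t within {0..})"
proof -
  have "((\<lambda>t. p e * lam * pY y t) has_real_derivative p e * lam * pL y t) (at t within {0..})"
    by (intro DERIV_cmult DERIV_of_has_integral L_continuous Y_integral t)
  then show ?thesis
    by (rule has_field_derivative_transform_within[OF _ zero_less_one, THEN DERIV_cong])
      (use t A_rate[OF e] in auto)
qed

lemma shorter_queue:
  assumes e: "{i, j} \<in> edges S p" and t: "0 \<le> t"
    and less: "pQ y i t / load S p i < pQ y j t / load S p j"
  shows "(pAd y {i, j} i has_real_derivative lam * p {i, j} * pL y t) (at t within {0..})"
proof -
  have "((\<lambda>t. pA y {i, j} t - pAd y {i, j} j t) has_real_derivative lam * p {i, j} * pL y t - 0)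
      (at t within {0..})"
    by (intro DERIV_diff A_deriv longer_queue assms)
  then show ?thesis
    by (rule has_field_derivative_transform_within[OF _ zero_less_one, THEN DERIV_cong])
      (use t A_split[OF e] in auto)
qed

text \<open>
  With distinct levels all arrivals join the lower end. With equal levels the individual flows need
  not be differentiable, but both ends have the same weight and only the total flow on the edge enters.
\<close>

lemma edge_weighted_deriv:
  assumes e: "e \<in> edges S p" and t: "0 \<le> t"
  shows "((\<lambda>s. \<Sum>i\<in>e. g (x i t) * pAd y e i s) has_real_derivative
    lam * pL y t * (p e * g (Min ((\<lambda>i. x i t) ` e)))) (at t within {0..})"
proof -
  obtain a b where "e = {a, b}" "a \<noteq> b" by (rule edgeE[OF e])
  then obtain i j where ij: "e = {i, j}" "i \<noteq> j" "x i t \<le> x j t"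
    using linear[of "x a t" "x b t"] by (auto simp: insert_commute)
  have m: "Min ((\<lambda>i. x i t) ` e) = x i t" using ij by (simp add: min_absorb1)
  have sum: "(\<lambda>s. \<Sum>i\<in>e. g (x i t) * pAd y e i s) =
      (\<lambda>s. g (x i t) * pAd y e i s + g (x j t) * pAd y e j s)"
    using ij by simp
  consider "x i t < x j t" | "x i t = x j t" using ij(3) by linarith
  then show ?thesis
  proof cases
    case 1
    then have less: "pQ y i t / load S p i < pQ y j t / load S p j" by (simp add: x_def)
    have ed: "{i, j} \<in> edges S p" using e ij by simp
    have "((\<lambda>s. g (x i t) * pAd y e i s + g (x j t) * pAd y e j s) has_real_derivative
        g (x i t) * (lam * p {i, j} * pL y t) + g (x j t) * 0) (at t within {0..})"
      unfolding ij(1)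
      by (intro DERIV_add DERIV_cmult shorter_queue[OF ed t less] longer_queue[OF ed t less])
    then show ?thesis unfolding sum m by (rule DERIV_cong) (simp add: ij)
  next
    case 2
    have "((\<lambda>s. g (x i t) * pA y e s) has_real_derivative g (x i t) * (lam * p e * pL y t)) (at t within {0..})"
      by (intro DERIV_cmult A_deriv e t)
    then have "((\<lambda>s. g (x i t) * pAd y e i s + g (x j t) * pAd y e j s) has_real_derivative
        g (x i t) * (lam * p e * pL y t)) (at t within {0..})"
      by (rule has_field_derivative_transform_within[OF _ zero_less_one])
        (use t 2 e ij A_split[of i j] in \<open>auto simp: distrib_left\<close>)
    then show ?thesis unfolding sum m by (rule DERIV_cong) simp
  qed
qed

text \<open>
  The weights are frozen at time \<open>t\<close>. Regrouping the arrivals by edges instead of stations lets the two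
  routed components on an edge enter only together.
\<close>

lemma weighted_queue_deriv:
  assumes t: "0 \<le> t"
  shows "((\<lambda>s. \<Sum>j\<in>{1..S}. g (x j t) * pQ y j s) has_real_derivative
    lam * pL y t * (\<Sum>e\<in>edges S p. p e * g (Min ((\<lambda>i. x i t) ` e)))
      - \<mu> * (\<Sum>j\<in>{1..S}. g (x j t) * pZ y j t)) (at t within {0..})"
proof -
  have eq: "(\<Sum>j\<in>{1..S}. g (x j t) * pQ y j s) = (\<Sum>j\<in>{1..S}. g (x j t) * pQ y j 0)
      + (\<Sum>e\<in>edges S p. \<Sum>i\<in>e. g (x i t) * pAd y e i s)
      - (\<Sum>j\<in>{1..S}. g (x j t) * (\<mu> * pT y j s))" if s: "0 \<le> s" for s
  proof -
    have "(\<Sum>j\<in>{1..S}. g (x j t) * pQ y j s) = (\<Sum>j\<in>{1..S}. g (x j t) * pQ y j 0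
        + (\<Sum>i | {i, j} \<in> edges S p. g (x j t) * pAd y {i, j} j s) - g (x j t) * (\<mu> * pT y j s))"
    proof (rule sum.cong)
      fix j assume j: "j \<in> {1..S}"
      show "g (x j t) * pQ y j s = g (x j t) * pQ y j 0
        + (\<Sum>i | {i, j} \<in> edges S p. g (x j t) * pAd y {i, j} j s) - g (x j t) * (\<mu> * pT y j s)"
        unfolding Q_balance[OF j s] D_rate[OF j s, symmetric] by (simp add: algebra_simps sum_distrib_left)
    qed simp
    also have "\<dots> = (\<Sum>j\<in>{1..S}. g (x j t) * pQ y j 0)
      + (\<Sum>e\<in>edges S p. \<Sum>i\<in>e. g (x i t) * pAd y e i s)
      - (\<Sum>j\<in>{1..S}. g (x j t) * (\<mu> * pT y j s))"
      by (simp add: sum.distrib sum_subtractf sum_incoming)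
    finally show ?thesis .
  qed
  have "((\<lambda>s. (\<Sum>j\<in>{1..S}. g (x j t) * pQ y j 0)
      + (\<Sum>e\<in>edges S p. \<Sum>i\<in>e. g (x i t) * pAd y e i s)
      - (\<Sum>j\<in>{1..S}. g (x j t) * (\<mu> * pT y j s))) has_real_derivative
      0 + (\<Sum>e\<in>edges S p. lam * pL y t * (p e * g (Min ((\<lambda>i. x i t) ` e))))
      - (\<Sum>j\<in>{1..S}. g (x j t) * (\<mu> * pZ y j t))) (at t within {0..})"
    by (intro DERIV_diff DERIV_add DERIV_const DERIV_sum DERIV_cmult edge_weighted_deriv
        DERIV_of_has_integral Z_continuous T_integral t)
  then have "((\<lambda>s. \<Sum>j\<in>{1..S}. g (x j t) * pQ y j s) has_real_derivative
      0 + (\<Sum>e\<in>edges S p. lam * pL y t * (p e * g (Min ((\<lambda>i. x i t) ` e))))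
      - (\<Sum>j\<in>{1..S}. g (x j t) * (\<mu> * pZ y j t))) (at t within {0..})"
    by (rule has_field_derivative_transform_within[OF _ zero_less_one])
      (use t in simp, rule eq[symmetric], simp)
  then show ?thesis
    by (rule DERIV_cong) (simp add: sum_distrib_left mult.left_commute)
qed

section \<open>Equilibrium\<close>

text \<open>
  Let \<open>m\<close> and \<open>M\<close> be the smallest and the largest level. The stations of level \<open>M\<close> receive only the
  arrivals that choose between two of them, at most their share \<open>\<Sum> p\<^sub>j\<close> of all arrivals, and must
  balance their departures; hence \<open>min M c \<le> c L\<close>. The stations of level \<open>m\<close> receive all arrivals that
  choose one of them, at least their share; hence \<open>c L \<le> min m c\<close>. If \<open>m < c\<close>, then all levels agree
  and lie below \<open>c\<close>, so that no vehicle waits and \<open>L = 1\<close>, contradicting \<open>c L \<le> m\<close>. So \<open>m \<ge> c\<close>, which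
  gives \<open>L \<ge> 1\<close>: nobody waits, and no level exceeds \<open>c\<close>.
\<close>

lemma constant_path_equilibrium:
  assumes const: "\<And>j t. j \<in> {1..S} \<Longrightarrow> 0 \<le> t \<Longrightarrow> pQ y j t = q j" and j: "j \<in> {1..S}"
  shows "q j = load S p j * lam / \<mu>"
proof -
  define c where "c = lam / \<mu>"
  define u where "u j = x j 1" for j
  define Lo where "Lo = pL y 1"
  have Lo: "0 \<le> Lo" using L_nonneg[of 1] by (simp add: Lo_def)
  \<comment> \<open>at the interior time 1 the derivative relative to the half-line is two-sided, hence unique\<close>
  have bal: "c * Lo * (\<Sum>e\<in>edges S p. p e * g (Min (u ` e))) =
      (\<Sum>j\<in>{1..S}. load S p j * (g (u j) * min (u j) c))" for g
  proof -
    have "((\<lambda>s. \<Sum>j\<in>{1..S}. g (x j 1) * pQ y j s) has_real_derivative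
      lam * pL y 1 * (\<Sum>e\<in>edges S p. p e * g (Min ((\<lambda>i. x i 1) ` e)))
        - \<mu> * (\<Sum>j\<in>{1..S}. g (x j 1) * pZ y j 1)) (at 1 within {0..})"
      by (rule weighted_queue_deriv) simp
    moreover have "((\<lambda>s. \<Sum>j\<in>{1..S}. g (x j 1) * pQ y j s) has_real_derivative 0) (at 1 within {0..})"
    proof -
      have "((\<lambda>s. \<Sum>j\<in>{1..S}. g (x j 1) * q j) has_real_derivative 0) (at (1::real) within {0..})"
        by (rule DERIV_const)
      then show ?thesis
        by (rule has_field_derivative_transform_within[OF _ zero_less_one]) (auto simp: const)
    qed
    moreover have "at (1::real) within {0..} = at 1"
      by (intro at_within_interior) (simp add: interior_Ici)
    ultimately have "lam * pL y 1 * (\<Sum>e\<in>edges S p. p e * g (Min ((\<lambda>i. x i 1) ` e)))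
        = \<mu> * (\<Sum>j\<in>{1..S}. g (x j 1) * pZ y j 1)"
      using DERIV_unique by fastforce
    moreover have "(\<Sum>j\<in>{1..S}. g (x j 1) * pZ y j 1) =
        (\<Sum>j\<in>{1..S}. load S p j * (g (u j) * min (u j) c))"
      by (intro sum.cong) (auto simp: Z_x u_def c_def)
    ultimately show ?thesis
      using \<mu>_pos by (simp add: c_def Lo_def u_def[abs_def] field_simps)
  qed
  have ne: "u ` {1..S} \<noteq> {}" "finite (u ` {1..S})" using j by auto
  have mass: "0 < (\<Sum>j\<in>{1..S}. load S p j * (if u j = v then 1 else 0))"
    if v: "v \<in> u ` {1..S}" for v
  proof -
    obtain k where k: "k \<in> {1..S}" "u k = v" using v by auto
    show ?thesis
      by (rule sum_pos2[OF _ k(1)]) (use k load_pos in \<open>auto intro: less_imp_le\<close>)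
  qed
  have upper: "min v c \<le> c * Lo" if v: "v \<in> u ` {1..S}" "\<forall>w\<in>u ` {1..S}. w \<le> v" for v
  proof -
    define G where "G = (\<Sum>j\<in>{1..S}. load S p j * (if u j = v then 1 else 0))"
    have "min v c * G = (\<Sum>j\<in>{1..S}. load S p j * ((if u j = v then 1 else 0) * min (u j) c))"
      unfolding G_def sum_distrib_left by (intro sum.cong) auto
    also have "\<dots> = c * Lo * (\<Sum>e\<in>edges S p. p e * (if Min (u ` e) = v then 1 else 0))"
      using bal[of "\<lambda>w. if w = v then 1 else 0"] by simp
    also have "\<dots> \<le> c * Lo * G"
      unfolding G_def
    proof (intro mult_left_mono sum_edge_min_le[where g="\<lambda>w. if w = v then 1 else 0"])
      fix i j assume "{i, j} \<in> edges S p" "u i \<le> u j"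
      with edge_ends[of i j] v(2)
      show "(if u i = v then 1 else 0) \<le> ((if u i = v then 1 else 0) + (if u j = v then 1 else 0)) / (2::real)"
        by force
    qed (use Lo lam_pos \<mu>_pos in \<open>simp add: c_def\<close>)
    finally show ?thesis using mass[OF v(1)] by (simp add: G_def)
  qed
  have lower: "c * Lo \<le> min v c" if v: "v \<in> u ` {1..S}" "\<forall>w\<in>u ` {1..S}. v \<le> w" for v
  proof -
    define G where "G = (\<Sum>j\<in>{1..S}. load S p j * (if u j = v then 1 else 0))"
    have "c * Lo * G \<le> c * Lo * (\<Sum>e\<in>edges S p. p e * (if Min (u ` e) = v then 1 else 0))"
      unfolding G_def
    proof (intro mult_left_mono sum_edge_min_ge[where g="\<lambda>w. if w = v then 1 else 0"])
      fix i j assume "{i, j} \<in> edges S p" "u i \<le> u j"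
      with edge_ends[of i j] v(2)
      show "((if u i = v then 1 else 0) + (if u j = v then 1 else 0)) / (2::real) \<le> (if u i = v then 1 else 0)"
        by force
    qed (use Lo lam_pos \<mu>_pos in \<open>simp add: c_def\<close>)
    also have "\<dots> = (\<Sum>j\<in>{1..S}. load S p j * ((if u j = v then 1 else 0) * min (u j) c))"
      using bal[of "\<lambda>w. if w = v then 1 else 0"] by simp
    also have "\<dots> = min v c * G"
      unfolding G_def sum_distrib_left by (intro sum.cong) auto
    finally show ?thesis using mass[OF v(1)] by (simp add: G_def)
  qed
  define m M where "m = Min (u ` {1..S})" and "M = Max (u ` {1..S})"
  have mM: "m \<le> u k" "u k \<le> M" if "k \<in> {1..S}" for k
    using that by (auto simp: m_def M_def)
  have "min M c \<le> c * Lo" unfolding M_def by (rule upper) (use ne in \<open>auto intro: Max_in\<close>)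
  moreover have "c * Lo \<le> min m c" unfolding m_def by (rule lower) (use ne in \<open>auto intro: Min_in\<close>)
  moreover have c: "0 < c" using lam_pos \<mu>_pos by (simp add: c_def)
  have Lo_eq: "Lo = 1 - (\<Sum>j\<in>{1..S}. load S p j * max (u j - c) 0)"
    using L_x[of 1] by (simp add: Lo_def u_def c_def)
  have "m \<ge> c"
  proof (rule ccontr)
    assume "\<not> m \<ge> c"
    with calculation have "M \<le> m" by (auto simp: min_def split: if_splits)
    then have "u k - c \<le> 0" if "k \<in> {1..S}" for k using mM[OF that] \<open>\<not> m \<ge> c\<close> by linarith
    then have "Lo = 1" unfolding Lo_eq by (simp add: max_absorb2)
    with calculation \<open>\<not> m \<ge> c\<close> show False by auto
  qed
  with mM[OF j] have "M \<ge> c" by linarith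
  with calculation have "c * 1 \<le> c * Lo" by (simp add: min_absorb2)
  then have "1 \<le> Lo" using c by (simp only: mult_le_cancel_left_pos)
  then have "(\<Sum>j\<in>{1..S}. load S p j * max (u j - c) 0) \<le> 0" using Lo_eq by simp
  moreover have nn: "0 \<le> load S p k * max (u k - c) 0" if "k \<in> {1..S}" for k
    using load_pos[OF that] by simp
  ultimately have "load S p j * max (u j - c) 0 \<le> 0"
    using member_le_sum[OF j, of "\<lambda>j. load S p j * max (u j - c) 0"] nn by fastforce
  then have "u j \<le> c" using load_pos[OF j] by (simp add: mult_le_0_iff)
  with mM[OF j] \<open>m \<ge> c\<close> have "u j = c" by linarith
  then show ?thesis
    using Q_x[OF j, of 1] const[OF j, of 1] by (simp add: u_def c_def)
qed

text \<open>
  \<open>V\<close> is the squared distance to the equilibrium in the norm weighted by the loads. If all vehicles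
  were on the road, that is \<open>L = 1\<close>, the bound for its derivative would be nonpositive; the only
  unfavourable term comes from the missing arrivals \<open>1 - L\<close>. These and their effect on \<open>V\<close> are both
  controlled by the mean distance \<open>a = \<Sum>\<^sub>j p\<^sub>j \<bar>x\<^sub>j - c\<bar>\<close>, and \<open>a\<^sup>2 \<le> V\<close> because the loads sum to one.
\<close>

lemma equilibrium_path_constant:
  assumes start: "\<And>j. j \<in> {1..S} \<Longrightarrow> pQ y j 0 = load S p j * lam / \<mu>"
    and t: "0 \<le> t" and j: "j \<in> {1..S}"
  shows "pQ y j t = load S p j * lam / \<mu>"
proof -
  define c where "c = lam / \<mu>"
  have lam_c: "lam = \<mu> * c" using \<mu>_pos by (simp add: c_def)
  define V where "V t = (\<Sum>j\<in>{1..S}. load S p j * (x j t - c)\<^sup>2)" for t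
  have deriv: "\<exists>d. (V has_real_derivative d) (at t within {0..}) \<and> d \<le> 2 * lam * V t"
    if t: "0 \<le> t" for t
  proof -
    define g where "g v = 2 * (v - c)" for v
    define d where "d = lam * pL y t * (\<Sum>e\<in>edges S p. p e * g (Min ((\<lambda>i. x i t) ` e)))
      - \<mu> * (\<Sum>j\<in>{1..S}. g (x j t) * pZ y j t)"
    have lip: "\<exists>C. C-lipschitz_on {0..} (x j)" if j: "j \<in> {1..S}" for j
    proof -
      obtain C where "C-lipschitz_on {0..} (pQ y j)" using Q_lipschitz[OF j] by blast
      from lipschitz_on_cmult_real[OF this, of "1 / load S p j"]
      show ?thesis by (auto simp: x_def[abs_def])
    qed
    \<comment> \<open>\<open>V\<close> is its linearization at time \<open>t\<close>, which is a weighted sum of queues, plus a quadratic remainder\<close>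
    have "((\<lambda>s. (\<Sum>j\<in>{1..S}. load S p j * (x j s - x j t)\<^sup>2)
        + (\<Sum>j\<in>{1..S}. g (x j t) * pQ y j s)
        - (\<Sum>j\<in>{1..S}. load S p j * ((x j t)\<^sup>2 - c\<^sup>2))) has_real_derivative
        (\<Sum>j\<in>{1..S}. load S p j * 0) + d - 0) (at t within {0..})"
      unfolding d_def
    proof (intro DERIV_diff DERIV_add DERIV_const DERIV_sum DERIV_cmult weighted_queue_deriv t)
      fix j assume "j \<in> {1..S}"
      then obtain C where "C-lipschitz_on {0..} (x j)" using lip by blast
      then show "((\<lambda>s. (x j s - x j t)\<^sup>2) has_real_derivative 0) (at t within {0..})"
        by (rule DERIV_lipschitz_square) (simp add: t)
    qed
    moreover have "(\<lambda>s. (\<Sum>j\<in>{1..S}. load S p j * (x j s - x j t)\<^sup>2)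
        + (\<Sum>j\<in>{1..S}. g (x j t) * pQ y j s)
        - (\<Sum>j\<in>{1..S}. load S p j * ((x j t)\<^sup>2 - c\<^sup>2))) = V"
    proof
      fix s
      have "load S p j * (x j s - x j t)\<^sup>2 + g (x j t) * pQ y j s - load S p j * ((x j t)\<^sup>2 - c\<^sup>2)
          = load S p j * (x j s - c)\<^sup>2" if "j \<in> {1..S}" for j
        unfolding Q_x[OF that] g_def by (simp add: power2_eq_square algebra_simps)
      then show "(\<Sum>j\<in>{1..S}. load S p j * (x j s - x j t)\<^sup>2)
        + (\<Sum>j\<in>{1..S}. g (x j t) * pQ y j s)
        - (\<Sum>j\<in>{1..S}. load S p j * ((x j t)\<^sup>2 - c\<^sup>2)) = V s"
        by (simp add: V_def flip: sum.distrib sum_subtractf)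
    qed
    ultimately have Vd: "(V has_real_derivative d) (at t within {0..})" by simp
    define a where "a = (\<Sum>j\<in>{1..S}. load S p j * \<bar>x j t - c\<bar>)"
    have a: "0 \<le> a" unfolding a_def using load_pos by (intro sum_nonneg) (simp add: less_imp_le)
    have La: "1 - pL y t \<le> a" "0 \<le> 1 - pL y t"
    proof -
      have "1 - pL y t = (\<Sum>j\<in>{1..S}. load S p j * max (x j t - c) 0)"
        using L_x[OF t] by (simp add: c_def)
      moreover have "\<dots> \<le> a"
        unfolding a_def by (intro sum_mono mult_left_mono) (auto simp: load_pos less_imp_le)
      moreover have "0 \<le> (\<Sum>j\<in>{1..S}. load S p j * max (x j t - c) 0)"
        using load_pos by (intro sum_nonneg) (simp add: less_imp_le)
      ultimately show "1 - pL y t \<le> a" "0 \<le> 1 - pL y t" by simp_all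
    qed
    have "d \<le> lam * pL y t * (\<Sum>j\<in>{1..S}. load S p j * g (x j t))
      - \<mu> * (\<Sum>j\<in>{1..S}. g (x j t) * pZ y j t)"
      unfolding d_def using lam_pos L_nonneg[OF t]
      by (intro diff_right_mono mult_left_mono sum_edge_min_le) (auto simp: g_def)
    also have "\<dots> = (\<Sum>j\<in>{1..S}. load S p j * (2 * \<mu> * ((x j t - c) * (c * pL y t - min (x j t) c))))"
      unfolding sum_distrib_left sum_subtractf[symmetric]
    proof (rule sum.cong)
      fix j assume j: "j \<in> {1..S}"
      show "lam * pL y t * (load S p j * g (x j t)) - \<mu> * (g (x j t) * pZ y j t) =
         load S p j * (2 * \<mu> * ((x j t - c) * (c * pL y t - min (x j t) c)))"
        unfolding Z_x[OF j t] c_def[symmetric] g_def lam_c by (simp add: algebra_simps)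
    qed simp
    also have "\<dots> \<le> (\<Sum>j\<in>{1..S}. load S p j * (2 * \<mu> * (c * (a * \<bar>x j t - c\<bar>))))"
    proof (intro sum_mono mult_left_mono)
      fix j assume "j \<in> {1..S}"
      have c0: "0 < c" using lam_pos \<mu>_pos by (simp add: c_def)
      have "(x j t - c) * (c - min (x j t) c) \<le> 0"
        by (cases "x j t \<le> c") (auto simp: mult_le_0_iff)
      then have "(x j t - c) * (c * pL y t - min (x j t) c) \<le> (x j t - c) * (c * (pL y t - 1))"
        by (simp add: algebra_simps)
      also have "\<dots> \<le> \<bar>(x j t - c) * (c * (pL y t - 1))\<bar>" by (rule abs_ge_self)
      also have "\<dots> = c * ((1 - pL y t) * \<bar>x j t - c\<bar>)"
        using c0 La(2) by (simp add: abs_mult)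
      also have "\<dots> \<le> c * (a * \<bar>x j t - c\<bar>)"
        using c0 La(1) by (intro mult_left_mono mult_right_mono) auto
      finally show "(x j t - c) * (c * pL y t - min (x j t) c) \<le> c * (a * \<bar>x j t - c\<bar>)" .
    qed (use \<mu>_pos load_pos in \<open>auto intro: less_imp_le\<close>)
    also have "\<dots> = 2 * lam * a\<^sup>2"
      by (simp add: a_def lam_c power2_eq_square sum_distrib_left mult_ac)
    also have "a\<^sup>2 \<le> V t"
    proof -
      have "0 \<le> (\<Sum>j\<in>{1..S}. load S p j * (\<bar>x j t - c\<bar> - a)\<^sup>2)"
        using load_pos by (intro sum_nonneg) (simp add: less_imp_le)
      also have "\<dots> = (\<Sum>j\<in>{1..S}. load S p j * (x j t - c)\<^sup>2 - 2 * a * (load S p j * \<bar>x j t - c\<bar>) + a\<^sup>2 * load S p j)"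
        by (intro sum.cong) (simp_all add: power2_diff algebra_simps)
      also have "\<dots> = V t - 2 * a * a + a\<^sup>2 * 1"
        unfolding sum.distrib sum_subtractf sum_distrib_left[symmetric] total_load
        by (simp add: V_def a_def)
      finally show ?thesis by (simp add: power2_eq_square)
    qed
    finally have "d \<le> 2 * lam * V t" using lam_pos by simp
    with Vd show ?thesis by blast
  qed
  have "x j 0 = c" if "j \<in> {1..S}" for j
    using start[OF that] load_pos[OF that] by (simp add: x_def c_def)
  then have "V 0 \<le> 0" by (simp add: V_def)
  with gronwall_zero[OF deriv] t have "V t \<le> 0" by blast
  moreover have nn: "0 \<le> load S p k * (x k t - c)\<^sup>2" if "k \<in> {1..S}" for k
    using load_pos[OF that] by simp
  ultimately have "load S p j * (x j t - c)\<^sup>2 \<le> 0"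
    using member_le_sum[OF j, of "\<lambda>j. load S p j * (x j t - c)\<^sup>2"] unfolding V_def by fastforce
  then have "x j t = c" using load_pos[OF j] by (simp add: mult_le_0_iff)
  then show ?thesis using Q_x[OF j, of t] by (simp add: c_def)
qed

end

section \<open>Scaled systems\<close>

text \<open>
  On the fluid scale the square-root term and the rounding error vanish, so batteries and charging
  points have the same limit.
\<close>

lemma capacity_limit:
  assumes K: "capacity S p lam \<mu> c K" and j: "j \<in> {1..S}" and pos: "0 < lam" "0 < \<mu>"
  shows "(\<lambda>r. K r j / real r) \<longlonglongrightarrow> load S p j * lam / \<mu>"
proof -
  define a w where "a = lam / \<mu>" and "w = load S p j"
  have a: "0 < a" using pos by (simp add: a_def)
  have hw: "(\<lambda>r. halfin_whitt w lam \<mu> c r / real r) \<longlonglongrightarrow> w * a"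
  proof (rule Lim_transform_eventually)
    have "(\<lambda>r. 1 / sqrt (real r)) \<longlonglongrightarrow> 0" by real_asymp
    then have "(\<lambda>r. w * (a + c * sqrt a * (1 / sqrt (real r)))) \<longlonglongrightarrow> w * (a + c * sqrt a * 0)"
      by (intro tendsto_intros)
    then show "(\<lambda>r. w * (a + c * sqrt a * (1 / sqrt (real r)))) \<longlonglongrightarrow> w * a" by simp
    show "\<forall>\<^sub>F r in sequentially. w * (a + c * sqrt a * (1 / sqrt (real r))) = halfin_whitt w lam \<mu> c r / real r"
      using eventually_gt_at_top[of 0]
    proof eventually_elim
      case (elim r)
      have lr: "lam * real r / \<mu> = a * real r" by (simp add: a_def)
      have "1 / sqrt (real r) = sqrt (real r) / real r"
        using elim by (simp add: real_div_sqrt field_simps)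
      then show ?case
        unfolding halfin_whitt_def lr real_sqrt_mult using elim by (simp add: field_simps)
    qed
  qed
  have "(\<lambda>r. K r j / real r - halfin_whitt w lam \<mu> c r / real r) \<longlonglongrightarrow> 0"
  proof (rule Lim_null_comparison)
    have "\<forall>\<^sub>F r in sequentially. \<bar>K r j - halfin_whitt w lam \<mu> c r\<bar> \<le> 1"
      using K j by (auto simp: capacity_def w_def elim!: eventually_mono)
    then show "\<forall>\<^sub>F r in sequentially. norm (K r j / real r - halfin_whitt w lam \<mu> c r / real r) \<le> 1 / real r"
      by eventually_elim (simp add: divide_right_mono flip: diff_divide_distrib)
    show "(\<lambda>r. 1 / real r) \<longlonglongrightarrow> 0" by real_asymp
  qed
  from tendsto_add[OF this hw] show ?thesis by (simp add: a_def w_def)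
qed

lemma integral_increment_bounds:
  fixes f :: "real \<Rightarrow> real"
  assumes int: "\<And>t. 0 \<le> t \<Longrightarrow> (f has_integral G t) {0..t}"
    and f: "\<And>t. 0 \<le> t \<Longrightarrow> 0 \<le> f t \<and> f t \<le> K" and st: "0 \<le> s" "s \<le> t"
  shows "0 \<le> G t - G s" "G t - G s \<le> K * (t - s)"
proof -
  have it: "f integrable_on {0..t}" using int[of t] st by (auto simp: integrable_on_def)
  have ist: "f integrable_on {s..t}" by (rule integrable_subinterval_real[OF it]) (use st in auto)
  have "integral {0..s} f + integral {s..t} f = integral {0..t} f"
    by (rule Henstock_Kurzweil_Integration.integral_combine[OF st it])
  then have eq: "integral {s..t} f = G t - G s"
    using integral_unique[OF int] st by simp
  show "0 \<le> G t - G s"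
    unfolding eq[symmetric] by (rule integral_nonneg[OF ist]) (use f st in auto)
  have "integral {s..t} f \<le> integral {s..t} (\<lambda>_. K)"
    by (rule integral_le[OF ist]) (use f st in auto)
  then show "G t - G s \<le> K * (t - s)" using st by (simp add: eq mult.commute)
qed

lemma lipschitz_const: "\<exists>C. C-lipschitz_on X (\<lambda>_. a :: real)"
  by (rule exI) (rule lipschitz_on_constant)

lemma lipschitz_add:
  assumes "\<exists>C. C-lipschitz_on X f" "\<exists>C. C-lipschitz_on X g"
  shows "\<exists>C. C-lipschitz_on X (\<lambda>t. f t + g t :: real)"
  using assms by (elim exE) (rule exI, rule lipschitz_on_add)

lemma lipschitz_cmult:
  assumes "\<exists>C. C-lipschitz_on X f"
  shows "\<exists>C. C-lipschitz_on X (\<lambda>t. a * f t :: real)"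
  using assms by (elim exE) (rule exI, rule lipschitz_on_cmult_real)

lemma lipschitz_diff:
  assumes "\<exists>C. C-lipschitz_on X f" "\<exists>C. C-lipschitz_on X g"
  shows "\<exists>C. C-lipschitz_on X (\<lambda>t. f t - g t :: real)"
  using assms by (elim exE) (rule exI, rule lipschitz_on_diff)

lemma lipschitz_sum:
  assumes "finite I" "\<And>i. i \<in> I \<Longrightarrow> \<exists>C. C-lipschitz_on X (f i)"
  shows "\<exists>C. C-lipschitz_on X (\<lambda>t. \<Sum>i\<in>I. f i t :: real)"
  using assms
proof (induction I rule: finite_induct)
  case empty
  show ?case unfolding sum.empty by (rule lipschitz_const)
next
  case (insert i I)
  have "\<exists>C. C-lipschitz_on X (\<lambda>t. f i t + (\<Sum>i\<in>I. f i t))"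
    by (rule lipschitz_add[OF insert.prems insert.IH]) (use insert.prems in auto)
  with insert.hyps show ?case by simp
qed

lemma lipschitz_contraction:
  fixes f :: "real \<Rightarrow> real"
  assumes f: "\<exists>C. C-lipschitz_on X f" and h: "\<And>a b. \<bar>h a - h b\<bar> \<le> \<bar>a - b :: real\<bar>"
  shows "\<exists>C. C-lipschitz_on X (\<lambda>t. h (f t) :: real)"
proof -
  obtain C where C: "C-lipschitz_on X f" using f by blast
  have "C-lipschitz_on X (\<lambda>t. h (f t))"
  proof (rule lipschitz_onI)
    fix s t assume "s \<in> X" "t \<in> X"
    with lipschitz_onD[OF C this] h[of "f s" "f t"]
    show "dist (h (f s)) (h (f t)) \<le> C * dist s t" by (simp add: dist_real_def)
  qed (rule lipschitz_on_nonneg[OF C])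
  then show ?thesis by blast
qed

lemma lipschitz_cong:
  assumes "\<exists>C. C-lipschitz_on X g" "\<And>t. t \<in> X \<Longrightarrow> f t = g t"
  shows "\<exists>C. C-lipschitz_on X f"
  using assms by (auto simp: lipschitz_on_def)

text \<open>
  One outcome for which the law of large numbers holds, with the systems of sizes \<open>\<rho> l\<close>. Keeping the
  sizes as a parameter lets the same facts serve for the original sequence and for its subsequences.
\<close>

locale scaled_paths = station_network +
  fixes \<beta> \<gamma> :: real and B F :: "nat \<Rightarrow> nat \<Rightarrow> real"
    and La :: "nat set \<Rightarrow> real \<Rightarrow> nat" and Sv :: "nat \<Rightarrow> real \<Rightarrow> nat"
    and xs :: "nat \<Rightarrow> ev_path" and \<rho> :: "nat \<Rightarrow> nat"
  assumes capacity_B: "capacity S p lam \<mu> \<beta> B" and capacity_F: "capacity S p lam \<mu> \<gamma> F"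
    and lln_arrivals: "\<And>e. e \<in> edges S p \<Longrightarrow>
      uoc (\<lambda>r t. real (La e (real r * t)) / real r) (\<lambda>t. p e * lam * t)"
    and lln_services: "\<And>j. j \<in> {1..S} \<Longrightarrow>
      uoc (\<lambda>r t. real (Sv j (real r * t)) / real r) (\<lambda>t. \<mu> * t)"
    and paths: "\<And>r. 1 \<le> r \<Longrightarrow> \<exists>U. system_path S p r (B r) (F r) La Sv U (xs r)"
    and scale: "filterlim \<rho> at_top sequentially"
begin

abbreviation scaled :: "(ev_path \<Rightarrow> real \<Rightarrow> real) \<Rightarrow> nat \<Rightarrow> real \<Rightarrow> real" where
  "scaled c l t \<equiv> c (xs (\<rho> l)) t / real (\<rho> l)"

lemma scale_pos: "\<forall>\<^sub>F l in sequentially. 1 \<le> \<rho> l"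
  using scale by (simp add: filterlim_at_top)

lemma F_nonneg: "j \<in> {1..S} \<Longrightarrow> 0 \<le> F r j"
  using capacity_F by (auto simp: capacity_def)

lemma B_limit: "j \<in> {1..S} \<Longrightarrow> (\<lambda>l. B (\<rho> l) j / real (\<rho> l)) \<longlonglongrightarrow> load S p j * lam / \<mu>"
  using filterlim_compose[OF capacity_limit[OF capacity_B _ lam_pos \<mu>_pos] scale] .

lemma F_limit: "j \<in> {1..S} \<Longrightarrow> (\<lambda>l. F (\<rho> l) j / real (\<rho> l)) \<longlonglongrightarrow> load S p j * lam / \<mu>"
  using filterlim_compose[OF capacity_limit[OF capacity_F _ lam_pos \<mu>_pos] scale] .

lemma path_facts:
  assumes "1 \<le> r"
  shows path_Ad: "\<forall>e\<in>edges S p. \<forall>i\<in>e. mono_on {0..} (pAd (xs r) e i) \<and> (\<forall>t\<ge>0. pAd (xs r) e i t \<in> \<nat>)"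
    and path_Q_Nats: "\<forall>j\<in>{1..S}. \<forall>t\<ge>0. pQ (xs r) j t \<in> \<nat>"
    and path_L_nonneg: "\<forall>t\<ge>0. 0 \<le> pL (xs r) t"
    and path_A_split: "\<forall>i j. {i, j} \<in> edges S p \<longrightarrow>
      (\<forall>t\<ge>0. pA (xs r) {i, j} t = pAd (xs r) {i, j} i t + pAd (xs r) {i, j} j t)"
    and path_A: "\<forall>e\<in>edges S p. \<forall>t\<ge>0. pA (xs r) e t = real (La e (pY (xs r) t))"
    and path_Q: "\<forall>j\<in>{1..S}. \<forall>t\<ge>0. pQ (xs r) j t =
      pQ (xs r) j 0 + (\<Sum>i | {i, j} \<in> edges S p. pAd (xs r) {i, j} j t) - pD (xs r) j t"
    and path_D: "\<forall>j\<in>{1..S}. \<forall>t\<ge>0. pD (xs r) j t = real (Sv j (pT (xs r) j t))"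
    and path_Y: "\<forall>t\<ge>0. (pL (xs r) has_integral pY (xs r) t) {0..t}"
    and path_T: "\<forall>j\<in>{1..S}. \<forall>t\<ge>0. (pZ (xs r) j has_integral pT (xs r) j t) {0..t}"
    and path_Z: "\<forall>j\<in>{1..S}. \<forall>t\<ge>0. pZ (xs r) j t = min (pQ (xs r) j t) (F r j)"
    and path_L: "\<forall>t\<ge>0. pL (xs r) t = real r - (\<Sum>j\<in>{1..S}. max (pQ (xs r) j t - B r j) 0)"
    and path_routing: "shorter_queue_routing S p (xs r)"
  using paths[OF assms] unfolding system_path_def by - (elim exE conjE, assumption)+

lemma Ad_mono: "e \<in> edges S p \<Longrightarrow> i \<in> e \<Longrightarrow> 1 \<le> r \<Longrightarrow> mono_on {0..} (pAd (xs r) e i)"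
  using path_Ad by blast

lemma Ad_nonneg: "e \<in> edges S p \<Longrightarrow> i \<in> e \<Longrightarrow> 1 \<le> r \<Longrightarrow> 0 \<le> t \<Longrightarrow> 0 \<le> pAd (xs r) e i t"
  using path_Ad[of r] by (metis Nats_cases of_nat_0_le_iff)

lemma Q_nonneg: "j \<in> {1..S} \<Longrightarrow> 1 \<le> r \<Longrightarrow> 0 \<le> t \<Longrightarrow> 0 \<le> pQ (xs r) j t"
  using path_Q_Nats[of r] by (metis Nats_cases of_nat_0_le_iff)

lemma L_nonneg: "1 \<le> r \<Longrightarrow> 0 \<le> t \<Longrightarrow> 0 \<le> pL (xs r) t"
  using path_L_nonneg by blast

lemma A_split: "{i, j} \<in> edges S p \<Longrightarrow> 1 \<le> r \<Longrightarrow> 0 \<le> t \<Longrightarrow>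
    pA (xs r) {i, j} t = pAd (xs r) {i, j} i t + pAd (xs r) {i, j} j t"
  using path_A_split by blast

lemma A_eq: "e \<in> edges S p \<Longrightarrow> 1 \<le> r \<Longrightarrow> 0 \<le> t \<Longrightarrow> pA (xs r) e t = real (La e (pY (xs r) t))"
  using path_A by blast

lemma Q_eq: "j \<in> {1..S} \<Longrightarrow> 1 \<le> r \<Longrightarrow> 0 \<le> t \<Longrightarrow> pQ (xs r) j t =
    pQ (xs r) j 0 + (\<Sum>i | {i, j} \<in> edges S p. pAd (xs r) {i, j} j t) - pD (xs r) j t"
  using path_Q by blast

lemma D_eq: "j \<in> {1..S} \<Longrightarrow> 1 \<le> r \<Longrightarrow> 0 \<le> t \<Longrightarrow> pD (xs r) j t = real (Sv j (pT (xs r) j t))"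
  using path_D by blast

lemma Y_integral: "1 \<le> r \<Longrightarrow> 0 \<le> t \<Longrightarrow> (pL (xs r) has_integral pY (xs r) t) {0..t}"
  using path_Y by blast

lemma T_integral: "j \<in> {1..S} \<Longrightarrow> 1 \<le> r \<Longrightarrow> 0 \<le> t \<Longrightarrow> (pZ (xs r) j has_integral pT (xs r) j t) {0..t}"
  using path_T by blast

lemma Z_eq: "j \<in> {1..S} \<Longrightarrow> 1 \<le> r \<Longrightarrow> 0 \<le> t \<Longrightarrow> pZ (xs r) j t = min (pQ (xs r) j t) (F r j)"
  using path_Z by blast

lemma L_eq: "1 \<le> r \<Longrightarrow> 0 \<le> t \<Longrightarrow> pL (xs r) t = real r - (\<Sum>j\<in>{1..S}. max (pQ (xs r) j t - B r j) 0)"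
  using path_L by blast

text \<open>
  The routing rule looks at the queues just before an arrival; comparing them on the closed interval
  is what uniform convergence provides.
\<close>

lemma routing:
  assumes "{i, j} \<in> edges S p" "1 \<le> r" "0 \<le> s" "s \<le> t"
    and "\<And>u. s \<le> u \<Longrightarrow> u \<le> t \<Longrightarrow> pQ (xs r) i u / load S p i < pQ (xs r) j u / load S p j"
  shows "pAd (xs r) {i, j} j t = pAd (xs r) {i, j} j s"
proof (cases "s = t")
  case False
  have "{j, i} \<in> edges S p \<and> 0 \<le> s \<and> s < t \<and>
        (\<forall>u\<in>{s..<t}. pQ (xs r) j u / load S p j > pQ (xs r) i u / load S p i)
        \<longrightarrow> pAd (xs r) {j, i} j t = pAd (xs r) {j, i} j s"
    using path_routing[OF assms(2)] unfolding shorter_queue_routing_def by blast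
  with assms False show ?thesis by (auto simp: insert_commute)
qed simp

lemma Y_zero: "1 \<le> r \<Longrightarrow> pY (xs r) 0 = 0"
  using Y_integral[of r 0] by (auto dest: has_integral_unique[OF has_integral_refl(2)])

lemma T_zero: "j \<in> {1..S} \<Longrightarrow> 1 \<le> r \<Longrightarrow> pT (xs r) j 0 = 0"
  using T_integral[of j r 0] by (auto dest: has_integral_unique[OF has_integral_refl(2)])

lemma Y_increment:
  assumes "1 \<le> r" "0 \<le> s" "s \<le> t"
  shows "0 \<le> pY (xs r) t - pY (xs r) s" "pY (xs r) t - pY (xs r) s \<le> real r * (t - s)"
proof -
  have "0 \<le> pL (xs r) u \<and> pL (xs r) u \<le> real r" if "0 \<le> u" for u
    using L_nonneg[OF assms(1) that] L_eq[OF assms(1) that] by (simp add: sum_nonneg)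
  from integral_increment_bounds[OF Y_integral[OF assms(1)] this assms(2,3)]
  show "0 \<le> pY (xs r) t - pY (xs r) s" "pY (xs r) t - pY (xs r) s \<le> real r * (t - s)" by auto
qed

lemma T_increment:
  assumes "j \<in> {1..S}" "1 \<le> r" "0 \<le> s" "s \<le> t"
  shows "0 \<le> pT (xs r) j t - pT (xs r) j s" "pT (xs r) j t - pT (xs r) j s \<le> F r j * (t - s)"
proof -
  have "0 \<le> pZ (xs r) j u \<and> pZ (xs r) j u \<le> F r j" if "0 \<le> u" for u
    using Q_nonneg[OF assms(1,2) that] F_nonneg[OF assms(1)] Z_eq[OF assms(1,2) that] by simp
  from integral_increment_bounds[OF T_integral[OF assms(1,2)] this assms(3,4)]
  show "0 \<le> pT (xs r) j t - pT (xs r) j s" "pT (xs r) j t - pT (xs r) j s \<le> F r j * (t - s)" by auto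
qed

lemma Y_bounds: "1 \<le> r \<Longrightarrow> 0 \<le> t \<Longrightarrow> 0 \<le> pY (xs r) t \<and> pY (xs r) t \<le> real r * t"
  using Y_increment[of r 0 t] Y_zero[of r] by simp

lemma T_bounds: "j \<in> {1..S} \<Longrightarrow> 1 \<le> r \<Longrightarrow> 0 \<le> t \<Longrightarrow> 0 \<le> pT (xs r) j t \<and> pT (xs r) j t \<le> F r j * t"
  using T_increment[of j r 0 t] T_zero[of j r] by simp

lemma Q_bound:
  assumes "j \<in> {1..S}" "1 \<le> r" "0 \<le> t"
  shows "pQ (xs r) j t \<le> B r j + real r"
proof -
  have "max (pQ (xs r) j t - B r j) 0 \<le> (\<Sum>j\<in>{1..S}. max (pQ (xs r) j t - B r j) 0)"
    using assms(1) by (intro member_le_sum) auto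
  then show ?thesis using L_nonneg[OF assms(2,3)] L_eq[OF assms(2,3)] by simp
qed

text \<open>
  Both routed components of the arrivals on an edge are nondecreasing, so each grows by at most the
  total.
\<close>

lemma Ad_increment:
  assumes e: "e \<in> edges S p" "i \<in> e" and r: "1 \<le> r" and st: "0 \<le> s" "s \<le> t"
  shows "0 \<le> pAd (xs r) e i t - pAd (xs r) e i s"
    "pAd (xs r) e i t - pAd (xs r) e i s \<le> pA (xs r) e t - pA (xs r) e s"
proof -
  have m: "pAd (xs r) e k s \<le> pAd (xs r) e k t" if "k \<in> e" for k
    using Ad_mono[OF e(1) that r] st by (auto simp: mono_on_def)
  show "0 \<le> pAd (xs r) e i t - pAd (xs r) e i s" using m[OF e(2)] by simp
  obtain a b where ab: "e = {a, b}" by (rule edgeE[OF e(1)])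
  have "pAd (xs r) e i t - pAd (xs r) e i s \<le>
      (pAd (xs r) e a t + pAd (xs r) e b t) - (pAd (xs r) e a s + pAd (xs r) e b s)"
    using m e(2) by (auto simp: ab)
  then show "pAd (xs r) e i t - pAd (xs r) e i s \<le> pA (xs r) e t - pA (xs r) e s"
    using A_split[of a b r] e(1) r st by (simp add: ab)
qed

lemma scaled_Y_lipschitz:
  "\<forall>\<^sub>F l in sequentially. \<forall>s\<ge>0. \<forall>t\<ge>0. \<bar>scaled pY l t - scaled pY l s\<bar> \<le> 1 * \<bar>t - s\<bar>"
  using scale_pos
proof eventually_elim
  case (elim l)
  have le: "\<bar>scaled pY l t - scaled pY l s\<bar> \<le> t - s" if "0 \<le> s" "s \<le> t" for s t
    using Y_increment[OF elim that] elim by (simp add: pos_divide_le_eq mult.commute flip: diff_divide_distrib)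
  show ?case
  proof (intro allI impI)
    fix s t :: real assume "0 \<le> s" "0 \<le> t"
    then show "\<bar>scaled pY l t - scaled pY l s\<bar> \<le> 1 * \<bar>t - s\<bar>"
      using le[of s t] le[of t s] by (cases "s \<le> t") auto
  qed
qed

lemma scaled_T_lipschitz:
  assumes j: "j \<in> {1..S}"
  shows "\<forall>\<^sub>F l in sequentially. \<forall>s\<ge>0. \<forall>t\<ge>0.
    \<bar>scaled (\<lambda>x. pT x j) l t - scaled (\<lambda>x. pT x j) l s\<bar> \<le> (load S p j * lam / \<mu> + 1) * \<bar>t - s\<bar>"
proof -
  have "\<forall>\<^sub>F l in sequentially. F (\<rho> l) j / real (\<rho> l) < load S p j * lam / \<mu> + 1"
    by (rule order_tendstoD[OF F_limit[OF j]]) simp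
  with scale_pos show ?thesis
  proof eventually_elim
    case (elim l)
    have le: "\<bar>scaled (\<lambda>x. pT x j) l t - scaled (\<lambda>x. pT x j) l s\<bar> \<le> (load S p j * lam / \<mu> + 1) * (t - s)"
      if "0 \<le> s" "s \<le> t" for s t
    proof -
      have "\<bar>scaled (\<lambda>x. pT x j) l t - scaled (\<lambda>x. pT x j) l s\<bar> \<le> F (\<rho> l) j * (t - s) / real (\<rho> l)"
        using T_increment[OF j elim(1) that] by (simp add: divide_right_mono flip: diff_divide_distrib)
      also have "\<dots> = F (\<rho> l) j / real (\<rho> l) * (t - s)" by simp
      also have "\<dots> \<le> (load S p j * lam / \<mu> + 1) * (t - s)"
        using elim(2) that by (intro mult_right_mono) auto
      finally show ?thesis .
    qed
    show ?case
    proof (intro allI impI)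
      fix s t :: real assume "0 \<le> s" "0 \<le> t"
      then show "\<bar>scaled (\<lambda>x. pT x j) l t - scaled (\<lambda>x. pT x j) l s\<bar> \<le> (load S p j * lam / \<mu> + 1) * \<bar>t - s\<bar>"
        using le[of s t] le[of t s] by (cases "s \<le> t") (auto simp: abs_minus_commute)
    qed
  qed
qed

text \<open>
  Routed arrivals are only bounded by all arrivals on the edge, and these follow the straight line of
  the law of large numbers, run on a clock of slope at most one.
\<close>

lemma scaled_Ad_lipschitz:
  assumes e: "e \<in> edges S p" "i \<in> e" and b: "0 \<le> b" and \<epsilon>: "0 < \<epsilon>"
  shows "\<forall>\<^sub>F l in sequentially. \<forall>s\<in>{0..b}. \<forall>t\<in>{0..b}.
    \<bar>scaled (\<lambda>x. pAd x e i) l t - scaled (\<lambda>x. pAd x e i) l s\<bar> \<le> p e * lam * \<bar>t - s\<bar> + \<epsilon>"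
proof -
  have "0 < \<epsilon> / 2" using \<epsilon> by simp
  from uocD[OF uoc_subseq[OF lln_arrivals[OF e(1)] scale] b this] scale_pos scaled_Y_lipschitz
  show ?thesis
  proof eventually_elim
    case (elim l)
    let ?n = "real (\<rho> l)"
    have n: "0 < ?n" using elim(2) by simp
    have A: "\<bar>pA (xs (\<rho> l)) e t / ?n - p e * lam * scaled pY l t\<bar> < \<epsilon> / 2" if t: "t \<in> {0..b}" for t
    proof -
      have "?n * t \<le> ?n * b" using t n by (intro mult_left_mono) auto
      moreover have "0 \<le> pY (xs (\<rho> l)) t \<and> pY (xs (\<rho> l)) t \<le> ?n * t"
        using t by (intro Y_bounds elim(2)) auto
      ultimately have "0 \<le> pY (xs (\<rho> l)) t" "pY (xs (\<rho> l)) t \<le> ?n * b" by linarith+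
      then have "scaled pY l t \<in> {0..b}" using n by (simp add: pos_divide_le_eq mult.commute)
      with elim(1) have "\<bar>real (La e (?n * scaled pY l t)) / ?n - p e * lam * scaled pY l t\<bar> < \<epsilon> / 2" by blast
      then show ?thesis using A_eq[OF e(1) elim(2), of t] t n by simp
    qed
    have le: "\<bar>scaled (\<lambda>x. pAd x e i) l t - scaled (\<lambda>x. pAd x e i) l s\<bar> \<le> p e * lam * (t - s) + \<epsilon>"
      if st: "s \<in> {0..b}" "t \<in> {0..b}" "s \<le> t" for s t
    proof -
      have "\<bar>scaled (\<lambda>x. pAd x e i) l t - scaled (\<lambda>x. pAd x e i) l s\<bar> \<le>
          (pA (xs (\<rho> l)) e t - pA (xs (\<rho> l)) e s) / ?n"
        using Ad_increment[OF e elim(2), of s t] st by (simp add: divide_right_mono flip: diff_divide_distrib)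
      also have "\<dots> \<le> p e * lam * (scaled pY l t - scaled pY l s) + \<epsilon>"
      proof -
        have "a' - a \<le> u' - u + \<epsilon>" if "\<bar>a - u\<bar> < \<epsilon> / 2" "\<bar>a' - u'\<bar> < \<epsilon> / 2" for a a' u u' :: real
          using that by linarith
        from this[OF A[OF st(1)] A[OF st(2)]] show ?thesis
          unfolding right_diff_distrib diff_divide_distrib .
      qed
      also have "p e * lam * (scaled pY l t - scaled pY l s) \<le> p e * lam * (t - s)"
      proof (rule mult_left_mono)
        have "\<bar>scaled pY l t - scaled pY l s\<bar> \<le> 1 * \<bar>t - s\<bar>"
          by (rule elim(3)[rule_format]) (use st in auto)
        then have "scaled pY l t - scaled pY l s \<le> 1 * \<bar>t - s\<bar>" by (rule abs_le_D1)
        also have "\<dots> = t - s" using st by simp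
        finally show "scaled pY l t - scaled pY l s \<le> t - s" .
      qed (use edge_pos[OF e(1)] lam_pos in simp)
      finally show ?thesis by simp
    qed
    show ?case
    proof (intro ballI)
      fix s t :: real assume "s \<in> {0..b}" "t \<in> {0..b}"
      then show "\<bar>scaled (\<lambda>x. pAd x e i) l t - scaled (\<lambda>x. pAd x e i) l s\<bar> \<le> p e * lam * \<bar>t - s\<bar> + \<epsilon>"
        using le[of s t] le[of t s] by (cases "s \<le> t") (auto simp: abs_minus_commute)
    qed
  qed
qed

lemma A_convergence:
  assumes e: "e \<in> edges S p" and Y: "uoc (scaled pY) Y"
  shows "uoc (scaled (\<lambda>x. pA x e)) (\<lambda>t. p e * lam * Y t)"
proof -
  have "\<forall>\<^sub>F l in sequentially. \<forall>t\<ge>0. 0 \<le> scaled pY l t \<and> scaled pY l t \<le> 1 * t"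
    using scale_pos by eventually_elim (use Y_bounds in \<open>simp add: pos_divide_le_eq mult.commute\<close>)
  from uoc_compose_linear[OF uoc_subseq[OF lln_arrivals[OF e] scale] Y this]
  show ?thesis
    by (rule uoc_cong) (use scale_pos in \<open>auto elim!: eventually_mono simp: A_eq[OF e]\<close>)
qed

lemma D_convergence:
  assumes j: "j \<in> {1..S}" and T: "uoc (scaled (\<lambda>x. pT x j)) T"
  shows "uoc (scaled (\<lambda>x. pD x j)) (\<lambda>t. \<mu> * T t)"
proof -
  have "\<forall>\<^sub>F l in sequentially. \<forall>t\<ge>0. 0 \<le> scaled (\<lambda>x. pT x j) l t \<and>
      scaled (\<lambda>x. pT x j) l t \<le> (load S p j * lam / \<mu> + 1) * t"
    using scale_pos scaled_T_lipschitz[OF j]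
  proof eventually_elim
    case (elim l)
    show ?case
    proof (intro allI impI)
      fix t :: real assume "0 \<le> t"
      with elim(2)[rule_format, of 0 t] T_zero[OF j elim(1)] T_bounds[OF j elim(1), of t]
      show "0 \<le> scaled (\<lambda>x. pT x j) l t \<and> scaled (\<lambda>x. pT x j) l t \<le> (load S p j * lam / \<mu> + 1) * t"
        by simp
    qed
  qed
  from uoc_compose_linear[OF uoc_subseq[OF lln_services[OF j] scale] T this]
  show ?thesis
    by (rule uoc_cong) (use scale_pos in \<open>auto elim!: eventually_mono simp: D_eq[OF j]\<close>)
qed

lemma Q_convergence:
  assumes j: "j \<in> {1..S}" and Q0: "(\<lambda>l. scaled (\<lambda>x. pQ x j) l 0) \<longlonglongrightarrow> q"
    and Ad: "\<And>i. {i, j} \<in> edges S p \<Longrightarrow> uoc (scaled (\<lambda>x. pAd x {i, j} j)) (Ad i)"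
    and D: "uoc (scaled (\<lambda>x. pD x j)) D"
  shows "uoc (scaled (\<lambda>x. pQ x j)) (\<lambda>t. q + (\<Sum>i | {i, j} \<in> edges S p. Ad i t) - D t)"
proof -
  have fin: "finite {i. {i, j} \<in> edges S p}"
    by (rule finite_subset[of _ "{1..S}"]) (use edge_ends in auto)
  have "uoc (\<lambda>l t. scaled (\<lambda>x. pQ x j) l 0 + (\<Sum>i | {i, j} \<in> edges S p. scaled (\<lambda>x. pAd x {i, j} j) l t)
      - scaled (\<lambda>x. pD x j) l t) (\<lambda>t. q + (\<Sum>i | {i, j} \<in> edges S p. Ad i t) - D t)"
    using Ad by (intro uoc_diff uoc_add uoc_const uoc_sum Q0 D fin) auto
  then show ?thesis
  proof (rule uoc_cong)
    show "\<forall>\<^sub>F l in sequentially. \<forall>t\<ge>0. scaled (\<lambda>x. pQ x j) l t = scaled (\<lambda>x. pQ x j) l 0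
      + (\<Sum>i | {i, j} \<in> edges S p. scaled (\<lambda>x. pAd x {i, j} j) l t) - scaled (\<lambda>x. pD x j) l t"
      using scale_pos
    proof eventually_elim
      case (elim l)
      show ?case
      proof (intro allI impI)
        fix t :: real assume "0 \<le> t"
        from Q_eq[OF j elim this]
        show "scaled (\<lambda>x. pQ x j) l t = scaled (\<lambda>x. pQ x j) l 0
            + (\<Sum>i | {i, j} \<in> edges S p. scaled (\<lambda>x. pAd x {i, j} j) l t) - scaled (\<lambda>x. pD x j) l t"
          by (simp add: add_divide_distrib diff_divide_distrib sum_divide_distrib)
      qed
    qed
  qed simp
qed

lemma Z_convergence:
  assumes j: "j \<in> {1..S}" and Q: "uoc (scaled (\<lambda>x. pQ x j)) Q"
  shows "uoc (scaled (\<lambda>x. pZ x j)) (\<lambda>t. min (Q t) (load S p j * lam / \<mu>))"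
proof -
  have "uoc (\<lambda>l t. min (scaled (\<lambda>x. pQ x j) l t) (F (\<rho> l) j / real (\<rho> l)))
      (\<lambda>t. min (Q t) (load S p j * lam / \<mu>))"
    by (intro uoc_min Q uoc_const F_limit j)
  then show ?thesis
    by (rule uoc_cong)
      (use scale_pos in \<open>auto elim!: eventually_mono simp: Z_eq[OF j] min_divide_distrib_right\<close>)
qed

lemma L_convergence:
  assumes Q: "\<And>j. j \<in> {1..S} \<Longrightarrow> uoc (scaled (\<lambda>x. pQ x j)) (Q j)"
  shows "uoc (scaled pL) (\<lambda>t. 1 - (\<Sum>j\<in>{1..S}. max (Q j t - load S p j * lam / \<mu>) 0))"
proof -
  have "uoc (\<lambda>l t. 1 - (\<Sum>j\<in>{1..S}. max (scaled (\<lambda>x. pQ x j) l t - B (\<rho> l) j / real (\<rho> l)) 0))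
      (\<lambda>t. 1 - (\<Sum>j\<in>{1..S}. max (Q j t - load S p j * lam / \<mu>) 0))"
    by (intro uoc_diff uoc_sum uoc_max uoc_const Q B_limit tendsto_const) auto
  then show ?thesis
  proof (rule uoc_cong)
    show "\<forall>\<^sub>F l in sequentially. \<forall>t\<ge>0. scaled pL l t =
        1 - (\<Sum>j\<in>{1..S}. max (scaled (\<lambda>x. pQ x j) l t - B (\<rho> l) j / real (\<rho> l)) 0)"
      using scale_pos
    proof eventually_elim
      case (elim l)
      show ?case
      proof (intro allI impI)
        fix t :: real assume t: "0 \<le> t"
        have "max (scaled (\<lambda>x. pQ x j) l t - B (\<rho> l) j / real (\<rho> l)) 0 =
            max (pQ (xs (\<rho> l)) j t - B (\<rho> l) j) 0 / real (\<rho> l)" for j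
          by (simp add: max_divide_distrib_right diff_divide_distrib)
        then show "scaled pL l t =
            1 - (\<Sum>j\<in>{1..S}. max (scaled (\<lambda>x. pQ x j) l t - B (\<rho> l) j / real (\<rho> l)) 0)"
          using L_eq[OF elim t] elim by (simp add: diff_divide_distrib sum_divide_distrib)
      qed
    qed
  qed simp
qed

end

section \<open>Limits of scaled systems\<close>

locale scaled_limit = scaled_paths +
  fixes y :: ev_path
  assumes convergence: "path_convergence S p \<rho> xs y"
begin

lemma conv_A: "e \<in> edges S p \<Longrightarrow> uoc (scaled (\<lambda>x. pA x e)) (pA y e)"
  and conv_Ad: "e \<in> edges S p \<Longrightarrow> i \<in> e \<Longrightarrow> uoc (scaled (\<lambda>x. pAd x e i)) (pAd y e i)"
  and conv_Q: "j \<in> {1..S} \<Longrightarrow> uoc (scaled (\<lambda>x. pQ x j)) (pQ y j)"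
  and conv_Z: "j \<in> {1..S} \<Longrightarrow> uoc (scaled (\<lambda>x. pZ x j)) (pZ y j)"
  and conv_Y: "uoc (scaled pY) (pY y)"
  and conv_T: "j \<in> {1..S} \<Longrightarrow> uoc (scaled (\<lambda>x. pT x j)) (pT y j)"
  and conv_D: "j \<in> {1..S} \<Longrightarrow> uoc (scaled (\<lambda>x. pD x j)) (pD y j)"
  and conv_L: "uoc (scaled pL) (pL y)"
  using convergence by (auto simp: path_convergence_def)

lemma limit_A_split:
  assumes e: "{i, j} \<in> edges S p" and t: "0 \<le> t"
  shows "pA y {i, j} t = pAd y {i, j} i t + pAd y {i, j} j t"
proof (rule uoc_unique[OF conv_A[OF e] _ t])
  have "uoc (\<lambda>l t. scaled (\<lambda>x. pAd x {i, j} i) l t + scaled (\<lambda>x. pAd x {i, j} j) l t)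
      (\<lambda>t. pAd y {i, j} i t + pAd y {i, j} j t)"
    by (intro uoc_add conv_Ad e) auto
  then show "uoc (scaled (\<lambda>x. pA x {i, j})) (\<lambda>t. pAd y {i, j} i t + pAd y {i, j} j t)"
    by (rule uoc_cong)
      (use scale_pos in \<open>auto elim!: eventually_mono simp: A_split[OF e] add_divide_distrib\<close>)
qed

lemma limit_A_rate: "e \<in> edges S p \<Longrightarrow> 0 \<le> t \<Longrightarrow> pA y e t = p e * lam * pY y t"
  by (rule uoc_unique[OF conv_A A_convergence[OF _ conv_Y]])

lemma limit_D_rate: "j \<in> {1..S} \<Longrightarrow> 0 \<le> t \<Longrightarrow> pD y j t = \<mu> * pT y j t"
  by (rule uoc_unique[OF conv_D D_convergence[OF _ conv_T]])

lemma limit_Q_balance: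
  assumes j: "j \<in> {1..S}" and t: "0 \<le> t"
  shows "pQ y j t = pQ y j 0 + (\<Sum>i | {i, j} \<in> edges S p. pAd y {i, j} j t) - pD y j t"
  by (rule uoc_unique[OF conv_Q[OF j] Q_convergence[OF j uoc_tendsto[OF conv_Q[OF j] order_refl]] t])
    (auto intro!: conv_Ad conv_D j)

lemma limit_Z_eq: "j \<in> {1..S} \<Longrightarrow> 0 \<le> t \<Longrightarrow> pZ y j t = min (pQ y j t) (load S p j * lam / \<mu>)"
  by (rule uoc_unique[OF conv_Z Z_convergence[OF _ conv_Q]])

lemma limit_L_eq: "0 \<le> t \<Longrightarrow> pL y t = 1 - (\<Sum>j\<in>{1..S}. max (pQ y j t - load S p j * lam / \<mu>) 0)"
  by (rule uoc_unique[OF conv_L L_convergence[OF conv_Q]])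

lemma limit_L_nonneg:
  assumes t: "0 \<le> t"
  shows "0 \<le> pL y t"
proof (rule tendsto_lowerbound[OF uoc_tendsto[OF conv_L t]])
  show "\<forall>\<^sub>F l in sequentially. 0 \<le> scaled pL l t"
    using scale_pos by eventually_elim (simp add: L_nonneg t)
qed simp

lemma lipschitz_Y: "\<exists>C. C-lipschitz_on {0..} (pY y)"
proof -
  have "1-lipschitz_on {0..} (pY y)"
  proof (rule uoc_lipschitz_limit[OF conv_Y])
    fix s t \<epsilon> :: real assume "0 \<le> s" "0 \<le> t" "0 < \<epsilon>"
    then show "\<forall>\<^sub>F l in sequentially. \<bar>scaled pY l t - scaled pY l s\<bar> \<le> 1 * \<bar>t - s\<bar> + \<epsilon>"
      using scaled_Y_lipschitz by (auto elim!: eventually_mono intro: add_increasing2)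
  qed simp
  then show ?thesis by blast
qed

lemma lipschitz_T:
  assumes j: "j \<in> {1..S}"
  shows "\<exists>C. C-lipschitz_on {0..} (pT y j)"
proof -
  have "(load S p j * lam / \<mu> + 1)-lipschitz_on {0..} (pT y j)"
  proof (rule uoc_lipschitz_limit[OF conv_T[OF j]])
    fix s t \<epsilon> :: real assume st: "0 \<le> s" "0 \<le> t" "0 < \<epsilon>"
    show "\<forall>\<^sub>F l in sequentially. \<bar>scaled (\<lambda>x. pT x j) l t - scaled (\<lambda>x. pT x j) l s\<bar>
        \<le> (load S p j * lam / \<mu> + 1) * \<bar>t - s\<bar> + \<epsilon>"
      using scaled_T_lipschitz[OF j]
    proof eventually_elim
      case (elim l)
      with st have "\<bar>scaled (\<lambda>x. pT x j) l t - scaled (\<lambda>x. pT x j) l s\<bar>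
        \<le> (load S p j * lam / \<mu> + 1) * \<bar>t - s\<bar>" by blast
      with st show ?case by linarith
    qed
  qed (use load_pos[OF j] lam_pos \<mu>_pos in simp)
  then show ?thesis by blast
qed

lemma lipschitz_Ad:
  assumes e: "e \<in> edges S p" "i \<in> e"
  shows "\<exists>C. C-lipschitz_on {0..} (pAd y e i)"
proof -
  have "(p e * lam)-lipschitz_on {0..} (pAd y e i)"
  proof (rule uoc_lipschitz_limit[OF conv_Ad[OF e]])
    fix s t \<epsilon> :: real assume st: "0 \<le> s" "0 \<le> t" "0 < \<epsilon>"
    then have "0 \<le> max s t" by simp
    from scaled_Ad_lipschitz[OF e this st(3)]
    show "\<forall>\<^sub>F l in sequentially. \<bar>scaled (\<lambda>x. pAd x e i) l t - scaled (\<lambda>x. pAd x e i) l s\<bar>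
        \<le> p e * lam * \<bar>t - s\<bar> + \<epsilon>"
      by eventually_elim (use st in auto)
  qed (use edge_pos[OF e(1)] lam_pos in simp)
  then show ?thesis by blast
qed

lemma lipschitz_D: "j \<in> {1..S} \<Longrightarrow> \<exists>C. C-lipschitz_on {0..} (pD y j)"
  by (rule lipschitz_cong[OF lipschitz_cmult[OF lipschitz_T]]) (auto simp: limit_D_rate)

lemma lipschitz_Q:
  assumes j: "j \<in> {1..S}"
  shows "\<exists>C. C-lipschitz_on {0..} (pQ y j)"
proof -
  have fin: "finite {i. {i, j} \<in> edges S p}"
    by (rule finite_subset[of _ "{1..S}"]) (use edge_ends in auto)
  have "\<exists>C. C-lipschitz_on {0..} (\<lambda>t. pQ y j 0 + (\<Sum>i | {i, j} \<in> edges S p. pAd y {i, j} j t) - pD y j t)"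
    by (intro lipschitz_diff lipschitz_add lipschitz_const lipschitz_sum fin lipschitz_D j lipschitz_Ad) auto
  then show ?thesis by (rule lipschitz_cong) (rule limit_Q_balance[OF j], simp)
qed

lemma lipschitz_Z:
  assumes j: "j \<in> {1..S}"
  shows "\<exists>C. C-lipschitz_on {0..} (pZ y j)"
proof -
  have "\<exists>C. C-lipschitz_on {0..} (\<lambda>t. min (pQ y j t) (load S p j * lam / \<mu>))"
    by (rule lipschitz_contraction[OF lipschitz_Q[OF j]]) linarith
  then show ?thesis by (rule lipschitz_cong) (simp add: limit_Z_eq[OF j])
qed

lemma lipschitz_L: "\<exists>C. C-lipschitz_on {0..} (pL y)"
proof -
  have "\<exists>C. C-lipschitz_on {0..} (\<lambda>t. max (pQ y j t - load S p j * lam / \<mu>) 0)"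
    if "j \<in> {1..S}" for j
    by (rule lipschitz_contraction[OF lipschitz_Q[OF that], where h="\<lambda>a. max (a - load S p j * lam / \<mu>) 0"])
      linarith
  then have "\<exists>C. C-lipschitz_on {0..} (\<lambda>t. 1 - (\<Sum>j\<in>{1..S}. max (pQ y j t - load S p j * lam / \<mu>) 0))"
    by (intro lipschitz_diff lipschitz_const lipschitz_sum) auto
  then show ?thesis by (rule lipschitz_cong) (simp add: limit_L_eq)
qed

lemma limit_lipschitz: "lipschitz_path S p y"
proof -
  have "\<exists>C. C-lipschitz_on {0..} (pA y e)" if "e \<in> edges S p" for e
    by (rule lipschitz_cong[OF lipschitz_cmult[OF lipschitz_Y]]) (use limit_A_rate[OF that] in auto)
  then show ?thesis
    unfolding lipschitz_path_def
    using lipschitz_Ad lipschitz_Q lipschitz_Z lipschitz_Y lipschitz_T lipschitz_D lipschitz_L by blast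
qed

lemma limit_Y_integral: "0 \<le> t \<Longrightarrow> (pL y has_integral pY y t) {0..t}"
proof (rule uoc_has_integral[OF conv_L conv_Y])
  show "continuous_on {0..} (pL y)" using lipschitz_L lipschitz_on_continuous_on by blast
  show "\<forall>\<^sub>F l in sequentially. \<forall>t\<ge>0. (scaled pL l has_integral scaled pY l t) {0..t}"
    using scale_pos by eventually_elim (intro allI impI has_integral_divide Y_integral)
qed

lemma limit_T_integral:
  assumes j: "j \<in> {1..S}" and t: "0 \<le> t"
  shows "(pZ y j has_integral pT y j t) {0..t}"
proof (rule uoc_has_integral[OF conv_Z[OF j] conv_T[OF j] _ _ t])
  show "continuous_on {0..} (pZ y j)" using lipschitz_Z[OF j] lipschitz_on_continuous_on by blast
  show "\<forall>\<^sub>F l in sequentially. \<forall>t\<ge>0.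
      (scaled (\<lambda>x. pZ x j) l has_integral scaled (\<lambda>x. pT x j) l t) {0..t}"
    using scale_pos by eventually_elim (intro allI impI has_integral_divide T_integral j)
qed

text \<open>
  By continuity the limiting levels keep a positive gap near \<open>t\<close>, and by uniform convergence so do those
  of the large systems. There the routed arrivals are constant near \<open>t\<close>, and so is their limit.
\<close>

lemma limit_longer_queue:
  assumes e: "{i, j} \<in> edges S p" and t: "0 \<le> t"
    and less: "pQ y i t / load S p i < pQ y j t / load S p j"
  shows "(pAd y {i, j} j has_real_derivative 0) (at t within {0..})"
proof -
  have ij: "i \<in> {1..S}" "j \<in> {1..S}" using edge_ends[OF e] by auto
  define gap where "gap s = pQ y j s / load S p j - pQ y i s / load S p i" for s
  define \<delta> where "\<delta> = gap t / 2"
  have \<delta>: "0 < \<delta>" using less by (simp add: \<delta>_def gap_def)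
  have "\<exists>C. C-lipschitz_on {0..} gap"
    unfolding gap_def[abs_def] divide_inverse mult.commute[of _ "inverse _"]
    by (intro lipschitz_diff lipschitz_cmult lipschitz_Q ij)
  then have "continuous_on {0..} gap" using lipschitz_on_continuous_on by blast
  then obtain d where d: "0 < d" "\<And>s. 0 \<le> s \<Longrightarrow> dist s t < d \<Longrightarrow> dist (gap s) (gap t) < \<delta>"
    unfolding continuous_on_iff using t \<delta> by (metis atLeast_iff)
  have gap: "\<delta> < gap s" if "0 \<le> s" "dist s t < d" for s
    using d(2)[OF that] unfolding dist_real_def \<delta>_def by linarith
  have "uoc (\<lambda>l s. inverse (load S p j) * scaled (\<lambda>x. pQ x j) l s
      - inverse (load S p i) * scaled (\<lambda>x. pQ x i) l s) gap"
    unfolding gap_def[abs_def] divide_inverse[of _ "load S p _"] mult.commute[of _ "inverse (load S p _)"]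
    by (intro uoc_diff uoc_cmult conv_Q ij)
  from uocD[OF this, of "t + d" \<delta>] have "\<forall>\<^sub>F l in sequentially. \<forall>s\<in>{0..t + d}.
      \<bar>inverse (load S p j) * scaled (\<lambda>x. pQ x j) l s
      - inverse (load S p i) * scaled (\<lambda>x. pQ x i) l s - gap s\<bar> < \<delta>"
    using t d \<delta> by simp
  then have const: "\<forall>\<^sub>F l in sequentially. \<forall>s u. 0 \<le> s \<and> s \<le> u \<and> dist s t < d \<and> dist u t < d \<longrightarrow>
      scaled (\<lambda>x. pAd x {i, j} j) l u = scaled (\<lambda>x. pAd x {i, j} j) l s"
    using scale_pos
  proof eventually_elim
    case (elim l)
    show ?case
    proof (intro allI impI, elim conjE)
      fix s u assume su: "0 \<le> s" "s \<le> u" "dist s t < d" "dist u t < d"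
      have "pAd (xs (\<rho> l)) {i, j} j u = pAd (xs (\<rho> l)) {i, j} j s"
      proof (rule routing[OF e elim(2) su(1,2)])
        fix v assume v: "s \<le> v" "v \<le> u"
        then have vd: "0 \<le> v" "dist v t < d" "v \<in> {0..t + d}" using su by (auto simp: dist_real_def)
        have "\<bar>inverse (load S p j) * scaled (\<lambda>x. pQ x j) l v
            - inverse (load S p i) * scaled (\<lambda>x. pQ x i) l v - gap v\<bar> < \<delta>"
          using elim(1) vd(3) by blast
        with gap[OF vd(1,2)] have "0 < inverse (load S p j) * scaled (\<lambda>x. pQ x j) l v
            - inverse (load S p i) * scaled (\<lambda>x. pQ x i) l v"
          by linarith
        also have "\<dots> = (pQ (xs (\<rho> l)) j v / load S p j - pQ (xs (\<rho> l)) i v / load S p i) / real (\<rho> l)"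
          by (simp add: divide_inverse algebra_simps)
        finally show "pQ (xs (\<rho> l)) i v / load S p i < pQ (xs (\<rho> l)) j v / load S p j"
          using elim(2) by (simp add: zero_less_divide_iff)
      qed
      then show "scaled (\<lambda>x. pAd x {i, j} j) l u = scaled (\<lambda>x. pAd x {i, j} j) l s" by simp
    qed
  qed
  have eq: "pAd y {i, j} j u = pAd y {i, j} j s"
    if su: "0 \<le> s" "s \<le> u" "dist s t < d" "dist u t < d" for s u
  proof (rule LIMSEQ_unique)
    have uo: "uoc (scaled (\<lambda>x. pAd x {i, j} j)) (pAd y {i, j} j)" by (intro conv_Ad e) simp
    show "(\<lambda>l. scaled (\<lambda>x. pAd x {i, j} j) l u) \<longlonglongrightarrow> pAd y {i, j} j u"
      using su by (intro uoc_tendsto[OF uo]) auto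
    have "(\<lambda>l. scaled (\<lambda>x. pAd x {i, j} j) l s) \<longlonglongrightarrow> pAd y {i, j} j s"
      using su by (intro uoc_tendsto[OF uo]) auto
    then show "(\<lambda>l. scaled (\<lambda>x. pAd x {i, j} j) l u) \<longlonglongrightarrow> pAd y {i, j} j s"
    proof (rule Lim_transform_eventually)
      show "\<forall>\<^sub>F l in sequentially. scaled (\<lambda>x. pAd x {i, j} j) l s = scaled (\<lambda>x. pAd x {i, j} j) l u"
        using const by eventually_elim (use su in metis)
    qed
  qed
  have "((\<lambda>_. pAd y {i, j} j t) has_real_derivative 0) (at t within {0..})" by (rule DERIV_const)
  then show ?thesis
  proof (rule has_field_derivative_transform_within[OF _ d(1)])
    fix s assume "s \<in> {0..}" "dist s t < d"
    then show "pAd y {i, j} j t = pAd y {i, j} j s"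
      using eq[of s t] eq[of t s] t d(1) by (cases "s \<le> t") auto
  qed (simp add: t)
qed

sublocale fluid_path S p lam \<mu> y
  by unfold_locales
    (fact limit_A_split limit_A_rate limit_Q_balance limit_D_rate limit_Y_integral limit_T_integral
      limit_Z_eq limit_L_eq limit_L_nonneg lipschitz_Q limit_longer_queue)+

end

section \<open>Existence of fluid limits\<close>

context scaled_paths
begin

text \<open>
  Only the initial queues, the clocks \<open>Y\<close> and \<open>T\<^sub>j\<close> and the routed arrivals need compactness; a further
  subsequence makes all of them converge, and every other component is a continuous function of them.
\<close>

lemma scaled_limit_exists:
  obtains k y where "strict_mono (k :: nat \<Rightarrow> nat)" "path_convergence S p (\<rho> \<circ> k) xs y"
proof -
  \<comment> \<open>indexing the family by the components themselves, viewed as functions of the path\<close>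
  define I :: "(ev_path \<Rightarrow> real \<Rightarrow> real) set" where
    "I = {c. (\<exists>e\<in>edges S p. \<exists>i\<in>e. c = (\<lambda>x. pAd x e i)) \<or> (\<exists>j\<in>{1..S}. c = (\<lambda>x. pT x j)) \<or>
      c = pY \<or> (\<exists>j\<in>{1..S}. c = (\<lambda>x t. pQ x j 0))}"
  have "I = (\<Union>e\<in>edges S p. (\<lambda>i x. pAd x e i) ` e) \<union> (\<lambda>j x. pT x j) ` {1..S} \<union> {pY}
      \<union> (\<lambda>j x t. pQ x j 0) ` {1..S}"
    by (auto simp: I_def)
  moreover have "finite (\<Union>e\<in>edges S p. (\<lambda>i x. pAd x e i) ` e)"
    using finite_edges edgesD by (intro finite_UN_I finite_imageI) (auto intro: finite_subset)
  ultimately have I: "countable I" by (intro countable_finite) auto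
  have lip: "\<exists>C\<ge>0. \<forall>b \<epsilon>. 0 \<le> b \<longrightarrow> 0 < \<epsilon> \<longrightarrow> (\<forall>\<^sub>F l in sequentially. \<forall>s\<in>{0..b}. \<forall>t\<in>{0..b}.
      \<bar>scaled c l t - scaled c l s\<bar> \<le> C * \<bar>t - s\<bar> + \<epsilon>)" if "c \<in> I" for c
  proof -
    have weaken: "\<forall>b \<epsilon>. 0 \<le> b \<longrightarrow> 0 < \<epsilon> \<longrightarrow> (\<forall>\<^sub>F l in sequentially. \<forall>s\<in>{0..b}. \<forall>t\<in>{0..b}.
        \<bar>scaled c l t - scaled c l s\<bar> \<le> C * \<bar>t - s\<bar> + \<epsilon>)"
      if C: "\<forall>\<^sub>F l in sequentially. \<forall>s\<ge>0. \<forall>t\<ge>0. \<bar>scaled c l t - scaled c l s\<bar> \<le> C * \<bar>t - s\<bar>" for C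
    proof (intro allI impI)
      fix b \<epsilon> :: real assume "0 \<le> b" "0 < \<epsilon>"
      from C show "\<forall>\<^sub>F l in sequentially. \<forall>s\<in>{0..b}. \<forall>t\<in>{0..b}.
          \<bar>scaled c l t - scaled c l s\<bar> \<le> C * \<bar>t - s\<bar> + \<epsilon>"
      proof eventually_elim
        case (elim l)
        show ?case
        proof (intro ballI)
          fix s t assume "s \<in> {0..b}" "t \<in> {0..b}"
          then have "\<bar>scaled c l t - scaled c l s\<bar> \<le> C * \<bar>t - s\<bar>"
            by (intro elim[rule_format]) auto
          then show "\<bar>scaled c l t - scaled c l s\<bar> \<le> C * \<bar>t - s\<bar> + \<epsilon>"
            using \<open>0 < \<epsilon>\<close> by (rule order_trans[OF _ less_imp_le[OF less_add_same_cancel1[THEN iffD2]]])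
        qed
      qed
    qed
    from \<open>c \<in> I\<close> consider (Ad) e i where "e \<in> edges S p" "i \<in> e" "c = (\<lambda>x. pAd x e i)"
      | (T) j where "j \<in> {1..S}" "c = (\<lambda>x. pT x j)" | (Y) "c = pY"
      | (Q) j where "j \<in> {1..S}" "c = (\<lambda>x t. pQ x j 0)"
      unfolding I_def by blast
    then show ?thesis
    proof cases
      case Ad
      show ?thesis
        unfolding Ad(3)
        by (rule exI[of _ "p e * lam"])
          (use scaled_Ad_lipschitz[OF Ad(1,2)] edge_pos[OF Ad(1)] lam_pos in simp)
    next
      case T
      have "0 \<le> load S p j * lam / \<mu> + 1" using load_pos[OF T(1)] lam_pos \<mu>_pos by simp
      with weaken[of "load S p j * lam / \<mu> + 1"] scaled_T_lipschitz[OF T(1)] show ?thesis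
        unfolding T(2) by blast
    next
      case Y
      have "(0::real) \<le> 1" by simp
      with weaken[of 1] scaled_Y_lipschitz show ?thesis unfolding Y by blast
    next
      case Q
      have "\<forall>\<^sub>F l in sequentially. \<forall>s\<ge>0. \<forall>t\<ge>0. \<bar>scaled c l t - scaled c l s\<bar> \<le> 0 * \<bar>t - s\<bar>"
        unfolding Q(2) by simp
      with weaken[of 0] show ?thesis by blast
    qed
  qed
  then have "\<forall>c\<in>I. \<exists>C. 0 \<le> C \<and> (\<forall>b \<epsilon>. 0 \<le> b \<longrightarrow> 0 < \<epsilon> \<longrightarrow>
      (\<forall>\<^sub>F l in sequentially. \<forall>s\<in>{0..b}. \<forall>t\<in>{0..b}.
        \<bar>scaled c l t - scaled c l s\<bar> \<le> C * \<bar>t - s\<bar> + \<epsilon>))"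
    by blast
  from bchoice[OF this] obtain C where C: "\<And>c. c \<in> I \<Longrightarrow> 0 \<le> C c"
    "\<And>c b \<epsilon>. c \<in> I \<Longrightarrow> 0 \<le> b \<Longrightarrow> 0 < \<epsilon> \<Longrightarrow> \<forall>\<^sub>F l in sequentially. \<forall>s\<in>{0..b}. \<forall>t\<in>{0..b}.
      \<bar>scaled c l t - scaled c l s\<bar> \<le> C c * \<bar>t - s\<bar> + \<epsilon>"
    by blast
  have start: "Bseq (\<lambda>l. scaled c l 0)" if "c \<in> I" for c
  proof -
    from \<open>c \<in> I\<close> consider (Ad) e i where "e \<in> edges S p" "i \<in> e" "c = (\<lambda>x. pAd x e i)"
      | (T) j where "j \<in> {1..S}" "c = (\<lambda>x. pT x j)" | (Y) "c = pY"
      | (Q) j where "j \<in> {1..S}" "c = (\<lambda>x t. pQ x j 0)"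
      unfolding I_def by blast
    then show ?thesis
    proof cases
      case Ad
      have "(\<lambda>l. real (La e (real (\<rho> l) * 0)) / real (\<rho> l)) \<longlonglongrightarrow> p e * lam * 0"
        using uoc_subseq[OF lln_arrivals[OF Ad(1)] scale] by (rule uoc_tendsto) simp
      then have "(\<lambda>l. real (La e 0) / real (\<rho> l)) \<longlonglongrightarrow> 0" by simp
      then have small: "\<forall>\<^sub>F l in sequentially. real (La e 0) / real (\<rho> l) < 1"
        by (rule order_tendstoD) simp
      obtain a b where ab: "e = {a, b}" by (rule edgeE[OF Ad(1)])
      have "\<forall>\<^sub>F l in sequentially. norm (scaled c l 0) \<le> 1"
        using small scale_pos
      proof eventually_elim
        case (elim l)
        have "pAd (xs (\<rho> l)) e i 0 \<le> pAd (xs (\<rho> l)) e a 0 + pAd (xs (\<rho> l)) e b 0"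
          using Ad(2) Ad_nonneg[OF Ad(1) _ elim(2), of a 0] Ad_nonneg[OF Ad(1) _ elim(2), of b 0]
          by (auto simp: ab)
        also have "\<dots> = real (La e 0)"
          using A_split[of a b "\<rho> l" 0] A_eq[OF Ad(1) elim(2), of 0] Y_zero[OF elim(2)] Ad(1) elim(2)
          by (simp add: ab)
        finally have le: "pAd (xs (\<rho> l)) e i 0 \<le> real (La e 0)" .
        have "0 \<le> pAd (xs (\<rho> l)) e i 0" by (rule Ad_nonneg[OF Ad(1,2) elim(2)]) simp
        with divide_right_mono[OF le, of "real (\<rho> l)"] elim(1) show ?case
          unfolding Ad(3) by simp
      qed
      then show ?thesis by (rule BfunI)
    next
      case T
      have "\<forall>\<^sub>F l in sequentially. norm (scaled c l 0) \<le> 0"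
        using scale_pos by eventually_elim (simp add: T(2) T_zero[OF T(1)])
      then show ?thesis by (rule BfunI)
    next
      case Y
      have "\<forall>\<^sub>F l in sequentially. norm (scaled c l 0) \<le> 0"
        using scale_pos by eventually_elim (simp add: Y Y_zero)
      then show ?thesis by (rule BfunI)
    next
      case Q
      have "\<forall>\<^sub>F l in sequentially. B (\<rho> l) j / real (\<rho> l) < load S p j * lam / \<mu> + 1"
        by (rule order_tendstoD[OF B_limit[OF Q(1)]]) simp
      then have "\<forall>\<^sub>F l in sequentially. norm (scaled c l 0) \<le> load S p j * lam / \<mu> + 2"
        using scale_pos
      proof eventually_elim
        case (elim l)
        have "0 \<le> pQ (xs (\<rho> l)) j 0" by (rule Q_nonneg[OF Q(1) elim(2)]) simp
        moreover have "pQ (xs (\<rho> l)) j 0 / real (\<rho> l) \<le> (B (\<rho> l) j + real (\<rho> l)) / real (\<rho> l)"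
          by (intro divide_right_mono Q_bound Q(1) elim(2)) auto
        ultimately show ?case using elim by (simp add: Q(2) add_divide_distrib)
      qed
      then show ?thesis by (rule BfunI)
    qed
  qed
  have "\<exists>k g. strict_mono (k :: nat \<Rightarrow> nat) \<and> (\<forall>c\<in>I. uoc (\<lambda>l. scaled c (k l)) (g c))"
  proof (rule uoc_convergent_subsequence[where f="\<lambda>c l. scaled c l" and I=I and C=C])
    fix k :: "nat \<Rightarrow> nat" and g
    assume "strict_mono k" "\<And>c. c \<in> I \<Longrightarrow> uoc (\<lambda>l. scaled c (k l)) (g c)"
    then show ?thesis by blast
  qed (use I C start in blast)+
  then obtain k g where k: "strict_mono (k :: nat \<Rightarrow> nat)"
    and g: "\<And>c. c \<in> I \<Longrightarrow> uoc (\<lambda>l. scaled c (k l)) (g c)"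
    by blast
  interpret sub: scaled_paths S p lam \<mu> \<beta> \<gamma> B F La Sv xs "\<rho> \<circ> k"
  proof unfold_locales
    show "filterlim (\<rho> \<circ> k) at_top sequentially"
      unfolding comp_def by (rule filterlim_compose[OF scale filterlim_subseq[OF k]])
  qed (fact capacity_B capacity_F lln_arrivals lln_services paths)+
  define Y where "Y = g pY"
  define T where "T j = g (\<lambda>x. pT x j)" for j
  define Ad where "Ad e i = g (\<lambda>x. pAd x e i)" for e i
  \<comment> \<open>the initial queues enter as constant functions of time, read off at time 0\<close>
  define Q where "Q j t = g (\<lambda>x t. pQ x j 0) 0 + (\<Sum>i | {i, j} \<in> edges S p. Ad {i, j} j t) - \<mu> * T j t"
    for j t
  define y where "y = \<lparr>pA = \<lambda>e t. p e * lam * Y t, pAd = Ad, pQ = Q,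
    pZ = \<lambda>j t. min (Q j t) (load S p j * lam / \<mu>), pY = Y, pT = T, pD = \<lambda>j t. \<mu> * T j t,
    pL = \<lambda>t. 1 - (\<Sum>j\<in>{1..S}. max (Q j t - load S p j * lam / \<mu>) 0)\<rparr>"
  have cY: "uoc (sub.scaled pY) Y" using g[of pY] by (simp add: I_def Y_def)
  have cT: "uoc (sub.scaled (\<lambda>x. pT x j)) (T j)" if "j \<in> {1..S}" for j
  proof -
    have "(\<lambda>x. pT x j) \<in> I" using that unfolding I_def by blast
    from g[OF this] show ?thesis by (simp add: T_def)
  qed
  have cAd: "uoc (sub.scaled (\<lambda>x. pAd x e i)) (Ad e i)" if "e \<in> edges S p" "i \<in> e" for e i
  proof -
    have "(\<lambda>x. pAd x e i) \<in> I" using that unfolding I_def by blast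
    from g[OF this] show ?thesis by (simp add: Ad_def)
  qed
  have cQ0: "(\<lambda>l. sub.scaled (\<lambda>x. pQ x j) l 0) \<longlonglongrightarrow> g (\<lambda>x t. pQ x j 0) 0" if "j \<in> {1..S}" for j
  proof -
    have "(\<lambda>x t. pQ x j 0) \<in> I" using that unfolding I_def by blast
    from uoc_tendsto[OF g[OF this], of 0] show ?thesis by simp
  qed
  have cD: "uoc (sub.scaled (\<lambda>x. pD x j)) (\<lambda>t. \<mu> * T j t)" if "j \<in> {1..S}" for j
    by (rule sub.D_convergence[OF that cT[OF that]])
  have cQ: "uoc (sub.scaled (\<lambda>x. pQ x j)) (Q j)" if j: "j \<in> {1..S}" for j
    unfolding Q_def[abs_def] by (rule sub.Q_convergence[OF j cQ0[OF j] cAd cD[OF j]]) auto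
  have "path_convergence S p (\<rho> \<circ> k) xs y"
    unfolding path_convergence_def
    using sub.A_convergence[OF _ cY] cAd cQ sub.Z_convergence[OF _ cQ] cY cT cD
      sub.L_convergence[OF cQ]
    by (simp add: y_def)
  with k show thesis by (rule that)
qed

end

section \<open>Initial states\<close>

context station_network
begin

text \<open>
  Rounding down \<open>r q\<^sub>j\<close> is not enough: when the excess of \<open>q\<close> over \<open>c\<close> adds up to exactly \<open>1\<close>, the lower
  order terms of the capacities may leave more than \<open>r\<close> vehicles waiting. Truncating at
  \<open>B\<^sub>j + r (q\<^sub>j - c\<^sub>j)\<^sup>+\<close> enforces the constraint and does not change the limit.
\<close>

lemma initial_states_approximate:
  assumes B: "capacity S p lam \<mu> \<beta> B" and q: "q \<in> fluid_states S p lam \<mu>"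
  obtains n where "\<And>r. n r \<in> initial_states S r (B r)"
    "\<And>j. j \<in> {1..S} \<Longrightarrow> (\<lambda>r. real (n r j) / real r) \<longlonglongrightarrow> q j"
proof -
  define c where "c j = load S p j * lam / \<mu>" for j
  have q0: "0 \<le> q j" if "j \<in> {1..S}" for j using q that by (auto simp: fluid_states_def PiE_def Pi_def)
  have qsum: "(\<Sum>j\<in>{1..S}. max (q j - c j) 0) \<le> 1" using q by (simp add: fluid_states_def c_def)
  have B0: "0 \<le> B r j" if "j \<in> {1..S}" for r j using B that by (auto simp: capacity_def)
  define v where "v r j = min (real r * q j) (B r j + real r * max (q j - c j) 0)" for r j
  have v0: "0 \<le> v r j" if "j \<in> {1..S}" for r j
    using q0[OF that] B0[OF that, of r] by (simp add: v_def)
  define n where "n r = (\<lambda>j\<in>{1..S}. nat \<lfloor>v r j\<rfloor>)" for r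
  have n: "real (n r j) \<le> v r j" "v r j - 1 \<le> real (n r j)" if "j \<in> {1..S}" for r j
  proof -
    have "n r j = nat \<lfloor>v r j\<rfloor>" using that by (simp add: n_def)
    with v0[OF that, of r] show "real (n r j) \<le> v r j" "v r j - 1 \<le> real (n r j)" by linarith+
  qed
  show thesis
  proof (rule that)
    fix r
    have "(\<Sum>j\<in>{1..S}. max (real (n r j) - B r j) 0) \<le> (\<Sum>j\<in>{1..S}. real r * max (q j - c j) 0)"
    proof (rule sum_mono)
      fix j assume j: "j \<in> {1..S}"
      have "0 \<le> real r * max (q j - c j) 0" by simp
      with n(1)[OF j, of r] show "max (real (n r j) - B r j) 0 \<le> real r * max (q j - c j) 0"
        unfolding v_def by linarith
    qed
    also have "\<dots> \<le> real r * 1"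
      unfolding sum_distrib_left[symmetric] by (intro mult_left_mono qsum) simp
    finally show "n r \<in> initial_states S r (B r)" by (simp add: initial_states_def n_def)
  next
    fix j assume j: "j \<in> {1..S}"
    have "(\<lambda>r. min (q j) (B r j / real r + max (q j - c j) 0)) \<longlonglongrightarrow> min (q j) (c j + max (q j - c j) 0)"
      unfolding c_def by (intro tendsto_min tendsto_intros capacity_limit[OF B j lam_pos \<mu>_pos])
    also have "min (q j) (c j + max (q j - c j) 0) = q j" by (simp add: min_def max_def)
    finally have lim: "(\<lambda>r. min (q j) (B r j / real r + max (q j - c j) 0)) \<longlonglongrightarrow> q j" .
    have veq: "v r j / real r = min (q j) (B r j / real r + max (q j - c j) 0)" if "0 < r" for r
      using that unfolding v_def by (simp add: min_divide_distrib_right add_divide_distrib)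
    have "(\<lambda>r. 1 / real r) \<longlonglongrightarrow> 0" by real_asymp
    from tendsto_diff[OF lim this]
    have low: "(\<lambda>r. min (q j) (B r j / real r + max (q j - c j) 0) - 1 / real r) \<longlonglongrightarrow> q j" by simp
    show "(\<lambda>r. real (n r j) / real r) \<longlonglongrightarrow> q j"
    proof (rule tendsto_sandwich[OF _ _ low lim])
      show "\<forall>\<^sub>F r in sequentially. min (q j) (B r j / real r + max (q j - c j) 0) - 1 / real r \<le> real (n r j) / real r"
        using eventually_gt_at_top[of 0]
      proof eventually_elim
        case (elim r)
        have "(v r j - 1) / real r \<le> real (n r j) / real r" by (intro divide_right_mono n(2) j) simp
        then show ?case using veq[OF elim] by (simp add: diff_divide_distrib)
      qed
      show "\<forall>\<^sub>F r in sequentially. real (n r j) / real r \<le> min (q j) (B r j / real r + max (q j - c j) 0)"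
        using eventually_gt_at_top[of 0]
      proof eventually_elim
        case (elim r)
        have "real (n r j) / real r \<le> v r j / real r" by (intro divide_right_mono n(1) j) simp
        then show ?case using veq[OF elim] by simp
      qed
    qed
  qed
qed

end

section \<open>The fluid limit theorem\<close>

text \<open>
  An invariant state \<open>q\<close> is tested on one fluid limit that starts in \<open>q\<close>, for any outcome at which the
  law of large numbers holds; such an outcome exists since these have probability one.
\<close>

theorem theorem4p4:
  fixes M :: "'w measure" and S :: nat and p :: "nat set \<Rightarrow> real"
    and lam \<mu> \<beta> \<gamma> :: real and B F :: "nat \<Rightarrow> nat \<Rightarrow> real"
    and \<Lambda> :: "nat set \<Rightarrow> real \<Rightarrow> 'w \<Rightarrow> nat" and Sv :: "nat \<Rightarrow> real \<Rightarrow> 'w \<Rightarrow> nat"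
    and X :: "nat \<Rightarrow> (nat \<Rightarrow> nat) \<Rightarrow> 'w \<Rightarrow> ev_path"
  assumes "2 \<le> S" and "0 < lam" and "0 < \<mu>" and "\<gamma> \<le> \<beta>"
    and "\<forall>e\<in>pairs S. 0 \<le> p e" and "(\<Sum>e\<in>pairs S. p e) = 1"
    and "connected_graph {1..S} (edges S p)"
    and "capacity S p lam \<mu> \<beta> B" and "capacity S p lam \<mu> \<gamma> F"
    and "prob_space M" and "driving_processes M S p lam \<mu> \<Lambda> Sv"
    and "swapping_systems M S p B F \<Lambda> Sv X"
  shows
    "measure M (lln_set M S p lam \<mu> \<Lambda> Sv) = 1 \<and>
     (\<forall>\<nu>. initial_sequence M S B \<nu> \<longrightarrow>
        (\<forall>\<omega>\<in>lln_set M S p lam \<mu> \<Lambda> Sv. \<exists>y. fluid_limit_at S p (start_from X \<nu>) \<omega> y) \<and>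
        (\<forall>y. fluid_limit M S p lam \<mu> \<Lambda> Sv (start_from X \<nu>) y \<longrightarrow>
           lipschitz_path S p y \<and>
           (\<forall>t\<ge>0.
              (\<forall>i j. {i, j} \<in> edges S p \<longrightarrow> pA y {i, j} t = pAd y {i, j} i t + pAd y {i, j} j t) \<and>
              (\<forall>e\<in>edges S p. pA y e t = p e * lam * pY y t) \<and>
              (\<forall>j\<in>{1..S}. pQ y j t =
                 pQ y j 0 + (\<Sum>i | {i, j} \<in> edges S p. pAd y {i, j} j t) - pD y j t) \<and>
              (\<forall>j\<in>{1..S}. pD y j t = \<mu> * pT y j t) \<and>
              (pL y has_integral pY y t) {0..t} \<and>
              (\<forall>j\<in>{1..S}. (pZ y j has_integral pT y j t) {0..t}) \<and>
              (\<forall>j\<in>{1..S}. pZ y j t = min (pQ y j t) (load S p j * lam / \<mu>)) \<and>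
              pL y t = 1 - (\<Sum>j\<in>{1..S}. max (pQ y j t - load S p j * lam / \<mu>) 0)) \<and>
           (\<forall>i j t. {i, j} \<in> edges S p \<and> regular_point S p y t \<and>
              pQ y j t / load S p j > pQ y i t / load S p i \<longrightarrow>
              (pAd y {i, j} i has_real_derivative lam * p {i, j} * pL y t) (at t within {0..}) \<and>
              (pAd y {i, j} j has_real_derivative 0) (at t within {0..})))) \<and>
     {q. invariant_state M S p lam \<mu> B \<Lambda> Sv X q} = {\<lambda>i\<in>{1..S}. load S p i * lam / \<mu>}"
proof -
  let ?N = "lln_set M S p lam \<mu> \<Lambda> Sv"
  interpret station_network S p lam \<mu> using assms by unfold_locales auto
  interpret prob_space M by fact
  have prob: "measure M ?N = 1"
    using lln_set_prob[OF _ \<mu>_pos assms(11)] edge_pos lam_pos by simp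
  have paths: "scaled_paths S p lam \<mu> \<beta> \<gamma> B F (\<lambda>e t. \<Lambda> e t \<omega>) (\<lambda>j t. Sv j t \<omega>)
      (\<lambda>r. start_from X \<nu> r \<omega>) \<rho>"
    if \<omega>: "\<omega> \<in> ?N" and \<nu>: "initial_sequence M S B \<nu>" and \<rho>: "filterlim \<rho> at_top sequentially"
    for \<omega> \<nu> \<rho>
  proof unfold_locales
    fix r :: nat assume r: "1 \<le> r"
    have \<omega>M: "\<omega> \<in> space M" using \<omega> by (simp add: lln_set_def)
    have "\<nu> r \<omega> \<in> initial_states S r (B r)" using \<nu> r \<omega>M by (simp add: initial_sequence_def)
    with assms(12) r \<omega>M obtain U where "system_path S p r (B r) (F r) (\<lambda>e t. \<Lambda> e t \<omega>) (\<lambda>j t. Sv j t \<omega>)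
        (\<lambda>e k. U e k \<omega>) (X r (\<nu> r \<omega>) \<omega>)"
      unfolding swapping_systems_def by blast
    then show "\<exists>U. system_path S p r (B r) (F r) (\<lambda>e t. \<Lambda> e t \<omega>) (\<lambda>j t. Sv j t \<omega>) U (start_from X \<nu> r \<omega>)"
      unfolding start_from_def by blast
  qed (use assms \<omega> \<rho> in \<open>simp_all add: lln_set_def\<close>)
  have start: "pQ (start_from X \<nu> r \<omega>) j 0 = real (\<nu> r \<omega> j)"
    if "\<omega> \<in> ?N" "initial_sequence M S B \<nu>" "1 \<le> r" "j \<in> {1..S}" for \<omega> \<nu> r j
  proof -
    have \<omega>M: "\<omega> \<in> space M" using that by (simp add: lln_set_def)
    have "\<nu> r \<omega> \<in> initial_states S r (B r)" using that \<omega>M by (simp add: initial_sequence_def)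
    with assms(12) that \<omega>M show ?thesis unfolding swapping_systems_def start_from_def by blast
  qed
  have exists: "\<exists>y. fluid_limit_at S p (start_from X \<nu>) \<omega> y"
    if "\<omega> \<in> ?N" "initial_sequence M S B \<nu>" for \<omega> \<nu>
  proof -
    interpret scaled_paths S p lam \<mu> \<beta> \<gamma> B F "\<lambda>e t. \<Lambda> e t \<omega>" "\<lambda>j t. Sv j t \<omega>"
      "\<lambda>r. start_from X \<nu> r \<omega>" "\<lambda>l. l"
      by (rule paths[OF that filterlim_ident])
    obtain k y where "strict_mono (k :: nat \<Rightarrow> nat)"
      "path_convergence S p ((\<lambda>l. l) \<circ> k) (\<lambda>r. start_from X \<nu> r \<omega>) y"
      by (rule scaled_limit_exists)
    then show ?thesis unfolding fluid_limit_at_def comp_def using filterlim_subseq by blast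
  qed
  have limit: "\<exists>\<omega> \<rho>. scaled_limit S p lam \<mu> \<beta> \<gamma> B F (\<lambda>e t. \<Lambda> e t \<omega>) (\<lambda>j t. Sv j t \<omega>)
      (\<lambda>r. start_from X \<nu> r \<omega>) \<rho> y"
    if fl: "fluid_limit M S p lam \<mu> \<Lambda> Sv (start_from X \<nu>) y" and \<nu>: "initial_sequence M S B \<nu>" for \<nu> y
  proof -
    obtain \<omega> \<rho> where "\<omega> \<in> ?N" "filterlim \<rho> at_top sequentially"
      "path_convergence S p \<rho> (\<lambda>r. start_from X \<nu> r \<omega>) y"
      using fl unfolding fluid_limit_def fluid_limit_at_def by blast
    then have "scaled_limit S p lam \<mu> \<beta> \<gamma> B F (\<lambda>e t. \<Lambda> e t \<omega>) (\<lambda>j t. Sv j t \<omega>)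
        (\<lambda>r. start_from X \<nu> r \<omega>) \<rho> y"
      using paths \<nu> by (intro scaled_limit.intro scaled_limit_axioms.intro)
    then show ?thesis by blast
  qed
  have fluid: "fluid_path S p lam \<mu> y" "lipschitz_path S p y"
    if lim: "fluid_limit M S p lam \<mu> \<Lambda> Sv (start_from X \<nu>) y" "initial_sequence M S B \<nu>" for \<nu> y
  proof -
    obtain \<omega> \<rho> where "scaled_limit S p lam \<mu> \<beta> \<gamma> B F (\<lambda>e t. \<Lambda> e t \<omega>) (\<lambda>j t. Sv j t \<omega>)
      (\<lambda>r. start_from X \<nu> r \<omega>) \<rho> y" using limit[OF lim] by blast
    then interpret scaled_limit S p lam \<mu> \<beta> \<gamma> B F "\<lambda>e t. \<Lambda> e t \<omega>" "\<lambda>j t. Sv j t \<omega>"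
      "\<lambda>r. start_from X \<nu> r \<omega>" \<rho> y .
    show "fluid_path S p lam \<mu> y" by (rule fluid_path_axioms)
    show "lipschitz_path S p y" by (rule limit_lipschitz)
  qed
  have equations: "(\<forall>t\<ge>0.
              (\<forall>i j. {i, j} \<in> edges S p \<longrightarrow> pA y {i, j} t = pAd y {i, j} i t + pAd y {i, j} j t) \<and>
              (\<forall>e\<in>edges S p. pA y e t = p e * lam * pY y t) \<and>
              (\<forall>j\<in>{1..S}. pQ y j t =
                 pQ y j 0 + (\<Sum>i | {i, j} \<in> edges S p. pAd y {i, j} j t) - pD y j t) \<and>
              (\<forall>j\<in>{1..S}. pD y j t = \<mu> * pT y j t) \<and>
              (pL y has_integral pY y t) {0..t} \<and>
              (\<forall>j\<in>{1..S}. (pZ y j has_integral pT y j t) {0..t}) \<and>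
              (\<forall>j\<in>{1..S}. pZ y j t = min (pQ y j t) (load S p j * lam / \<mu>)) \<and>
              pL y t = 1 - (\<Sum>j\<in>{1..S}. max (pQ y j t - load S p j * lam / \<mu>) 0)) \<and>
           (\<forall>i j t. {i, j} \<in> edges S p \<and> regular_point S p y t \<and>
              pQ y j t / load S p j > pQ y i t / load S p i \<longrightarrow>
              (pAd y {i, j} i has_real_derivative lam * p {i, j} * pL y t) (at t within {0..}) \<and>
              (pAd y {i, j} j has_real_derivative 0) (at t within {0..}))"
    if "fluid_path S p lam \<mu> y" for y
  proof -
    interpret fluid_path S p lam \<mu> y by fact
    show ?thesis
      unfolding regular_point_def
      by (intro conjI allI impI ballI; (elim conjE)?;
          (rule A_split A_rate Q_balance D_rate Y_integral T_integral Z_eq L_eq shorter_queue longer_queue;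
            assumption))
  qed
  define q0 where "q0 = (\<lambda>i\<in>{1..S}. load S p i * lam / \<mu>)"
  have "invariant_state M S p lam \<mu> B \<Lambda> Sv X q0"
    unfolding invariant_state_def
  proof (intro conjI allI impI ballI)
    show "q0 \<in> fluid_states S p lam \<mu>"
      using load_pos lam_pos \<mu>_pos by (auto simp: fluid_states_def q0_def less_imp_le)
    fix \<nu> y j and t :: real
    assume *: "initial_sequence M S B \<nu> \<and> fluid_limit M S p lam \<mu> \<Lambda> Sv (start_from X \<nu>) y \<and>
        (\<forall>j\<in>{1..S}. pQ y j 0 = q0 j)" and t: "0 \<le> t" and j: "j \<in> {1..S}"
    then interpret fluid_path S p lam \<mu> y using fluid(1) by blast
    have "pQ y j t = load S p j * lam / \<mu>"
      by (rule equilibrium_path_constant[OF _ t j]) (use * in \<open>simp add: q0_def\<close>)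
    then show "pQ y j t = q0 j" using j by (simp add: q0_def)
  qed
  moreover have "q = q0" if inv: "invariant_state M S p lam \<mu> B \<Lambda> Sv X q" for q
  proof -
    have q: "q \<in> fluid_states S p lam \<mu>" using inv by (simp add: invariant_state_def)
    obtain n where n: "\<And>r. n r \<in> initial_states S r (B r)"
      "\<And>j. j \<in> {1..S} \<Longrightarrow> (\<lambda>r. real (n r j) / real r) \<longlonglongrightarrow> q j"
      using initial_states_approximate[OF assms(8) q] by blast
    define \<nu> where "\<nu> r \<omega> = n r" for r and \<omega> :: 'w
    have \<nu>: "initial_sequence M S B \<nu>" using n(1) by (simp add: initial_sequence_def \<nu>_def)
    have "?N \<noteq> {}" using prob by auto
    then obtain \<omega> where \<omega>: "\<omega> \<in> ?N" by blast
    obtain \<rho> y where \<rho>: "filterlim \<rho> at_top sequentially"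
      and y: "path_convergence S p \<rho> (\<lambda>r. start_from X \<nu> r \<omega>) y"
      using exists[OF \<omega> \<nu>] unfolding fluid_limit_at_def by blast
    have lim: "fluid_limit M S p lam \<mu> \<Lambda> Sv (start_from X \<nu>) y"
      unfolding fluid_limit_def fluid_limit_at_def using \<omega> \<rho> y by blast
    have y0: "pQ y j 0 = q j" if j: "j \<in> {1..S}" for j
    proof (rule LIMSEQ_unique)
      have "uoc (\<lambda>l t. pQ (start_from X \<nu> (\<rho> l) \<omega>) j t / real (\<rho> l)) (pQ y j)"
        using y j by (simp add: path_convergence_def)
      then show "(\<lambda>l. pQ (start_from X \<nu> (\<rho> l) \<omega>) j 0 / real (\<rho> l)) \<longlonglongrightarrow> pQ y j 0"
        by (rule uoc_tendsto) simp
      have "\<forall>\<^sub>F l in sequentially. 1 \<le> \<rho> l" using \<rho> by (simp add: filterlim_at_top)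
      then have "\<forall>\<^sub>F l in sequentially. real (n (\<rho> l) j) / real (\<rho> l) =
          pQ (start_from X \<nu> (\<rho> l) \<omega>) j 0 / real (\<rho> l)"
        by eventually_elim (simp add: start[OF \<omega> \<nu> _ j] \<nu>_def)
      with filterlim_compose[OF n(2)[OF j] \<rho>]
      show "(\<lambda>l. pQ (start_from X \<nu> (\<rho> l) \<omega>) j 0 / real (\<rho> l)) \<longlonglongrightarrow> q j"
        by (rule Lim_transform_eventually)
    qed
    have const: "pQ y j t = q j" if "j \<in> {1..S}" "0 \<le> t" for j t
      using inv \<nu> lim y0 that unfolding invariant_state_def by blast
    interpret fluid_path S p lam \<mu> y by (rule fluid(1)[OF lim \<nu>])
    have "q j = load S p j * lam / \<mu>" if "j \<in> {1..S}" for j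
      by (rule constant_path_equilibrium[OF const that])
    moreover have "q \<in> extensional {1..S}" using q by (auto simp: fluid_states_def PiE_def)
    ultimately show "q = q0" by (auto simp: q0_def intro!: extensionalityI[of _ "{1..S}"])
  qed
  ultimately have "{q. invariant_state M S p lam \<mu> B \<Lambda> Sv X q} = {q0}" by blast
  then show ?thesis
    unfolding q0_def using prob exists equations[OF fluid(1)] fluid(2) by blast
qed

end
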